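(* Let $(\mathsf{X},\mathsf{d})$ be a geodesic metric space and let $f:\mathsf{X}\to\mathbb{R}\cup\{+\infty\}$ be a lower semicontinuous function such that, for some $\lambda\in\mathbb{R}$, for every $x\in\mathsf{X}$ there exists an $\mathrm{EVI}_\lambda$ gradient flow trajectory for $f$ starting from $x$. Let $\{\epsilon_h\}_h$ be a sequence of positive real numbers with $\epsilon_h\searrow 0$. Let $\{x_0^h\}_h,\{x_1^h\}_h\subseteq\mathsf{X}$ be two sequences with $x_0^h\to x_0$, $x_1^h\to x_1$ and $$\limsup_h f(x_0^h)\le f(x_0)<\infty\quad\text{and}\quad \limsup_h f(x_1^h)\le f(x_1)<\infty.$$ Then the functionals $\Theta^{\epsilon_h f}_{x_0^h,x_1^h}$ $\Gamma$-converge to $\Theta^{0}_{x_0,x_1}$ with respect to the topology of $\mathrm{C}([0,1],\mathsf{X})$ (uniform convergence), where $\Theta^0$ denotes the functional associated with the function identically equal to $0$.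
   Context: A metric space is geodesic if any two points are joined by a constant speed geodesic. $D(f)=\{x: f(x)<+\infty\}$. $\mathrm{EVI}_\lambda$ gradient flow trajectory for $f$ starting at $x$: a curve $t\in[0,+\infty)\mapsto x_t\in\mathsf{X}$ with $x_t\in D(f)$ for $t>0$, locally absolutely continuous in $(0,+\infty)$, with $\lim_{t\searrow0}x_t=x_0=x$, and such that for every $v\in D(f)$ $$\frac12\frac{d}{dt}\mathsf{d}(x_t,v)^2+\frac{\lambda}{2}\mathsf{d}(x_t,v)^2\le f(v)-f(x_t)\quad\text{for a.e. }t\in(0,+\infty).$$ Descending slope: $|\partial f|(x)=+\infty$ if $x\notin D(f)$; $|\partial f|(x)=0$ if $x\in D(f)$ is isolated; otherwise $|\partial f|(x)=\limsup_{y\to x}\frac{(f(y)-f(x))^-}{\mathsf{d}(y,x)}$, where $a^-=\max\{-a,0\}$. For $x_0,x_1\in\mathsf{X}$ the functional $\Theta^f_{x_0,x_1}:\mathrm{C}([0,1],\mathsf{X})\to[0,+\infty]$ is $$\Theta^f_{x_0,x_1}(\gamma)=\int_0^1 |\dot\gamma|^2(t)+|\partial f|^2(\gamma(t))\,dt$$ if $\gamma$ is absolutely continuous with $\gamma(0)=x_0$, $\gamma(1)=x_1$, and $\Theta^f_{x_0,x_1}(\gamma)=+\infty$ otherwise. Here $|\dot\gamma|$ is the metric derivative. $\Gamma$-convergence of functionals $F^h$ to $F$ on a metric space $Y$ (here $Y=\mathrm{C}([0,1],\mathsf{X})$ with the uniform distance) means: (i) if $y^h\to y$ then $F(y)\le\liminf_h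 F^h(y^h)$; (ii) for every $y\in Y$ there is $y^h\to y$ with $\limsup_h F^h(y^h)\le F(y)$. *)

theory Defs
  imports "HOL-Analysis.Analysis"
begin

definition geodesic_space :: "'a::metric_space itself \<Rightarrow> bool" where
  "geodesic_space _ \<longleftrightarrow>
     (\<forall>x y :: 'a. \<exists>\<gamma> :: real \<Rightarrow> 'a. \<gamma> 0 = x \<and> \<gamma> 1 = y \<and>
        (\<forall>s\<in>{0..1}. \<forall>t\<in>{0..1}. dist (\<gamma> s) (\<gamma> t) = \<bar>s - t\<bar> * dist x y))"

definition lower_semicontinuous :: "('a::topological_space \<Rightarrow> ereal) \<Rightarrow> bool" where
  "lower_semicontinuous f \<longleftrightarrow> (\<forall>x. f x \<le> Liminf (at x) f)"

definition effective_domain :: "('a \<Rightarrow> ereal) \<Rightarrow> 'a set" where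
  "effective_domain f = {x. f x < \<infinity>}"

definition ac_curve_on :: "real \<Rightarrow> real \<Rightarrow> (real \<Rightarrow> 'a::metric_space) \<Rightarrow> bool" where
  "ac_curve_on a b \<gamma> \<longleftrightarrow>
     (\<exists>g :: real \<Rightarrow> real. set_integrable lborel {a..b} g \<and>
        (\<forall>s t. a \<le> s \<and> s \<le> t \<and> t \<le> b \<longrightarrow>
           dist (\<gamma> s) (\<gamma> t) \<le> (LINT r:{s..t}|lborel. g r)))"

definition locally_ac_curve :: "(real \<Rightarrow> 'a::metric_space) \<Rightarrow> bool" where
  "locally_ac_curve \<gamma> \<longleftrightarrow> (\<forall>a b. 0 < a \<and> a \<le> b \<longrightarrow> ac_curve_on a b \<gamma>)"

(* For an absolutely continuous curve on [0,1] this limit exists at almost every t in [0,1];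
   where it does not exist the value is unspecified. *)
definition metric_derivative :: "(real \<Rightarrow> 'a::metric_space) \<Rightarrow> real \<Rightarrow> real" where
  "metric_derivative \<gamma> t = Lim (at t within {0..1}) (\<lambda>s. dist (\<gamma> s) (\<gamma> t) / \<bar>s - t\<bar>)"

(* The curve is only relevant on [0,\<infinity>). The differential inequality includes the existence of
   the derivative at almost every t. *)
definition EVI_trajectory ::
    "real \<Rightarrow> ('a::metric_space \<Rightarrow> ereal) \<Rightarrow> 'a \<Rightarrow> (real \<Rightarrow> 'a) \<Rightarrow> bool" where
  "EVI_trajectory l f x \<xi> \<longleftrightarrow>
     (\<forall>t>0. \<xi> t \<in> effective_domain f) \<and>
     locally_ac_curve \<xi> \<and>
     \<xi> 0 = x \<and> (\<xi> \<longlongrightarrow> x) (at_right 0) \<and>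
     (\<forall>v\<in>effective_domain f. AE t in lborel. t > 0 \<longrightarrow>
        (\<exists>D. ((\<lambda>s. (dist (\<xi> s) v)\<^sup>2) has_real_derivative D) (at t) \<and>
             ereal (D / 2 + l / 2 * (dist (\<xi> t) v)\<^sup>2) \<le> f v - f (\<xi> t)))"

definition descending_slope :: "('a::metric_space \<Rightarrow> ereal) \<Rightarrow> 'a \<Rightarrow> ereal" where
  "descending_slope f x =
     (if x \<notin> effective_domain f then \<infinity>
      else if x isolated_in UNIV then 0
      else Limsup (at x) (\<lambda>y. max (- (f y - f x)) 0 / ereal (dist y x)))"

definition Theta ::
    "('a::metric_space \<Rightarrow> ereal) \<Rightarrow> 'a \<Rightarrow> 'a \<Rightarrow> (real \<Rightarrow> 'a) \<Rightarrow> ennreal" where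
  "Theta f x0 x1 \<gamma> =
     (if ac_curve_on 0 1 \<gamma> \<and> \<gamma> 0 = x0 \<and> \<gamma> 1 = x1
      then \<integral>\<^sup>+t\<in>{0..1}. ((ennreal (metric_derivative \<gamma> t))\<^sup>2 +
                        (e2ennreal (descending_slope f (\<gamma> t)))\<^sup>2) \<partial>lborel
      else \<infinity>)"

(* Continuous curves on [0,1] with the uniform distance; the elements are functions on the reals
   that take the value undefined outside [0,1]. *)
definition curve_space :: "(real \<Rightarrow> 'a::metric_space) metric" where
  "curve_space = cfunspace (top_of_set {0..1}) euclidean_metric"

lemma mspace_curve_space:
  "mspace (curve_space :: (real \<Rightarrow> 'a::metric_space) metric) =
     {\<gamma>. \<gamma> \<in> extensional {0..1} \<and> continuous_on {0..1} \<gamma>}"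
proof -
  have "Metric_space.mbounded UNIV dist (\<gamma> ` {0..1})" if "continuous_on {0..1} \<gamma>"
    for \<gamma> :: "real \<Rightarrow> 'a"
  proof -
    have "bounded (\<gamma> ` {0..1})"
      using that by (intro compact_imp_bounded compact_continuous_image) auto
    then show ?thesis by simp
  qed
  then show ?thesis by (auto simp: curve_space_def)
qed

definition gamma_converges ::
    "'b metric \<Rightarrow> (nat \<Rightarrow> 'b \<Rightarrow> 'c::complete_linorder) \<Rightarrow> ('b \<Rightarrow> 'c) \<Rightarrow> bool" where
  "gamma_converges Y Fh F \<longleftrightarrow>
     (\<forall>y\<in>mspace Y.
        (\<forall>ys. range ys \<subseteq> mspace Y \<and> limitin (mtopology_of Y) ys y sequentially \<longrightarrow>
           F y \<le> liminf (\<lambda>h. Fh h (ys h))) \<and>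
        (\<exists>ys. range ys \<subseteq> mspace Y \<and> limitin (mtopology_of Y) ys y sequentially \<and>
           limsup (\<lambda>h. Fh h (ys h)) \<le> F y))"

end

theory Submission
  imports Defs
begin

text \<open>
  The slope terms in \<^term>\<open>Theta\<close> are nonnegative, so the lower bound is the lower semicontinuity of
  the kinetic energy under uniform convergence. The difficulty lies in the upper bound: the slope of
  \<open>f\<close> may be infinite all along a given curve \<open>y\<close>, so \<open>y\<close> itself is no recovery sequence. The remedy is
  to push a curve \<open>\<gamma>\<close> by the EVI flow \<open>S\<close> for a short time that vanishes at the end points,
  \<open>u(t) = S (\<gamma> t) (2 \<epsilon> min t (1 - t))\<close>. On the first half, testing the inequality for the trajectory
  of \<open>\<gamma>(t)\<close> with the point \<open>u(s)\<close>, \<open>s < t\<close>, gives in the limit \<open>s \<rightarrow> t\<close>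
    \<open>\<bar>u'\<bar>\<^sup>2 + \<epsilon>\<^sup>2 \<bar>\<partial>f\<bar>\<^sup>2(u) + 4 \<epsilon> (f \<circ> u)' \<le> exp (3 \<bar>l\<bar> \<epsilon>) \<bar>\<gamma>'\<bar>\<^sup>2\<close>
  and on the second half the same with the opposite sign of \<open>(f \<circ> u)'\<close>. The last term on the left is a
  total derivative; integration adds \<open>4 \<epsilon> (f(\<gamma> 0) + f(\<gamma> 1) - 2 f(u(1/2)))\<close> to the
  bound, a quantity with upper limit at most zero because \<open>f\<close> is bounded above along the end points and, by lower
  semicontinuity, bounded below near \<open>y(1/2)\<close>. The moving end points are reached beforehand by
  attaching two short geodesics to \<open>y\<close>.

  Kinetic energy is handled through a function \<open>R\<close> with
  \<open>dist (\<gamma> s) (\<gamma> t)\<^sup>2 \<le> (t - s) (R t - R s)\<close> (\<open>energy_bound\<close>); the increment \<open>R 1 - R 0\<close> then bounds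
  the energy. Gluing, reparametrising and adding multiples of \<open>f \<circ> u\<close> to \<open>R\<close> are algebra in this form,
  and the derivatives of the displayed estimate become lower Dini derivatives of the nondecreasing
  function \<open>R\<close>, whose integral is at most the increment of \<open>R\<close> by Fatou's lemma
  (\<open>nn_integral_lower_Dini_derivative\<close>). Two facts link
  energy bounds with the metric derivative. First, the speed of an absolutely continuous curve exists
  almost everywhere and recovers distances by integration (\<open>ac_curve_speed\<close>); this rests on the
  Lebesgue differentiation theorem and the Radon-Nikodym theorem on the line, applied to the
  distances from countably many points of the curve. Second, a uniform limit of curves with bounded
  energy is absolutely continuous with the same bound (\<open>energy_bound_closure\<close>); here the
  parallelogram identity in the space of square integrable functions replaces weak compactness.
  The second fact gives both the lower bound and the absolute continuity of \<open>u\<close>.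

  About the flow one needs the inequality in integrated form, the exponential contraction of
  trajectories and a bound of the slope by the drop of \<open>f\<close>
  (\<open>EVI_trajectory_imp_integrated_EVI\<close>, \<open>integrated_EVI_contraction\<close>,
  \<open>integrated_EVI_slope_le_energy_drop\<close>); the displayed estimate for \<open>u\<close> is their combination
  \<open>integrated_EVI_joint_energy_estimate\<close>.
\<close>

section \<open>Differentiation of indefinite integrals\<close>

text \<open>
  The intervals in question form a Vitali cover, so countably many disjoint ones among them fill the
  set up to a null set. Their total length is at most \<open>1 / c\<close> times the \<open>\<kappa>\<close>-measure of any open
  neighbourhood \<open>U\<close> of \<open>B\<close>, and that is arbitrarily small by outer regularity of \<open>\<kappa>\<close>.
\<close>

lemma negligible_positive_density:
  fixes \<kappa> :: "real measure"
  assumes sets: "sets \<kappa> = sets borel" and fin: "emeasure \<kappa> UNIV \<noteq> \<infinity>"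
    and B: "B \<in> sets borel" "emeasure \<kappa> B = 0" and c: "0 < (c::real)"
  shows "negligible {t\<in>B. \<forall>d>0. \<exists>a b. a < b \<and> a \<le> t \<and> t \<le> b \<and> b - a < d \<and>
            ennreal (c * (b - a)) \<le> emeasure \<kappa> {a..b}}" (is "negligible ?A")
  unfolding negligible_outer_le
proof (intro allI impI)
  fix e :: real assume "e > 0"
  have space: "space \<kappa> = UNIV"
    using sets_eq_imp_space_eq[OF sets] by simp
  have "emeasure \<kappa> B = (INF U\<in>{U. B \<subseteq> U \<and> open U}. emeasure \<kappa> U)"
    using outer_regular[of \<kappa> B] sets fin B space by simp
  then have "(INF U\<in>{U. B \<subseteq> U \<and> open U}. emeasure \<kappa> U) < ennreal (c * e)"
    using B c \<open>e > 0\<close> by simp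
  then obtain U where U: "B \<subseteq> U" "open U" "emeasure \<kappa> U < ennreal (c * e)"
    by (auto simp: INF_less_iff)
  define K where "K = {(a, b). a < b \<and> {a..b} \<subseteq> U \<and> ennreal (c * (b - a)) \<le> emeasure \<kappa> {a..b}}"
  define m r where "m = (\<lambda>(a::real, b). (a + b) / 2)" and "r = (\<lambda>(a::real, b). (b - a) / 2)"
  have ball: "cball (m i) (r i) = {fst i..snd i}" for i
    by (cases i) (simp add: m_def r_def cball_eq_atLeastAtMost field_simps)
  obtain C where C: "countable C" "C \<subseteq> K" "pairwise (\<lambda>i j. disjnt (cball (m i) (r i)) (cball (m j)
      (r j))) C"
     "negligible (?A - (\<Union>i \<in> C. cball (m i) (r i)))"
  proof (rule Vitali_covering_theorem_cballs[of K r ?A m])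
    show "0 < r i" if "i \<in> K" for i
      using that by (auto simp: K_def r_def)
    fix x and d :: real assume x: "x \<in> ?A" and d: "0 < d"
    from x U obtain d' where d': "d' > 0" "ball x d' \<subseteq> U"
      using openE[OF U(2), of x] by blast
    have "min d d' > 0"
      using d d' by simp
    with x obtain a b where ab: "a < b" "a \<le> x" "x \<le> b" "b - a < min d d'"
        "ennreal (c * (b - a)) \<le> emeasure \<kappa> {a..b}"
      by blast
    have "{a..b} \<subseteq> ball x d'"
      using ab by (auto simp: dist_real_def)
    then have "(a, b) \<in> K"
      using ab d' by (auto simp: K_def)
    moreover have "x \<in> cball (m (a, b)) (r (a, b))" "r (a, b) < d"
      using ab by (simp_all add: ball) (simp add: r_def)
    ultimately show "\<exists>i. i \<in> K \<and> x \<in> cball (m i) (r i) \<and> r i < d"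
      by blast
  qed
  let ?V = "\<Union>i \<in> C. {fst i..snd i}"
  have disj: "disjoint_family_on (\<lambda>i. {fst i..snd i}) C"
    using C(3) unfolding ball disjoint_family_on_def pairwise_def disjnt_def by blast
  have [measurable]: "?V \<in> sets borel"
    using C(1) by (intro sets.countable_UN'') auto
  have "ennreal c * emeasure lborel ?V = ennreal c * (\<integral>\<^sup>+i. emeasure lborel {fst i..snd i}
      \<partial>count_space C)"
    using C(1) disj by (subst emeasure_UN_countable) auto
  also have "\<dots> = (\<integral>\<^sup>+i. ennreal c * emeasure lborel {fst i..snd i} \<partial>count_space C)"
    by (rule nn_integral_cmult[symmetric]) auto
  also have "\<dots> \<le> (\<integral>\<^sup>+i. emeasure \<kappa> {fst i..snd i} \<partial>count_space C)"
  proof (rule nn_integral_mono)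
    fix i assume "i \<in> space (count_space C)"
    with C(2) have "i \<in> K" by auto
    then show "ennreal c * emeasure lborel {fst i..snd i} \<le> emeasure \<kappa> {fst i..snd i}"
      using c by (auto simp: K_def ennreal_mult[symmetric] split: prod.splits)
  qed
  also have "\<dots> = emeasure \<kappa> ?V"
    using C(1) disj by (subst emeasure_UN_countable) (auto simp: sets)
  also have "\<dots> \<le> emeasure \<kappa> U"
  proof (intro emeasure_mono UN_least)
    show "{fst i..snd i} \<subseteq> U" if "i \<in> C" for i
      using that C(2) unfolding K_def by fastforce
  qed (use U(2) in \<open>simp add: sets\<close>)
  also have "\<dots> < ennreal (c * e)" by fact
  finally have V: "emeasure lborel ?V < ennreal e"
  proof (rule contrapos_pp)
    assume "\<not> emeasure lborel ?V < ennreal e"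
    then have "ennreal c * ennreal e \<le> ennreal c * emeasure lborel ?V"
      by (intro mult_left_mono) auto
    then show "\<not> ennreal c * emeasure lborel ?V < ennreal (c * e)"
      using c \<open>e > 0\<close> by (simp add: ennreal_mult not_less)
  qed
  have "?V \<in> lmeasurable \<and> measure lebesgue ?V \<le> e"
  proof
    have "emeasure lebesgue ?V = emeasure lborel ?V"
      by simp
    with V have "emeasure lebesgue ?V < ennreal e"
      by simp
    then show "measure lebesgue ?V \<le> e"
      using \<open>e > 0\<close> unfolding measure_def by (intro enn2real_leI) auto
    show "?V \<in> lmeasurable"
      using \<open>emeasure lebesgue ?V < ennreal e\<close>
      by (intro fmeasurableI) (auto intro: order.strict_trans2)
  qed
  then have V': "?V \<in> lmeasurable" "measure lebesgue ?V \<le> e"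
    by blast+
  obtain Z where Z: "Z = ?A - ?V" "Z \<in> null_sets lebesgue"
    using C(4) unfolding ball negligible_iff_null_sets by blast
  have "measure lebesgue (?V \<union> Z) = measure lebesgue ?V"
    using V'(1) Z(2) by (intro measure_Un_null_set) auto
  moreover have "?V \<union> Z \<in> lmeasurable"
    using V'(1) fmeasurableI_null_sets[OF Z(2)] by (rule fmeasurable.Un)
  moreover have "?A \<subseteq> ?V \<union> Z"
    unfolding Z(1) Un_Diff_cancel by (rule Un_upper2)
  ultimately show "\<exists>T. ?A \<subseteq> T \<and> T \<in> lmeasurable \<and> measure lebesgue T \<le> e"
    by (intro exI[of _ "?V \<union> Z"] conjI) (assumption | simp only: V'(2))+
qed

lemma ennreal_integral_le_nn_integral:
  fixes f :: "'b \<Rightarrow> real"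
  assumes "integrable M f"
  shows "ennreal (\<integral>x. f x \<partial>M) \<le> (\<integral>\<^sup>+x. ennreal (f x) \<partial>M)"
proof -
  have "(\<integral>x. f x \<partial>M) \<le> (\<integral>x. max 0 (f x) \<partial>M)"
    using assms by (intro integral_mono) auto
  then have "ennreal (\<integral>x. f x \<partial>M) \<le> ennreal (\<integral>x. max 0 (f x) \<partial>M)"
    by (rule ennreal_leI)
  also have "\<dots> = (\<integral>\<^sup>+x. ennreal (max 0 (f x)) \<partial>M)"
    using assms by (intro nn_integral_eq_integral[symmetric]) auto
  also have "\<dots> = (\<integral>\<^sup>+x. ennreal (f x) \<partial>M)"
    by (intro nn_integral_cong) (simp add: ennreal_max_0)
  finally show ?thesis .
qed

text \<open>
  An interval on which the average of \<open>g\<close> is at least \<open>p\<close> carries mass at least \<open>p - q\<close> times its length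
  for the measure with density \<open>max 0 (g - q)\<close>, and this measure vanishes where \<open>g < q\<close>.
\<close>

lemma AE_averages_not_above:
  fixes g :: "real \<Rightarrow> real"
  assumes g: "set_integrable lborel {a..b} g" and qp: "q < p"
  shows "AE t in lborel. \<not> (t \<in> {a..b} \<and> g t < q \<and> (\<forall>d>0. \<exists>u v. u < v \<and> u \<le> t \<and> t \<le> v \<and> v - u < d \<and>
           a \<le> u \<and> v \<le> b \<and> p * (v - u) \<le> (LINT r:{u..v}|lborel. g r)))" (is "AE t in lborel. \<not> ?P
               t")
proof -
  define h where "h x = indicator {a..b} x * (g x - q)" for x
  have h: "integrable lborel h"
  proof -
    have "integrable lborel (\<lambda>x. indicator {a..b} x *\<^sub>R g x - q * indicator {a..b} x)"
    proof (intro Bochner_Integration.integrable_diff integrable_mult_right)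
      show "integrable lborel (indicat_real {a..b})"
        by (rule integrable_real_indicator) (auto simp: emeasure_lborel_Icc_eq)
    qed (use g in \<open>simp add: set_integrable_def\<close>)
    then show ?thesis by (simp add: h_def[abs_def] algebra_simps)
  qed
  then have [measurable]: "h \<in> borel_measurable borel" by simp
  define \<kappa> where "\<kappa> = density lborel (\<lambda>x. ennreal (h x))"
  define B where "B = {a..b} \<inter> {x. h x < 0}"
  have [measurable]: "B \<in> sets borel" unfolding B_def by measurable
  have "negligible {t\<in>B. \<forall>d>0. \<exists>u v. u < v \<and> u \<le> t \<and> t \<le> v \<and> v - u < d \<and>
            ennreal ((p - q) * (v - u)) \<le> emeasure \<kappa> {u..v}}"
  proof (rule negligible_positive_density)
    show "sets \<kappa> = sets borel" by (simp add: \<kappa>_def)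
    have "(\<integral>\<^sup>+x. ennreal (h x) \<partial>lborel) \<le> (\<integral>\<^sup>+x. ennreal (norm (h x)) \<partial>lborel)"
      by (intro nn_integral_mono ennreal_leI) simp
    also have "\<dots> < \<infinity>"
      using h by (simp add: integrable_iff_bounded)
    finally show "emeasure \<kappa> UNIV \<noteq> \<infinity>"
      by (simp add: \<kappa>_def emeasure_density)
    have "emeasure \<kappa> B = (\<integral>\<^sup>+x. 0 \<partial>(lborel::real measure))"
      unfolding \<kappa>_def by (subst emeasure_density, simp, simp, intro nn_integral_cong)
        (auto simp: B_def ennreal_neg split: split_indicator)
    then show "emeasure \<kappa> B = 0" by simp
  qed (use qp in auto)
  moreover have "{t. ?P t} \<subseteq> {t\<in>B. \<forall>d>0. \<exists>u v. u < v \<and> u \<le> t \<and> t \<le> v \<and> v - u < d \<and>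
            ennreal ((p - q) * (v - u)) \<le> emeasure \<kappa> {u..v}}"
  proof (safe)
    fix t assume "t \<in> {a..b}" "g t < q"
    then show "t \<in> B" by (auto simp: B_def h_def)
  next
    fix t d :: real
    assume "\<forall>d>0. \<exists>u v. u < v \<and> u \<le> t \<and> t \<le> v \<and> v - u < d \<and>
           a \<le> u \<and> v \<le> b \<and> p * (v - u) \<le> (LINT r:{u..v}|lborel. g r)" "0 < d"
    then obtain u v where uv: "u < v" "u \<le> t" "t \<le> v" "v - u < d" "a \<le> u" "v \<le> b"
        "p * (v - u) \<le> (LINT r:{u..v}|lborel. g r)"
      by blast
    have gi: "set_integrable lborel {u..v} g"
      using g by (rule set_integrable_subset) (use uv in auto)
    have "(LINT r:{u..v}|lborel. g r) - q * (v - u)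
        = (LINT r:{u..v}|lborel. g r) - (LINT r:{u..v}|lborel. q)"
      using uv by (simp add: set_lebesgue_integral_def)
    also have "\<dots> = (LINT r:{u..v}|lborel. g r - q)"
      using uv by (intro set_integral_diff(2)[symmetric] gi) (simp add: set_integrable_def)
    also have "\<dots> = (LINT r|lborel. indicator {u..v} r * h r)"
      unfolding set_lebesgue_integral_def using uv
      by (intro Bochner_Integration.integral_cong) (auto simp: h_def split: split_indicator)
    finally have "ennreal ((p - q) * (v - u)) \<le> ennreal (LINT r|lborel. indicator {u..v} r * h r)"
      using uv by (intro ennreal_leI) (simp add: algebra_simps)
    also have "\<dots> \<le> (\<integral>\<^sup>+r. ennreal (indicator {u..v} r * h r) \<partial>lborel)"
      using integrable_mult_indicator[of "{u..v}" lborel h] h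
      by (intro ennreal_integral_le_nn_integral) simp
    also have "\<dots> = emeasure \<kappa> {u..v}"
      unfolding \<kappa>_def by (subst emeasure_density, simp, simp, intro nn_integral_cong)
        (auto split: split_indicator)
    finally show "\<exists>u v. u < v \<and> u \<le> t \<and> t \<le> v \<and> v - u < d \<and>
            ennreal ((p - q) * (v - u)) \<le> emeasure \<kappa> {u..v}"
      using uv by blast
  qed
  ultimately have "negligible {t. ?P t}"
    by (rule negligible_subset)
  then have "AE t in lebesgue. \<not> ?P t"
    unfolding negligible_iff_null_sets by (drule_tac AE_not_in) simp
  then show ?thesis
    by (simp add: AE_completion_iff)
qed

text \<open>
  Rational levels between \<open>g t\<close> and \<open>x\<close> reduce the claim to countably many exceptional null sets.
\<close>

lemma AE_averages_eventually_below:
  fixes g G :: "real \<Rightarrow> real"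
  assumes g: "set_integrable lborel {a..b} g"
    and G: "\<And>s t. a \<le> s \<Longrightarrow> s \<le> t \<Longrightarrow> t \<le> b \<Longrightarrow> G t - G s = (LINT r:{s..t}|lborel. g r)"
  shows "AE t in lborel. a < t \<and> t < b \<longrightarrow> (\<forall>x>g t. eventually (\<lambda>y. (G y - G t) / (y - t)
      < x) (at t))"
proof -
  define N where "N q p t \<longleftrightarrow> t \<in> {a..b} \<and> g t < q \<and> (\<forall>d>0. \<exists>u v. u < v \<and> u \<le> t \<and> t \<le> v \<and> v - u < d \<and>
           a \<le> u \<and> v \<le> b \<and> p * (v - u) \<le> (LINT r:{u..v}|lborel. g r))" for q p t
  have "AE t in lborel. q < p \<longrightarrow> \<not> N q p t" for q p
    using AE_averages_not_above[OF g, of q p] unfolding N_def by (cases "q < p") auto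
  then have "AE t in lborel. \<forall>q\<in>\<rat>. \<forall>p\<in>\<rat>. q < p \<longrightarrow> \<not> N q p t"
    by (intro AE_ball_countable[OF countable_rat, THEN iffD2] ballI)
  then show ?thesis
  proof eventually_elim
    case (elim t)
    show ?case
    proof (intro impI allI)
      fix x assume t: "a < t \<and> t < b" and x: "g t < x"
      obtain q where q: "q \<in> \<rat>" "g t < q" "q < x" using Rats_dense_in_real[OF x] by blast
      obtain p where p: "p \<in> \<rat>" "q < p" "p < x" using Rats_dense_in_real[OF q(3)] by blast
      have "\<not> N q p t" using elim q(1) p(1,2) by blast
      then obtain d where d: "d > 0" and
        "\<not> (\<exists>u v. u < v \<and> u \<le> t \<and> t \<le> v \<and> v - u < d \<and>
           a \<le> u \<and> v \<le> b \<and> p * (v - u) \<le> (LINT r:{u..v}|lborel. g r))"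
        using t q(2) unfolding N_def by auto
      then have *: "\<And>u v. u < v \<Longrightarrow> u \<le> t \<Longrightarrow> t \<le> v \<Longrightarrow> v - u < d \<Longrightarrow> a \<le> u \<Longrightarrow> v \<le> b \<Longrightarrow>
          (LINT r:{u..v}|lborel. g r) < p * (v - u)"
        by (meson not_le)
      show "eventually (\<lambda>y. (G y - G t) / (y - t) < x) (at t)"
        unfolding eventually_at
      proof (intro exI[of _ "min d (min (t - a) (b - t))"] conjI ballI impI)
        show "0 < min d (min (t - a) (b - t))" using d t by auto
        fix y assume y: "y \<noteq> t \<and> dist y t < min d (min (t - a) (b - t))"
        have "(G y - G t) / (y - t) < p"
        proof (cases "y < t")
          case True
          have "(LINT r:{y..t}|lborel. g r) < p * (t - y)"
            using y True by (intro *) (auto simp: dist_real_def)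
          moreover have "G t - G y = (LINT r:{y..t}|lborel. g r)"
            using y True t by (intro G) (auto simp: dist_real_def)
          ultimately show ?thesis using True by (simp add: field_simps)
        next
          case False
          have "(LINT r:{t..y}|lborel. g r) < p * (y - t)"
            using y False by (intro *) (auto simp: dist_real_def)
          moreover have "G y - G t = (LINT r:{t..y}|lborel. g r)"
            using y False t by (intro G) (auto simp: dist_real_def)
          ultimately show ?thesis using False y by (simp add: field_simps)
        qed
        then show "(G y - G t) / (y - t) < x" using p by simp
      qed
    qed
  qed
qed

text \<open>
  Lebesgue's differentiation theorem: the one-sided bound for \<open>g\<close> and for \<open>- g\<close>.
\<close>

lemma AE_indefinite_integral_has_derivative:
  fixes g G :: "real \<Rightarrow> real"
  assumes g: "set_integrable lborel {a..b} g"
    and G: "\<And>s t. a \<le> s \<Longrightarrow> s \<le> t \<Longrightarrow> t \<le> b \<Longrightarrow> G t - G s = (LINT r:{s..t}|lborel. g r)"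
  shows "AE t in lborel. a < t \<and> t < b \<longrightarrow> (G has_real_derivative g t) (at t)"
proof -
  have "set_integrable lborel {a..b} (\<lambda>x. - g x)"
    using g by (simp add: set_integrable_def)
  moreover have "- G t - - G s = (LINT r:{s..t}|lborel. - g r)" if "a \<le> s" "s \<le> t" "t \<le> b" for s t
  proof -
    have "set_integrable lborel {s..t} g"
      using g by (rule set_integrable_subset) (use that in auto)
    then show ?thesis using G[OF that] by (simp add: set_integral_uminus)
  qed
  ultimately have below: "AE t in lborel. a < t \<and> t < b \<longrightarrow>
      (\<forall>x>- g t. eventually (\<lambda>y. (- G y - - G t) / (y - t) < x) (at t))"
    by (rule AE_averages_eventually_below)
  have "AE t in lborel. a < t \<and> t < b \<longrightarrow> (\<forall>x>g t. eventually (\<lambda>y. (G y - G t) / (y - t) < x) (at t))"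
    using g G by (rule AE_averages_eventually_below)
  with below show ?thesis
  proof eventually_elim
    case (elim t)
    show ?case
      unfolding has_field_derivative_iff
    proof (intro impI order_tendstoI)
      fix x assume t: "a < t \<and> t < b" and "g t < x"
      then show "eventually (\<lambda>y. (G y - G t) / (y - t) < x) (at t)" using elim by blast
    next
      fix x assume t: "a < t \<and> t < b" and "x < g t"
      with elim have "eventually (\<lambda>y. (- G y - - G t) / (y - t) < - x) (at t)" by simp
      then show "eventually (\<lambda>y. x < (G y - G t) / (y - t)) (at t)"
      proof eventually_elim
        case (elim y)
        have "(- G y - - G t) / (y - t) = - ((G y - G t) / (y - t))"
          by (metis minus_diff_minus minus_divide_left)
        then show ?case using elim by linarith
      qed
    qed
  qed
qed

section \<open>Densities of functions with dominated increments\<close>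

lemma set_integral_Icc_eq_Ioc:
  fixes f :: "real \<Rightarrow> real"
  assumes "set_borel_measurable lborel {s..t} f"
  shows "(LINT r:{s..t}|lborel. f r) = (LINT r:{s<..t}|lborel. f r)"
proof (rule set_integral_cong_set[symmetric])
  show "set_borel_measurable lborel {s<..t} f"
    using assms by (rule set_borel_measurable_subset) auto
  show "AE x in lborel. (x \<in> {s..t}) = (x \<in> {s<..t})"
    using AE_lborel_singleton[of s] by eventually_elim auto
qed (fact assms)

lemma isCont_integral_atMost:
  fixes k :: "real \<Rightarrow> real"
  assumes k: "integrable lborel k"
  shows "isCont (\<lambda>t. LINT x|lborel. indicator {..t} x * k x) t"
proof (rule continuous_at_sequentiallyI)
  fix u assume u: "u \<longlonglongrightarrow> t"
  have [measurable]: "k \<in> borel_measurable borel" using k by simp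
  show "(\<lambda>n. LINT x|lborel. indicator {..u n} x * k x) \<longlonglongrightarrow> (LINT x|lborel. indicator {..t} x * k x)"
  proof (rule integral_dominated_convergence[where w="\<lambda>x. norm (k x)"])
    show "AE x in lborel. (\<lambda>n. indicator {..u n} x * k x) \<longlonglongrightarrow> indicator {..t} x * k x"
      using AE_lborel_singleton[of t]
    proof eventually_elim
      case (elim x)
      have "eventually (\<lambda>n. indicator {..u n} x * k x = indicator {..t} x * k x) sequentially"
      proof (cases "x < t")
        case True
        show ?thesis using order_tendstoD(1)[OF u True] by (rule eventually_mono) (use True in simp)
      next
        case False
        then have "t < x" using elim by auto
        show ?thesis using order_tendstoD(2)[OF u \<open>t < x\<close>]
          by (rule eventually_mono) (use \<open>t < x\<close> in simp)
      qed
      then show ?case by (rule tendsto_eventually)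
    qed
  qed (use k in \<open>auto split: split_indicator\<close>)
qed

text \<open>
  Extend \<open>\<phi>\<close> to \<open>\<psi>\<close> by constants and let \<open>P\<close> be an indefinite integral of \<open>\<bar>g\<bar>\<close>. Both \<open>P + \<psi>\<close> and \<open>P - \<psi>\<close>
  are nondecreasing and continuous, and their Stieltjes measures add up to the measure with density
  \<open>2 \<bar>g\<bar>\<close>. Hence the first one is absolutely continuous and has a Radon-Nikodym density.
\<close>

lemma dominated_increments_density:
  fixes \<phi> g :: "real \<Rightarrow> real"
  assumes ab: "a \<le> b" and g: "set_integrable lborel {a..b} g"
    and \<phi>: "\<And>s t. a \<le> s \<Longrightarrow> s \<le> t \<Longrightarrow> t \<le> b \<Longrightarrow> \<bar>\<phi> t - \<phi> s\<bar> \<le> (LINT r:{s..t}|lborel. g r)"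
  obtains h where "integrable lborel h"
    "\<And>s t. a \<le> s \<Longrightarrow> s \<le> t \<Longrightarrow> t \<le> b \<Longrightarrow> \<phi> t - \<phi> s = (LINT r:{s..t}|lborel. h r)"
proof -
  define k where "k x = indicator {a..b} x * \<bar>g x\<bar>" for x
  have "integrable lborel (\<lambda>x. \<bar>indicator {a..b} x *\<^sub>R g x\<bar>)"
    using g unfolding set_integrable_def by (rule integrable_abs)
  then have k: "integrable lborel k"
    by (simp add: k_def[abs_def] abs_mult)
  then have [measurable]: "k \<in> borel_measurable borel" by simp
  have k_nonneg: "0 \<le> k x" for x by (simp add: k_def)
  have ki: "integrable lborel (\<lambda>x. indicator S x * k x)" if "S \<in> sets borel" for S
    using integrable_mult_indicator[of S lborel k] that k by simp
  define P where "P t = (LINT x|lborel. indicator {..t} x * k x)" for t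
  have P_cont: "isCont P t" for t
    unfolding P_def[abs_def] by (rule isCont_integral_atMost[OF k])
  have P_diff: "P t - P s = (LINT x|lborel. indicator {s<..t} x * k x)" if "s \<le> t" for s t
    unfolding P_def using that
    by (subst Bochner_Integration.integral_diff[symmetric]) (auto intro!: ki
        Bochner_Integration.integral_cong split: split_indicator)
  define c where "c t = max a (min b t)" for t
  have c: "a \<le> c t" "c t \<le> b" "a \<le> t \<Longrightarrow> t \<le> b \<Longrightarrow> c t = t" "s \<le> t \<Longrightarrow> c s \<le> c t" for s t
    using ab by (auto simp: c_def)
  have P_c: "P (c t) = P t" for t
    unfolding P_def
  proof (rule integral_cong_AE)
    show "AE x in lborel. indicator {..c t} x * k x = indicator {..t} x * k x"
      using AE_lborel_singleton[of a]
      by eventually_elim (auto simp: k_def c_def split: split_indicator)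
  qed auto
  define \<psi> where "\<psi> t = \<phi> (c t)" for t
  have \<psi>: "\<bar>\<psi> t - \<psi> s\<bar> \<le> P t - P s" if "s \<le> t" for s t
  proof -
    have gi: "set_integrable lborel {c s..c t} g"
      using g by (rule set_integrable_subset) (use c in auto)
    have "\<bar>\<psi> t - \<psi> s\<bar> \<le> (LINT r:{c s..c t}|lborel. g r)"
      unfolding \<psi>_def using c that by (intro \<phi>) auto
    also have "\<dots> = (LINT r:{c s<..c t}|lborel. g r)"
      using gi by (intro set_integral_Icc_eq_Ioc) (auto simp: set_integrable_def
          set_borel_measurable_def)
    also have "\<dots> \<le> (LINT r|lborel. indicator {c s<..c t} r * k r)"
      unfolding set_lebesgue_integral_def
    proof (rule integral_mono)
      have "set_integrable lborel {c s<..c t} g"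
        using gi by (rule set_integrable_subset) auto
      then show "integrable lborel (\<lambda>x. indicat_real {c s<..c t} x *\<^sub>R g x)"
        by (simp add: set_integrable_def)
      fix x show "indicat_real {c s<..c t} x *\<^sub>R g x \<le> indicat_real {c s<..c t} x * k x"
        using c(1)[of s] c(2)[of t] by (auto simp: k_def split: split_indicator)
    qed (simp add: ki)
    also have "\<dots> = P t - P s"
      using P_diff[of "c s" "c t"] c(4)[OF that] by (simp add: P_c)
    finally show ?thesis .
  qed
  have \<psi>_cont: "isCont \<psi> t" for t
  proof -
    have "((\<lambda>s. \<bar>P s - P t\<bar>) \<longlongrightarrow> 0) (at t)"
      using P_cont[of t] by (simp add: isCont_def tendsto_rabs_zero_iff LIM_zero_iff)
    moreover have "eventually (\<lambda>s. norm (\<psi> s - \<psi> t) \<le> \<bar>P s - P t\<bar>) (at t)"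
      using \<psi> by (intro always_eventually allI) (metis abs_ge_self abs_minus_commute linear
          order_trans real_norm_def)
    ultimately have "((\<lambda>s. \<psi> s - \<psi> t) \<longlongrightarrow> 0) (at t)"
      by (rule Lim_null_comparison[rotated])
    then show ?thesis by (simp add: isCont_def LIM_zero_iff)
  qed
  define \<mu> where "\<mu> e = interval_measure (\<lambda>t. P t + e * \<psi> t)" for e
  define \<nu> where "\<nu> = density lborel (\<lambda>x. ennreal (2 * k x))"
  have \<mu>_Ioc: "emeasure (\<mu> e) {s<..t} = ennreal (P t + e * \<psi> t - (P s + e * \<psi> s))" if "s
      \<le> t" "e \<in> {-1, 1}" for s t e
    unfolding \<mu>_def
  proof (rule emeasure_interval_measure_Ioc[OF that(1)])
    show "P x + e * \<psi> x \<le> P y + e * \<psi> y" if "x \<le> y" for x y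
      using \<psi>[OF that] \<open>e \<in> {-1, 1}\<close> by auto
    show "continuous (at_right x) (\<lambda>t. P t + e * \<psi> t)" for x
      by (rule continuous_at_imp_continuous_at_within) (intro isCont_add isCont_mult P_cont \<psi>_cont
          continuous_const)
  qed
  have sets_\<mu>[simp]: "sets (\<mu> e) = sets borel" and space_\<mu>[simp]: "space (\<mu> e) = UNIV" for e
    by (simp_all add: \<mu>_def)
  have sets_\<nu>[simp]: "sets \<nu> = sets borel" and space_\<nu>[simp]: "space \<nu> = UNIV"
    by (simp_all add: \<nu>_def)
  have UN: "(\<Union>n. {- real n<..real n}) = (UNIV :: real set)"
  proof -
    have "\<exists>n. x \<in> {- real n<..real n}" for x :: real
    proof -
      obtain n where "\<bar>x\<bar> < real n" using reals_Archimedean2 by blast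
      then show ?thesis by (intro exI[of _ n]) auto
    qed
    then show ?thesis by blast
  qed
  have inc: "incseq (\<lambda>n. {- real n<..real n})"
    by (auto simp: incseq_def)
  have fin_\<mu>: "finite_measure (\<mu> e)" if e: "e \<in> {-1, 1}" for e
  proof
    have "emeasure (\<mu> e) UNIV = (SUP n. emeasure (\<mu> e) {- real n<..real n})"
      unfolding UN[symmetric] using inc by (intro SUP_emeasure_incseq[symmetric]) auto
    also have "\<dots> \<le> ennreal (2 * (P b - P a))"
    proof (rule SUP_least)
      fix n
      have "\<bar>\<psi> (real n) - \<psi> (- real n)\<bar> \<le> P b - P a" "P (real n) - P (- real n) \<le> P b - P a"
      proof -
        have "P b - P (c (real n)) \<ge> 0" "P (c (- real n)) - P a \<ge> 0"
          using \<psi>[of "c (real n)" b] \<psi>[of a "c (- real n)"] c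
              by (auto intro: order_trans[OF abs_ge_zero])
        then show "P (real n) - P (- real n) \<le> P b - P a" by (simp add: P_c)
        then show "\<bar>\<psi> (real n) - \<psi> (- real n)\<bar> \<le> P b - P a" using \<psi>[of "- real n" "real n"] by simp
      qed
      then show "emeasure (\<mu> e) {- real n<..real n} \<le> ennreal (2 * (P b - P a))"
        using e by (subst \<mu>_Ioc) (auto intro!: ennreal_leI)
    qed
    finally show "emeasure (\<mu> e) (space (\<mu> e)) \<noteq> \<infinity>"
      by (auto simp: top_unique)
  qed
  have fin_\<nu>: "finite_measure \<nu>"
  proof
    have "(\<integral>\<^sup>+x. ennreal (2 * k x) \<partial>lborel) = ennreal (LINT x|lborel. 2 * k x)"
      using k k_nonneg by (intro nn_integral_eq_integral) auto
    then show "emeasure \<nu> (space \<nu>) \<noteq> \<infinity>"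
      unfolding \<nu>_def by (simp add: emeasure_density)
  qed
  interpret M1: finite_measure "\<mu> 1" by (rule fin_\<mu>) simp
  interpret M2: finite_measure "\<mu> (-1)" by (rule fin_\<mu>) simp
  interpret N: finite_measure \<nu> by (rule fin_\<nu>)
  have Ioc: "measure (\<mu> 1) {s<..t} + measure (\<mu> (-1)) {s<..t} = measure \<nu> {s<..t}" if "s \<le> t"
      for s t
  proof -
    have "emeasure \<nu> {s<..t} = (\<integral>\<^sup>+x. ennreal (2 * (indicator {s<..t} x * k x)) \<partial>lborel)"
      unfolding \<nu>_def by (subst emeasure_density, simp, simp,
          intro nn_integral_cong) (auto split: split_indicator)
    also have "\<dots> = ennreal (LINT x|lborel. 2 * (indicator {s<..t} x * k x))"
      using ki k_nonneg by (intro nn_integral_eq_integral) auto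
    also have "\<dots> = ennreal (2 * (P t - P s))"
      using P_diff[OF that] by simp
    finally have "measure \<nu> {s<..t} = 2 * (P t - P s)"
      using \<psi>[OF that] by (simp add: measure_def)
    then show ?thesis
      using \<psi>[OF that] by (simp add: measure_def \<mu>_Ioc[OF that])
  qed
  have total: "measure (\<mu> 1) UNIV + measure (\<mu> (-1)) UNIV = measure \<nu> UNIV"
  proof (rule LIMSEQ_unique)
    show "(\<lambda>n. measure (\<mu> 1) {- real n<..real n} + measure (\<mu> (-1)) {- real n<..real n}) \<longlonglongrightarrow>
        measure (\<mu> 1) UNIV + measure (\<mu> (-1)) UNIV"
      unfolding UN[symmetric] using inc
      by (intro tendsto_add M1.finite_Lim_measure_incseq M2.finite_Lim_measure_incseq) auto
    have "(\<lambda>n. measure \<nu> {- real n<..real n}) \<longlonglongrightarrow> measure \<nu> UNIV"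
      unfolding UN[symmetric] using inc by (intro N.finite_Lim_measure_incseq) auto
    then show "(\<lambda>n. measure (\<mu> 1) {- real n<..real n} + measure (\<mu> (-1)) {- real n<..real n})
        \<longlonglongrightarrow> measure \<nu> UNIV"
      by (simp add: Ioc)
  qed
  define E where "E = range (\<lambda>(s, t). {s<..t::real})"
  have borel_E: "sets borel = sigma_sets UNIV E"
    unfolding E_def borel_sigma_sets_Ioc by simp
  have add: "measure (\<mu> 1) A + measure (\<mu> (-1)) A = measure \<nu> A" if "A \<in> sets borel" for A
  proof -
    have "Int_stable E"
    proof (rule Int_stableI)
      fix A B assume "A \<in> E" "B \<in> E"
      then obtain s t s' t' where "A = {s<..t}" "B = {s'<..t'}" by (auto simp: E_def)
      then have "A \<inter> B = {max s s'<..min t t'}" by auto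
      then show "A \<inter> B \<in> E" by (auto simp: E_def)
    qed
    moreover have "E \<subseteq> Pow UNIV" by simp
    moreover have "A \<in> sigma_sets UNIV E" using that borel_E by simp
    ultimately show ?thesis
    proof (induction rule: sigma_sets_induct_disjoint)
      case (basic A)
      then obtain s t where A: "A = {s<..t}" by (auto simp: E_def)
      show ?case
      proof (cases "s \<le> t")
        case True then show ?thesis unfolding A by (rule Ioc)
      next
        case False then show ?thesis by (simp add: A)
      qed
    next
      case empty then show ?case by simp
    next
      case (compl A)
      then have "A \<in> sets borel" using borel_E by simp
      then show ?case
        using compl(2) total M1.finite_measure_compl[of A] M2.finite_measure_compl[of A]
            N.finite_measure_compl[of A]
        by (simp add: Compl_eq_Diff_UNIV)
    next
      case (union A)
      then have A: "range A \<subseteq> sets borel" using borel_E by simp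
      have "(\<lambda>i. measure (\<mu> 1) (A i) + measure (\<mu> (-1)) (A i)) sums (measure (\<mu> 1) (\<Union>i. A i) +
          measure (\<mu> (-1)) (\<Union>i. A i))"
        using A union(1) by (intro sums_add M1.finite_measure_UNION M2.finite_measure_UNION) auto
      moreover have "(\<lambda>i. measure \<nu> (A i)) sums measure \<nu> (\<Union>i. A i)"
        using A union(1) by (intro N.finite_measure_UNION) auto
      ultimately show ?case
        using union(3) by (simp add: sums_unique2)
    qed
  qed
  have "absolutely_continuous lborel (\<mu> 1)"
    unfolding absolutely_continuous_def
  proof
    fix A assume A: "A \<in> null_sets (lborel :: real measure)"
    then have [simp]: "A \<in> sets borel" by auto
    have "A \<in> null_sets \<nu>"
      using A absolutely_continuousI_density[of "\<lambda>x. ennreal (2 * k x)" lborel]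
      unfolding \<nu>_def absolutely_continuous_def by auto
    then have "measure \<nu> A = 0" by (simp add: measure_def null_setsD1)
    then have "measure (\<mu> 1) A = 0"
      using add[of A] by (simp add: add_nonneg_eq_0_iff)
    then show "A \<in> null_sets (\<mu> 1)"
      by (intro null_setsI) (auto simp: M1.emeasure_eq_measure)
  qed
  then obtain f where f[measurable]: "f \<in> borel_measurable lborel" and d: "density lborel f = \<mu> 1"
    using sigma_finite_measure.Radon_Nikodym[OF sigma_finite_lborel, of "\<mu> 1"] by auto
  have "(\<integral>\<^sup>+x. f x \<partial>lborel) = emeasure (\<mu> 1) UNIV"
    by (simp add: d[symmetric] emeasure_density)
  then have f_fin: "(\<integral>\<^sup>+x. f x \<partial>lborel) < \<infinity>"
    by (simp add: M1.emeasure_eq_measure)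
  then have f_AE: "AE x in lborel. f x \<noteq> \<infinity>"
    by (intro nn_integral_PInf_AE) auto
  define h1 where "h1 x = enn2real (f x)" for x
  have [measurable]: "h1 \<in> borel_measurable lborel" unfolding h1_def by measurable
  have "(\<integral>\<^sup>+x. ennreal (h1 x) \<partial>lborel) \<le> (\<integral>\<^sup>+x. f x \<partial>lborel)"
    unfolding h1_def by (intro nn_integral_mono) (simp add: ennreal_enn2real_if)
  then have h1: "integrable lborel h1"
    using f_fin by (intro integrableI_nonneg) (auto simp: h1_def intro: order.strict_trans1)
  have h1i: "integrable lborel (\<lambda>x. indicator S x * h1 x)" if "S \<in> sets borel" for S
    using integrable_mult_indicator[of S lborel h1] that h1 by simp
  have F: "P t + \<psi> t - (P s + \<psi> s) = (LINT x|lborel. indicator {s<..t} x * h1 x)" if "s \<le> t" for s t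
  proof -
    have "emeasure (\<mu> 1) {s<..t} = (\<integral>\<^sup>+x. ennreal (indicator {s<..t} x * h1 x) \<partial>lborel)"
      unfolding d[symmetric] using f_AE
      by (subst emeasure_density, simp, simp, intro nn_integral_cong_AE)
         (auto simp: h1_def less_top split: split_indicator elim!: eventually_mono)
    also have "\<dots> = ennreal (LINT x|lborel. indicator {s<..t} x * h1 x)"
      by (intro nn_integral_eq_integral h1i) (auto simp: h1_def)
    finally have "ennreal (P t + \<psi> t - (P s + \<psi> s))
        = ennreal (LINT x|lborel. indicator {s<..t} x * h1 x)"
      using \<mu>_Ioc[OF that, of 1] by simp
    moreover have "0 \<le> (LINT x|lborel. indicator {s<..t} x * h1 x)"
      by (rule Bochner_Integration.integral_nonneg) (simp add: h1_def)
    ultimately show ?thesis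
      using \<psi>[OF that] by (simp add: ennreal_inj)
  qed
  show ?thesis
  proof (rule that)
    show hk: "integrable lborel (\<lambda>x. h1 x - k x)" using h1 k by simp
    fix s t assume st: "a \<le> s" "s \<le> t" "t \<le> b"
    have "\<phi> t - \<phi> s = (P t + \<psi> t - (P s + \<psi> s)) - (P t - P s)"
      using st c by (simp add: \<psi>_def)
    also have "\<dots> = (LINT r:{s<..t}|lborel. h1 r - k r)"
      unfolding F[OF st(2)] P_diff[OF st(2)] set_lebesgue_integral_def
      by (subst Bochner_Integration.integral_diff[symmetric]) (use h1i ki in \<open>simp_all add:
          right_diff_distrib\<close>)
    also have "\<dots> = (LINT r:{s..t}|lborel. h1 r - k r)"
      by (intro set_integral_Icc_eq_Ioc[symmetric]) (simp add: set_borel_measurable_def)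
    finally show "\<phi> t - \<phi> s = (LINT r:{s..t}|lborel. h1 r - k r)" .
  qed
qed

text \<open>
  The density of \<open>W\<close> is almost everywhere its derivative.
\<close>

lemma antimono_if_derivative_nonpos_AE:
  fixes W :: "real \<Rightarrow> real"
  assumes ab: "a \<le> b" and g: "set_integrable lborel {a..b} g"
    and W: "\<And>s t. a \<le> s \<Longrightarrow> s \<le> t \<Longrightarrow> t \<le> b \<Longrightarrow> \<bar>W t - W s\<bar> \<le> (LINT r:{s..t}|lborel. g r)"
    and D: "AE t in lborel. a < t \<and> t < b \<longrightarrow> (\<exists>D\<le>0. (W has_real_derivative D) (at t))"
  shows "W b \<le> W a"
proof -
  obtain h where h: "integrable lborel h"
    "\<And>s t. a \<le> s \<Longrightarrow> s \<le> t \<Longrightarrow> t \<le> b \<Longrightarrow> W t - W s = (LINT r:{s..t}|lborel. h r)"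
    using dominated_increments_density[OF ab g W] by blast
  have hi: "set_integrable lborel {a..b} h"
    using integrable_mult_indicator[of "{a..b}" lborel h] h(1) by (simp add: set_integrable_def)
  have "AE t in lborel. a < t \<and> t < b \<longrightarrow> (W has_real_derivative h t) (at t)"
    using hi h(2) by (rule AE_indefinite_integral_has_derivative)
  with D have "AE t in lborel. indicator {a..b} t *\<^sub>R h t \<le> 0"
    using AE_lborel_singleton[of a] AE_lborel_singleton[of b]
  proof eventually_elim
    case (elim t)
    show ?case
    proof (cases "a < t \<and> t < b")
      case True
      then show ?thesis using elim DERIV_unique by (fastforce simp: mult_le_0_iff)
    qed (use elim in \<open>auto split: split_indicator\<close>)
  qed
  then have "0 \<le> (LINT t|lborel. - (indicator {a..b} t *\<^sub>R h t))"
    by (intro integral_nonneg_AE) auto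
  then have "(LINT r:{a..b}|lborel. h r) \<le> 0"
    by (simp add: set_lebesgue_integral_def)
  with h(2)[of a b] ab show ?thesis by simp
qed

section \<open>Difference quotients of monotone functions\<close>

lemma mono_imp_integrable_on:
  fixes R :: "real \<Rightarrow> real"
  assumes "mono R"
  shows "R integrable_on {a..b}"
proof -
  have [measurable]: "R \<in> borel_measurable borel" by (rule borel_measurable_mono[OF assms])
  have "set_integrable lborel {a..b} R"
    unfolding set_integrable_def
  proof (rule Bochner_Integration.integrable_bound[where f="\<lambda>x. (\<bar>R a\<bar> + \<bar>R b\<bar>) * indicator {a..b}
      x"])
    show "integrable lborel (\<lambda>x. (\<bar>R a\<bar> + \<bar>R b\<bar>) * indicat_real {a..b} x)"
      by (intro integrable_mult_right integrable_real_indicator) (auto simp: emeasure_lborel_Icc_eq)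
    show "AE x in lborel. norm (indicat_real {a..b} x *\<^sub>R R x)
        \<le> norm ((\<bar>R a\<bar> + \<bar>R b\<bar>) * indicat_real {a..b} x)"
    proof (rule AE_I2)
      fix x
      have "\<bar>R x\<bar> \<le> \<bar>R a\<bar> + \<bar>R b\<bar>" if "a \<le> x" "x \<le> b"
        using monoD[OF assms that(1)] monoD[OF assms that(2)] by linarith
      then show "norm (indicat_real {a..b} x *\<^sub>R R x)
          \<le> norm ((\<bar>R a\<bar> + \<bar>R b\<bar>) * indicat_real {a..b} x)"
        by (auto split: split_indicator)
    qed
  qed measurable
  then show ?thesis by (rule set_borel_integral_eq_integral)
qed

lemma integral_shift_difference:
  fixes f :: "real \<Rightarrow> real"
  assumes f: "\<And>u v. f integrable_on {u..v}" and "a \<le> b" "0 \<le> \<tau>"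
  shows "((\<lambda>t. f (t + \<tau>) - f t) has_integral (integral {b..b+\<tau>} f - integral {a..a+\<tau>} f)) {a..b}"
proof -
  have "(f has_integral integral {a+\<tau>..b+\<tau>} f) {a+\<tau>..b+\<tau>}"
    using f by (rule integrable_integral)
  then have "((\<lambda>t. f (t + \<tau>)) has_integral integral {a+\<tau>..b+\<tau>} f) {a..b}"
    using has_integral_shift_Icc_real[of f \<tau> _ a b] by (simp add: o_def add.commute)
  then have "((\<lambda>t. f (t + \<tau>) - f t) has_integral (integral {a+\<tau>..b+\<tau>} f - integral {a..b} f))
      {a..b}"
    using integrable_integral[OF f] by (rule has_integral_diff)
  moreover have 1: "integral {a..a+\<tau>} f + integral {a+\<tau>..b+\<tau>} f = integral {a..b+\<tau>} f"
    using assms by (intro Henstock_Kurzweil_Integration.integral_combine) auto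
  moreover have 2: "integral {a..b} f + integral {b..b+\<tau>} f = integral {a..b+\<tau>} f"
    using assms by (intro Henstock_Kurzweil_Integration.integral_combine) auto
  have "integral {a+\<tau>..b+\<tau>} f - integral {a..b} f = integral {b..b+\<tau>} f - integral {a..a+\<tau>} f"
    using 1 2 by linarith
  ultimately show ?thesis by simp
qed

text \<open>
  The integral of the difference telescopes to averages of \<open>R\<close> over intervals of length \<open>\<tau>\<close> at the two
  ends, which monotonicity compares with the values of \<open>R\<close> there.
\<close>

lemma nn_integral_mono_difference_quotient:
  fixes R :: "real \<Rightarrow> real"
  assumes R: "mono R" and ab: "a \<le> b" and \<tau>: "0 < \<tau>"
  shows "(\<integral>\<^sup>+t\<in>{a..b}. ennreal ((R (t + \<tau>) - R t) / \<tau>) \<partial>lborel) \<le> ennreal (R (b + \<tau>) - R a)"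
proof -
  have [measurable]: "R \<in> borel_measurable borel" by (rule borel_measurable_mono[OF R])
  let ?J = "integral {b..b+\<tau>} R - integral {a..a+\<tau>} R"
  have le: "0 \<le> R (t + \<tau>) - R t" for t
    using monoD[OF R, of t "t + \<tau>"] \<tau> by simp
  have "((\<lambda>t. (R (t + \<tau>) - R t) / \<tau>) has_integral (?J / \<tau>)) {a..b}"
    using integral_shift_difference[OF mono_imp_integrable_on[OF R] ab, of \<tau>] \<tau>
    by (intro has_integral_divide) simp
  then have "((\<lambda>t. indicator {a..b} t *\<^sub>R ((R (t + \<tau>) - R t) / \<tau>)) has_integral (?J / \<tau>)) UNIV"
  proof -
    have "(\<lambda>t. indicat_real {a..b} t *\<^sub>R ((R (t + \<tau>) - R t) / \<tau>)) = (\<lambda>t.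
        if t \<in> {a..b} then (R (t + \<tau>) - R t) / \<tau> else 0)"
      by (auto split: split_indicator)
    then show "((\<lambda>t. (R (t + \<tau>) - R t) / \<tau>) has_integral (?J / \<tau>)) {a..b} \<Longrightarrow> ?thesis"
      by (simp only: has_integral_restrict_UNIV)
  qed
  then have "(\<integral>\<^sup>+t. ennreal (indicator {a..b} t *\<^sub>R ((R (t + \<tau>) - R t) / \<tau>)) \<partial>lborel)
      = ennreal (?J / \<tau>)"
    using le \<tau> by (intro nn_integral_has_integral_lborel) auto
  moreover have "(\<integral>\<^sup>+t\<in>{a..b}. ennreal ((R (t + \<tau>) - R t) / \<tau>) \<partial>lborel)
      = (\<integral>\<^sup>+t. ennreal (indicator {a..b} t *\<^sub>R ((R (t + \<tau>) - R t) / \<tau>)) \<partial>lborel)"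
    by (intro nn_integral_cong) (auto split: split_indicator)
  moreover have "?J \<le> \<tau> * (R (b + \<tau>) - R a)"
  proof -
    have "integral {b..b+\<tau>} R \<le> integral {b..b+\<tau>} (\<lambda>_. R (b + \<tau>))"
      by (intro integral_le mono_imp_integrable_on R monoI) (auto intro: monoD[OF R])
    moreover have "integral {a..a+\<tau>} (\<lambda>_. R a) \<le> integral {a..a+\<tau>} R"
      by (intro integral_le mono_imp_integrable_on R monoI) (auto intro: monoD[OF R])
    ultimately show ?thesis using \<tau> by (simp add: algebra_simps)
  qed
  ultimately show ?thesis
    using \<tau> by (auto intro!: ennreal_leI simp: field_simps)
qed

lemma mono_on_clamp:
  fixes R :: "real \<Rightarrow> real"
  assumes "mono_on {a..b} R" "a \<le> b"
  shows "mono (\<lambda>t. R (max a (min b t)))"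
  using assms by (intro monoI) (auto intro!: mono_onD[OF assms(1)])

text \<open>
  The parameter \<open>\<alpha>\<close> covers left quotients (\<open>\<alpha> = 0\<close>) and right quotients (\<open>\<alpha> = 1\<close>) at once. The measurable
  function \<open>Q\<close> is exposed because the functions it will dominate, such as slopes along a curve, need not
  be measurable, and their upper bounds on two adjacent intervals have to be added.
\<close>

lemma nn_integral_lower_Dini_derivative:
  fixes R :: "real \<Rightarrow> real"
  assumes R: "mono_on {a..b} R" and ab: "a \<le> b" and \<alpha>: "0 \<le> \<alpha>" "\<alpha> \<le> 1"
  obtains Q where "Q \<in> borel_measurable borel"
    "\<And>t. a < t \<Longrightarrow> t < b \<Longrightarrow> Q t = liminf (\<lambda>n. ennreal (real (Suc n) * (R (t + \<alpha> / real (Suc n)) - R (t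
        - (1 - \<alpha>) / real (Suc n)))))"
    "(\<integral>\<^sup>+t\<in>{a..b}. Q t \<partial>lborel) \<le> ennreal (R b - R a)"
proof -
  define S where "S t = R (max a (min b t))" for t
  have S: "mono S" unfolding S_def using R ab by (rule mono_on_clamp)
  have [measurable]: "S \<in> borel_measurable borel" by (rule borel_measurable_mono[OF S])
  define Q where "Q n t = ennreal (real (Suc n) * (S (t + \<alpha> / real (Suc n)) - S (t - (1 - \<alpha>) / real
      (Suc n))))" for n t
  have [measurable]: "Q n \<in> borel_measurable borel" for n
    unfolding Q_def[abs_def] by measurable
  have eq: "liminf (\<lambda>n. Q n t) = liminf (\<lambda>n. ennreal (real (Suc n) * (R (t + \<alpha> / real (Suc n)) - R
      (t - (1 - \<alpha>) / real (Suc n)))))"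
    if t: "a < t" "t < b" for t
  proof (rule Liminf_eq)
    have "(\<lambda>n. t + \<alpha> / real (Suc n)) \<longlonglongrightarrow> t + 0" "(\<lambda>n. t - (1 - \<alpha>) / real (Suc n)) \<longlonglongrightarrow> t - 0"
      by (intro tendsto_add tendsto_diff tendsto_const LIMSEQ_Suc lim_const_over_n)+
    then have "eventually (\<lambda>n. t + \<alpha> / real (Suc n) < b) sequentially"
      "eventually (\<lambda>n. a < t - (1 - \<alpha>) / real (Suc n)) sequentially"
      using t by (auto dest: order_tendstoD)
    then show "eventually (\<lambda>n. Q n t = ennreal (real (Suc n) * (R (t + \<alpha> / real (Suc n)) - R (t - (1
        - \<alpha>) / real (Suc n))))) sequentially"
    proof eventually_elim
      case (elim n)
      have "0 \<le> \<alpha> / real (Suc n)" "0 \<le> (1 - \<alpha>) / real (Suc n)"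
        using \<alpha> by simp_all
      then have "S (t + \<alpha> / real (Suc n)) = R (t + \<alpha> / real (Suc n))"
        "S (t - (1 - \<alpha>) / real (Suc n)) = R (t - (1 - \<alpha>) / real (Suc n))"
        using t elim unfolding S_def by (intro arg_cong[of _ _ R]; linarith)+
      then show ?case by (simp only: Q_def)
    qed
  qed
  have "(\<integral>\<^sup>+t\<in>{a..b}. liminf (\<lambda>n. Q n t) \<partial>lborel)
      = (\<integral>\<^sup>+t. liminf (\<lambda>n. Q n t * indicator {a..b} t) \<partial>lborel)"
    by (intro nn_integral_cong) (auto simp: Liminf_const split: split_indicator)
  also have "\<dots> \<le> liminf (\<lambda>n. \<integral>\<^sup>+t\<in>{a..b}. Q n t \<partial>lborel)"
    by (intro nn_integral_liminf) measurable
  also have "\<dots> \<le> liminf (\<lambda>n::nat. ennreal (R b - R a))"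
  proof (intro Liminf_mono always_eventually allI)
    fix n
    let ?\<tau> = "1 / real (Suc n)"
    define S' where "S' t = S (t - (1 - \<alpha>) / real (Suc n))" for t
    have S': "mono S'"
      unfolding S'_def by (intro monoI monoD[OF S]) simp
    have eq: "t + ?\<tau> - (1 - \<alpha>) / real (Suc n) = t + \<alpha> / real (Suc n)" for t
      by (simp add: diff_divide_distrib)
    have "(\<integral>\<^sup>+t\<in>{a..b}. Q n t \<partial>lborel) = (\<integral>\<^sup>+t\<in>{a..b}. ennreal ((S' (t + ?\<tau>) - S' t) / ?\<tau>) \<partial>lborel)"
      unfolding Q_def S'_def eq by (simp add: mult.commute)
    also have "\<dots> \<le> ennreal (S' (b + ?\<tau>) - S' a)"
      using S' ab by (intro nn_integral_mono_difference_quotient) auto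
    also have "S' (b + ?\<tau>) = R b"
    proof -
      have "0 \<le> \<alpha> / real (Suc n)" using \<alpha> by simp
      then show ?thesis
        using ab unfolding S'_def eq S_def by (intro arg_cong[of _ _ R]) linarith
    qed
    also have "S' a = R a"
    proof -
      have "0 \<le> (1 - \<alpha>) / real (Suc n)" using \<alpha> by simp
      then show ?thesis
        using ab unfolding S'_def S_def by (intro arg_cong[of _ _ R]) linarith
    qed
    finally show "(\<integral>\<^sup>+t\<in>{a..b}. Q n t \<partial>lborel) \<le> ennreal (R b - R a)" .
  qed
  also have "\<dots> = ennreal (R b - R a)"
    by (intro Liminf_const) simp
  finally show ?thesis
    using eq by (intro that[of "\<lambda>t. liminf (\<lambda>n. Q n t)"]) auto
qed

section \<open>Almost minimal square integrable functions\<close>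

lemma set_integral_Cauchy_Schwarz:
  fixes g :: "real \<Rightarrow> real"
  assumes st: "s \<le> t" and g: "set_integrable lborel {s..t} g"
    and g2: "set_integrable lborel {s..t} (\<lambda>x. (g x)\<^sup>2)"
  shows "(LINT r:{s..t}|lborel. g r)\<^sup>2 \<le> (t - s) * (LINT r:{s..t}|lborel. (g r)\<^sup>2)"
proof (cases "s = t")
  case True
  have "(LINT r:{s..t}|lborel. g r) = (LINT r|(lborel::real measure). 0)"
    unfolding set_lebesgue_integral_def
  proof (rule integral_cong_AE)
    show "AE r in lborel. indicat_real {s..t} r *\<^sub>R g r = 0"
      using AE_lborel_singleton[of t] by eventually_elim (simp add: True)
  qed (use g in \<open>simp_all add: set_integrable_def\<close>)
  then show ?thesis using True by simp
next
  case False
  then have pos: "0 < t - s" using st by simp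
  let ?I = "LINT r:{s..t}|lborel. g r" and ?Q = "LINT r:{s..t}|lborel. (g r)\<^sup>2"
  define c where "c = ?I / (t - s)"
  have ind: "set_integrable lborel {s..t} (\<lambda>_. c\<^sup>2)" "(LINT r:{s..t}|lborel. c\<^sup>2) = (t - s) * c\<^sup>2"
    using st by (simp_all add: set_integrable_def set_lebesgue_integral_def)
  have cg: "set_integrable lborel {s..t} (\<lambda>x. 2 * c * g x)" "(LINT r:{s..t}|lborel. 2 * c * g r)
      = 2 * c * ?I"
    using g by simp_all
  have "0 \<le> (LINT r:{s..t}|lborel. (g r - c)\<^sup>2)"
    unfolding set_lebesgue_integral_def by (rule Bochner_Integration.integral_nonneg) simp
  also have "\<dots> = (LINT r:{s..t}|lborel. (g r)\<^sup>2 - 2 * c * g r + c\<^sup>2)"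
    by (simp add: power2_diff algebra_simps)
  also have "\<dots> = ?Q - 2 * c * ?I + (t - s) * c\<^sup>2"
    using g2 cg ind by (simp only: set_integral_add set_integral_diff)
  finally have "0 \<le> (t - s) * (?Q - 2 * c * ?I + (t - s) * c\<^sup>2)"
    using pos by simp
  also have "\<dots> = (t - s) * ?Q - ?I\<^sup>2"
  proof -
    have I: "?I = c * (t - s)" using pos by (simp add: c_def)
    show ?thesis unfolding I by (simp add: algebra_simps power2_eq_square)
  qed
  finally show ?thesis by simp
qed

lemma square_integrable_on_unit_interval_imp_integrable:
  fixes g :: "real \<Rightarrow> real"
  assumes [measurable]: "g \<in> borel_measurable borel" and sq: "integrable lborel (\<lambda>x. (g x)\<^sup>2)"
    and supp: "\<And>x. x \<notin> {0..1} \<Longrightarrow> g x = 0"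
  shows "integrable lborel g"
proof (rule Bochner_Integration.integrable_bound)
  have "integrable lborel (indicat_real {0..1::real})"
    by (rule integrable_real_indicator) (auto simp: emeasure_lborel_Icc_eq)
  then show "integrable lborel (\<lambda>x. (g x)\<^sup>2 + indicator {0..1} x)"
    using sq by simp
  have "\<bar>g x\<bar> \<le> (g x)\<^sup>2 + indicator {0..1} x" for x
  proof (cases "x \<in> {0..1}")
    case True
    have "0 \<le> (\<bar>g x\<bar> - 1)\<^sup>2" by simp
    then have "2 * \<bar>g x\<bar> \<le> (g x)\<^sup>2 + 1" by (simp add: power2_diff)
    then have "\<bar>g x\<bar> \<le> (g x)\<^sup>2 + 1" using abs_ge_zero[of "g x"] by linarith
    then show ?thesis using True by simp
  qed (simp add: supp)
  then show "AE x in lborel. norm (g x) \<le> norm ((g x)\<^sup>2 + indicat_real {0..1} x)"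
    by (intro AE_I2) (metis abs_ge_self order_trans real_norm_def)
qed measurable

text \<open>
  Choose in each \<open>S k\<close> an element whose norm is almost minimal. Since the sets decrease, the midpoint of
  two of these elements still competes in the larger set, and the parallelogram identity makes the
  sequence Cauchy. Along a fast subsequence it converges almost everywhere under an integrable
  majorant; Fatou's lemma keeps the norm bound.
\<close>

lemma almost_minimisers_converge:
  fixes S :: "nat \<Rightarrow> (real \<Rightarrow> real) set"
  assumes anti: "\<And>i j. i \<le> j \<Longrightarrow> S j \<subseteq> S i"
    and meas: "\<And>k g. g \<in> S k \<Longrightarrow> g \<in> borel_measurable borel"
    and sq: "\<And>k g. g \<in> S k \<Longrightarrow> integrable lborel (\<lambda>x. (g x)\<^sup>2)"
    and supp: "\<And>k g x. g \<in> S k \<Longrightarrow> x \<notin> {0..1} \<Longrightarrow> g x = 0"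
    and mid: "\<And>k g h. g \<in> S k \<Longrightarrow> h \<in> S k \<Longrightarrow> (\<lambda>x. (g x + h x) / 2) \<in> S k"
    and bound: "\<And>k. \<exists>g\<in>S k. (LINT x|lborel. (g x)\<^sup>2) \<le> C"
  obtains G g where "\<And>i. G i \<in> S i" "g \<in> borel_measurable borel" "integrable lborel g"
    "integrable lborel (\<lambda>x. (g x)\<^sup>2)" "(LINT x|lborel. (g x)\<^sup>2) \<le> C"
    "\<And>A. A \<in> sets borel \<Longrightarrow> (\<lambda>i. LINT x:A|lborel. G i x) \<longlonglongrightarrow> (LINT x:A|lborel. g x)"
proof -
  define N where "N g = (LINT x|lborel. (g x)\<^sup>2)" for g :: "real \<Rightarrow> real"
  define m where "m k = Inf (N ` S k)" for k
  have N_nonneg: "0 \<le> N g" for g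
    unfolding N_def by (rule Bochner_Integration.integral_nonneg) simp
  have bdd: "bdd_below (N ` S k)" for k
    using N_nonneg by (intro bdd_belowI[of _ 0]) auto
  have ne: "N ` S k \<noteq> {}" for k using bound[of k] by auto
  have m_le: "m k \<le> N g" if "g \<in> S k" for k g
    unfolding m_def using that bdd by (intro cInf_lower) auto
  have m_C: "m k \<le> C" for k
    using bound[of k] m_le[of _ k] unfolding N_def by force
  have m_inc: "incseq m"
    unfolding incseq_def m_def using anti bdd ne by (intro allI impI cInf_superset_mono) auto
  then obtain L where L: "m \<longlonglongrightarrow> L" "\<And>k. m k \<le> L"
    using m_C incseq_convergent[of m C] by blast
  have "\<exists>g\<in>S k. N g < m k + 1 / real (Suc k)" for k
    using cInf_lessD[OF ne, of k "m k + 1 / real (Suc k)"] unfolding m_def by auto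
  then obtain g0 where g0: "\<And>k. g0 k \<in> S k" "\<And>k. N (g0 k) < m k + 1 / real (Suc k)"
    by metis
  define e where "e k = 2 * (L - m k) + 4 / real (Suc k)" for k
  have e_lim: "e \<longlonglongrightarrow> 0"
  proof -
    have "(\<lambda>k. 2 * (L - m k) + 4 / real (Suc k)) \<longlonglongrightarrow> 2 * (L - L) + 0"
      by (intro tendsto_intros L LIMSEQ_Suc[OF lim_const_over_n])
    then show ?thesis by (simp add: e_def[abs_def])
  qed
  have diff: "integrable lborel (\<lambda>x. (g0 k x - g0 j x)\<^sup>2) \<and> (LINT x|lborel. (g0 k x - g0 j x)\<^sup>2)
      \<le> e k" if "k \<le> j" for k j
  proof -
    let ?M = "\<lambda>x. (g0 k x + g0 j x) / 2"
    have M: "?M \<in> S k" using mid[OF g0(1)[of k]] g0(1)[of j] anti[OF that] by blast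
    have eq: "(g0 k x - g0 j x)\<^sup>2 = 2 * (g0 k x)\<^sup>2 + 2 * (g0 j x)\<^sup>2 - 4 * (?M x)\<^sup>2" for x
      by (simp add: power2_eq_square algebra_simps)
    have i: "integrable lborel (\<lambda>x. 2 * (g0 k x)\<^sup>2)" "integrable lborel (\<lambda>x. 2 * (g0 j x)\<^sup>2)"
        "integrable lborel (\<lambda>x. 4 * (?M x)\<^sup>2)"
      using sq[OF g0(1)] sq[OF M] by simp_all
    have "(LINT x|lborel. (g0 k x - g0 j x)\<^sup>2) = 2 * N (g0 k) + 2 * N (g0 j) - 4 * N ?M"
      unfolding eq N_def using i by simp
    also have "\<dots> \<le> 2 * (m k + 1 / real (Suc k)) + 2 * (L + 1 / real (Suc k)) - 4 * m k"
    proof -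
      define u v where "u = 1 / real (Suc j)" and "v = 1 / real (Suc k)"
      have "u \<le> v" unfolding u_def v_def using that by (simp add: frac_le)
      moreover have "N (g0 k) < m k + v" "N (g0 j) < m j + u"
        using g0(2) by (simp_all add: u_def v_def)
      moreover define M where "M = N ?M"
      moreover have "m k \<le> M" "m j \<le> L" using L(2)[of j] m_le[OF M] by (simp_all add: M_def)
      ultimately show ?thesis unfolding v_def[symmetric] M_def[symmetric] by argo
    qed
    also have "\<dots> = e k" by (simp add: e_def)
    finally show ?thesis unfolding eq using i by simp
  qed
  have "\<exists>p. \<forall>k\<ge>p. e k \<le> (1/4)^i" for i
    using order_tendstoD(2)[OF e_lim, of "(1/4)^i"]
        by (auto simp: eventually_sequentially intro: less_imp_le)
  then obtain p where p: "\<And>i k. k \<ge> p i \<Longrightarrow> e k \<le> (1/4)^i" by metis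
  \<comment> \<open>nondecreasing, at least \<open>i\<close> (so that \<open>G i\<close> lies in \<open>S i\<close>) and at least \<open>p i\<close>\<close>
  define r where "r i = (\<Sum>j\<le>i. Suc (p j))" for i
  have r_p: "p i \<le> r i" and r_i: "i \<le> r i" and r_Suc: "r i \<le> r (Suc i)" for i
  proof -
    show "p i \<le> r i"
      using member_le_sum[of i "{..i}" "\<lambda>j. Suc (p j)"] by (simp add: r_def)
    have "(\<Sum>j\<le>i. 1) \<le> r i" unfolding r_def by (intro sum_mono) simp
    then show "i \<le> r i" by simp
  qed (simp add: r_def)
  define G where "G i = g0 (r i)" for i
  have G: "G i \<in> S i" for i
    using g0(1) anti[OF r_i] by (auto simp: G_def)
  have [measurable]: "G i \<in> borel_measurable borel" for i using meas[OF G] .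
  have GN: "N (G i) \<le> C + 1 / real (Suc i)" for i
  proof -
    have "1 / real (Suc (r i)) \<le> 1 / real (Suc i)" using r_i[of i] by (simp add: frac_le)
    then show ?thesis using g0(2)[of "r i"] m_C[of "r i"] by (simp add: G_def)
  qed
  have supp_int: "integrable lborel (indicat_real {0..1::real})"
    by (rule integrable_real_indicator) (auto simp: emeasure_lborel_Icc_eq)
  have AMGM: "\<bar>d\<bar> \<le> (2^i * d\<^sup>2 + (1/2)^i) / 2" for d :: real and i
  proof -
    have "0 \<le> (2^i * \<bar>d\<bar> - 1)\<^sup>2" by simp
    then have "2 * (2^i * \<bar>d\<bar>) \<le> 2^i * (2^i * d\<^sup>2) + 1"
      by (simp add: power2_diff power_mult_distrib) (simp add: power2_eq_square)
    then have "2 * \<bar>d\<bar> \<le> 2^i * d\<^sup>2 + 1 / 2^i"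
      by (simp add: field_simps)
    then show ?thesis by (simp add: power_one_over)
  qed
  define D where "D i x = G (Suc i) x - G i x" for i x
  have [measurable]: "D i \<in> borel_measurable borel" for i unfolding D_def[abs_def] by measurable
  have D: "integrable lborel (D i) \<and> (LINT x|lborel. \<bar>D i x\<bar>) \<le> (1/2)^i" for i
  proof -
    let ?b = "\<lambda>x. (2^i * (D i x)\<^sup>2 + (1/2)^i * indicator {0..1} x) / 2"
    have Dsq: "integrable lborel (\<lambda>x. (D i x)\<^sup>2)" "(LINT x|lborel. (D i x)\<^sup>2) \<le> (1/4)^i"
      using diff[OF r_Suc[of i]] p[OF r_p[of i]] unfolding D_def G_def
      by (auto simp: power2_commute)
    have b: "integrable lborel ?b" using Dsq supp_int by simp
    have le: "\<bar>D i x\<bar> \<le> ?b x" for x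
    proof (cases "x \<in> {0..1}")
      case True then show ?thesis using AMGM[of "D i x" i] by simp
    next
      case False
      then have "D i x = 0" using supp[OF G] by (simp add: D_def)
      then show ?thesis using False by simp
    qed
    have I: "integrable lborel (D i)"
      by (rule Bochner_Integration.integrable_bound[OF b]) (use le in \<open>auto intro: order_trans\<close>)
    have "(LINT x|lborel. \<bar>D i x\<bar>) \<le> (LINT x|lborel. ?b x)"
      using I b le by (intro Bochner_Integration.integral_mono) auto
    also have "\<dots> = (2^i * (LINT x|lborel. (D i x)\<^sup>2) + (1/2)^i) / 2"
      using Dsq supp_int by simp
    also have "\<dots> \<le> (2^i * (1/4)^i + (1/2)^i) / 2"
      using Dsq(2) by simp
    also have "\<dots> = (1/2)^i"
      by (simp add: power_mult_distrib[symmetric])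
    finally show ?thesis using I by simp
  qed
  have sumD: "summable (\<lambda>i. LINT x|lborel. \<bar>D i x\<bar>)"
    by (rule summable_comparison_test[of _ "\<lambda>i. (1/2)^i"]) (use D in \<open>simp_all add:
        summable_geometric\<close>)
  have AE_sum: "AE x in lborel. summable (\<lambda>i. \<bar>D i x\<bar>)"
  proof -
    have "(\<integral>\<^sup>+x. (\<Sum>i. ennreal \<bar>D i x\<bar>) \<partial>lborel) = (\<Sum>i. \<integral>\<^sup>+x. ennreal \<bar>D i x\<bar> \<partial>lborel)"
      by (intro nn_integral_suminf) measurable
    also have "\<dots> = (\<Sum>i. ennreal (LINT x|lborel. \<bar>D i x\<bar>))"
      using D by (intro suminf_cong nn_integral_eq_integral) auto
    also have "\<dots> = ennreal (\<Sum>i. LINT x|lborel. \<bar>D i x\<bar>)"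
      using sumD by (intro suminf_ennreal2) auto
    finally have "(\<integral>\<^sup>+x. (\<Sum>i. ennreal \<bar>D i x\<bar>) \<partial>lborel) \<noteq> \<infinity>" by simp
    then have "AE x in lborel. (\<Sum>i. ennreal \<bar>D i x\<bar>) \<noteq> \<infinity>"
      by (intro nn_integral_PInf_AE) auto
    then show ?thesis
      by eventually_elim (auto intro: summable_suminf_not_top)
  qed
  have G0: "integrable lborel (G 0)"
    by (rule square_integrable_on_unit_interval_imp_integrable[OF _ sq[OF G] supp[OF G]]) measurable
  have G_sum: "G n x = G 0 x + (\<Sum>i<n. D i x)" for n x
    using sum_lessThan_telescope[of "\<lambda>i. G i x" n] by (simp add: D_def)
  define g where "g x = G 0 x + (\<Sum>i. D i x)" for x
  define w where "w x = \<bar>G 0 x\<bar> + (\<Sum>i. \<bar>D i x\<bar>)" for x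
  have [measurable]: "g \<in> borel_measurable borel" unfolding g_def[abs_def] by measurable
  have w: "integrable lborel w"
    unfolding w_def[abs_def]
  proof (rule Bochner_Integration.integrable_add)
    show "integrable lborel (\<lambda>x. \<bar>G 0 x\<bar>)" using G0 by (rule integrable_abs)
    show "integrable lborel (\<lambda>x. \<Sum>i. \<bar>D i x\<bar>)"
      by (rule integrable_suminf) (use D AE_sum sumD in simp_all)
  qed
  have lim: "AE x in lborel. (\<lambda>n. G n x) \<longlonglongrightarrow> g x"
    using AE_sum
  proof eventually_elim
    case (elim x)
    have "(\<lambda>n. \<Sum>i<n. D i x) \<longlonglongrightarrow> (\<Sum>i. D i x)"
      by (rule summable_LIMSEQ[OF summable_rabs_cancel[OF elim]])
    then have "(\<lambda>n. G 0 x + (\<Sum>i<n. D i x)) \<longlonglongrightarrow> g x"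
      unfolding g_def by (intro tendsto_add tendsto_const)
    then show ?case by (simp only: G_sum[symmetric])
  qed
  have dom: "AE x in lborel. norm (G n x) \<le> w x" for n
    using AE_sum
  proof eventually_elim
    case (elim x)
    have "\<bar>\<Sum>i<n. D i x\<bar> \<le> (\<Sum>i<n. \<bar>D i x\<bar>)" by (rule sum_abs)
    also have "\<dots> \<le> (\<Sum>i. \<bar>D i x\<bar>)" using elim by (intro sum_le_suminf) auto
    finally have "\<bar>G 0 x + (\<Sum>i<n. D i x)\<bar> \<le> w x" unfolding w_def by linarith
    then show ?case by (simp only: G_sum[symmetric] real_norm_def)
  qed
  have g_int: "integrable lborel g"
    by (rule integrable_dominated_convergence[OF _ _ w lim dom]) measurable
  have "(\<integral>\<^sup>+x. ennreal ((g x)\<^sup>2) \<partial>lborel) = (\<integral>\<^sup>+x. liminf (\<lambda>n. ennreal ((G n x)\<^sup>2)) \<partial>lborel)"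
  proof (rule nn_integral_cong_AE)
    show "AE x in lborel. ennreal ((g x)\<^sup>2) = liminf (\<lambda>n. ennreal ((G n x)\<^sup>2))"
      using lim
    proof eventually_elim
      case (elim x)
      then have "(\<lambda>n. ennreal ((G n x)\<^sup>2)) \<longlonglongrightarrow> ennreal ((g x)\<^sup>2)"
        by (intro tendsto_ennrealI tendsto_power)
      from lim_imp_Liminf[OF trivial_limit_sequentially this] show ?case by (rule sym)
    qed
  qed
  also have "\<dots> \<le> liminf (\<lambda>n. \<integral>\<^sup>+x. ennreal ((G n x)\<^sup>2) \<partial>lborel)"
    by (intro nn_integral_liminf) measurable
  also have "\<dots> \<le> liminf (\<lambda>n. ennreal (C + 1 / real (Suc n)))"
  proof (intro Liminf_mono always_eventually allI)
    fix n
    have "(\<integral>\<^sup>+x. ennreal ((G n x)\<^sup>2) \<partial>lborel) = ennreal (N (G n))"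
      unfolding N_def using sq[OF G] by (intro nn_integral_eq_integral) auto
    then show "(\<integral>\<^sup>+x. ennreal ((G n x)\<^sup>2) \<partial>lborel) \<le> ennreal (C + 1 / real (Suc n))"
      using GN by (simp add: ennreal_leI)
  qed
  also have "\<dots> = ennreal C"
  proof (rule lim_imp_Liminf)
    have "(\<lambda>n. ennreal (C + 1 / real (Suc n))) \<longlonglongrightarrow> ennreal (C + 0)"
      by (intro tendsto_ennrealI tendsto_add tendsto_const LIMSEQ_Suc lim_const_over_n)
    then show "(\<lambda>n. ennreal (C + 1 / real (Suc n))) \<longlonglongrightarrow> ennreal C" by simp
  qed simp
  finally have g2: "(\<integral>\<^sup>+x. ennreal ((g x)\<^sup>2) \<partial>lborel) \<le> ennreal C" .
  have C: "0 \<le> C" using bound[of 0] N_nonneg unfolding N_def by (meson order_trans)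
  have g2_int: "integrable lborel (\<lambda>x. (g x)\<^sup>2)"
    using g2 by (intro integrableI_nonneg) (auto intro: order.strict_trans1)
  show ?thesis
  proof (rule that[of G g])
    show "(LINT x|lborel. (g x)\<^sup>2) \<le> C"
      using g2 g2_int C by (subst (asm) nn_integral_eq_integral) auto
    fix A :: "real set" assume [measurable]: "A \<in> sets borel"
    show "(\<lambda>i. LINT x:A|lborel. G i x) \<longlonglongrightarrow> (LINT x:A|lborel. g x)"
      unfolding set_lebesgue_integral_def
    proof (rule integral_dominated_convergence[where w=w])
      show "AE x in lborel. (\<lambda>i. indicat_real A x *\<^sub>R G i x) \<longlonglongrightarrow> indicat_real A x *\<^sub>R g x"
        using lim by eventually_elim (intro tendsto_intros)
      show "AE x in lborel. norm (indicat_real A x *\<^sub>R G i x) \<le> w x" for i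
        using dom[of i] by eventually_elim (auto split: split_indicator intro: order_trans[OF
            abs_ge_zero])
    qed (use w in measurable)
  qed (use G g_int g2_int in auto)
qed

section \<open>The speed of absolutely continuous curves\<close>

lemma integral_atMost_diff:
  fixes k :: "real \<Rightarrow> real"
  assumes k: "integrable lborel k" and "s \<le> t"
  shows "(LINT x|lborel. indicator {..t} x * k x) - (LINT x|lborel. indicator {..s} x * k x)
      = (LINT r:{s..t}|lborel. k r)"
proof -
  have ki: "integrable lborel (\<lambda>x. indicator S x * k x)" if "S \<in> sets borel" for S
    using integrable_mult_indicator[of S lborel k] that k by simp
  have "(LINT x|lborel. indicator {..t} x * k x) - (LINT x|lborel. indicator {..s} x * k x)
      = (LINT x|lborel. indicator {..t} x * k x - indicator {..s} x * k x)"
    by (intro Bochner_Integration.integral_diff[symmetric] ki) auto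
  also have "\<dots> = (LINT r:{s<..t}|lborel. k r)"
    unfolding set_lebesgue_integral_def using assms(2)
    by (intro Bochner_Integration.integral_cong) (auto split: split_indicator)
  also have "\<dots> = (LINT r:{s..t}|lborel. k r)"
    using k by (intro set_integral_Icc_eq_Ioc[symmetric]) (simp add: set_borel_measurable_def)
  finally show ?thesis .
qed

lemma ac_curve_on_imp_continuous_on:
  assumes "ac_curve_on a b \<gamma>"
  shows "continuous_on {a..b} \<gamma>"
proof -
  obtain g where g: "set_integrable lborel {a..b} g"
    "\<And>s t. a \<le> s \<Longrightarrow> s \<le> t \<Longrightarrow> t \<le> b \<Longrightarrow> dist (\<gamma> s) (\<gamma> t) \<le> (LINT r:{s..t}|lborel. g r)"
    using assms unfolding ac_curve_on_def by blast
  define k where "k x = indicator {a..b} x * g x" for x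
  have k: "integrable lborel k" using g(1) by (simp add: set_integrable_def k_def[abs_def])
  define P where "P t = (LINT x|lborel. indicator {..t} x * k x)" for t
  have le: "dist (\<gamma> s) (\<gamma> t) \<le> \<bar>P s - P t\<bar>" if "s \<in> {a..b}" "t \<in> {a..b}" for s t
  proof -
    have *: "dist (\<gamma> s) (\<gamma> t) \<le> P t - P s" if "a \<le> s" "s \<le> t" "t \<le> b" for s t
    proof -
      have "dist (\<gamma> s) (\<gamma> t) \<le> (LINT r:{s..t}|lborel. g r)" using g(2) that by blast
      also have "\<dots> = (LINT r:{s..t}|lborel. k r)"
        unfolding set_lebesgue_integral_def using that
        by (intro Bochner_Integration.integral_cong) (auto simp: k_def split: split_indicator)
      also have "\<dots> = P t - P s" unfolding P_def using integral_atMost_diff[OF k that(2)] by simp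
      finally show ?thesis .
    qed
    show ?thesis
      using *[of s t] *[of t s] that by (cases "s \<le> t") (auto simp: dist_commute)
  qed
  show ?thesis
    unfolding continuous_on
  proof
    fix t assume t: "t \<in> {a..b}"
    have "(P \<longlongrightarrow> P t) (at t)"
      using isCont_integral_atMost[OF k, of t] unfolding P_def[abs_def] isCont_def .
    then have "((\<lambda>s. \<bar>P s - P t\<bar>) \<longlongrightarrow> 0) (at t within {a..b})"
      by (intro tendsto_rabs_zero LIM_zero) (rule tendsto_within_subset[of _ _ _ UNIV], auto)
    then have "((\<lambda>s. dist (\<gamma> s) (\<gamma> t)) \<longlongrightarrow> 0) (at t within {a..b})"
      by (rule Lim_null_comparison[rotated]) (use le t in \<open>auto simp: eventually_at_filter\<close>)
    then show "(\<gamma> \<longlongrightarrow> \<gamma> t) (at t within {a..b})"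
      by (rule tendsto_dist_iff[THEN iffD2])
  qed
qed

lemma tendsto_abs_difference_quotient:
  assumes "(P has_real_derivative d) (at t)"
  shows "((\<lambda>y. \<bar>P y - P t\<bar> / \<bar>y - t\<bar>) \<longlongrightarrow> \<bar>d\<bar>) (at t within S)"
proof -
  have "((\<lambda>y. (P y - P t) / (y - t)) \<longlongrightarrow> d) (at t within S)"
    using assms unfolding has_field_derivative_iff by (rule tendsto_within_subset) simp
  then have "((\<lambda>y. \<bar>(P y - P t) / (y - t)\<bar>) \<longlongrightarrow> \<bar>d\<bar>) (at t within S)"
    by (rule tendsto_rabs)
  then show ?thesis by (simp add: abs_divide)
qed

text \<open>
  For rational \<open>q\<close> the function \<open>\<lambda>t. dist (\<gamma> t) (\<gamma> q)\<close> has a density \<open>h\<close>, and the speed is the supremum \<open>m\<close>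
  of the absolute values of these countably many densities. Distances are at most integrals of \<open>m\<close>
  because \<open>dist (\<gamma> s) (\<gamma> t)\<close> is recovered by letting \<open>q\<close> tend to \<open>t\<close>. At a point where all these functions
  and the indefinite integral of \<open>m\<close> are differentiable, the latter bounds the difference quotient of
  \<open>\<gamma>\<close> from above and the former bound it from below.
\<close>

lemma ac_curve_speed:
  assumes ac: "ac_curve_on 0 1 \<gamma>"
  obtains m where "integrable lborel m" "\<And>x. 0 \<le> m x"
    "\<And>s t. 0 \<le> s \<Longrightarrow> s \<le> t \<Longrightarrow> t \<le> 1 \<Longrightarrow> dist (\<gamma> s) (\<gamma> t) \<le> (LINT r:{s..t}|lborel. m r)"
    "AE t in lborel. 0 < t \<and> t < 1 \<longrightarrow>
       ((\<lambda>s. dist (\<gamma> s) (\<gamma> t) / \<bar>s - t\<bar>) \<longlongrightarrow> m t) (at t within {0..1})"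
proof -
  obtain g where g: "set_integrable lborel {0..1} g"
    "\<And>s t. 0 \<le> s \<Longrightarrow> s \<le> t \<Longrightarrow> t \<le> 1 \<Longrightarrow> dist (\<gamma> s) (\<gamma> t) \<le> (LINT r:{s..t}|lborel. g r)"
    using ac unfolding ac_curve_on_def by blast
  define k where "k x = indicator {0..1} x * g x" for x
  have k: "integrable lborel k" using g(1) by (simp add: set_integrable_def k_def[abs_def])
  then have [measurable]: "k \<in> borel_measurable borel" by simp
  have gk: "dist (\<gamma> s) (\<gamma> t) \<le> (LINT r:{s..t}|lborel. k r)" if "0 \<le> s" "s \<le> t" "t \<le> 1" for s t
  proof -
    have "(LINT r:{s..t}|lborel. g r) = (LINT r:{s..t}|lborel. k r)"
      unfolding set_lebesgue_integral_def using that
      by (intro Bochner_Integration.integral_cong) (auto simp: k_def split: split_indicator)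
    then show ?thesis using g(2)[OF that] by simp
  qed
  have ks: "set_integrable lborel {0..1} f" if "integrable lborel f" for f :: "real \<Rightarrow> real"
    using integrable_mult_indicator[of "{0..1}" lborel f] that by (simp add: set_integrable_def)
  have fs: "integrable lborel (\<lambda>x. indicator {s..t} x * f x)" if "integrable lborel f"
      for f :: "real \<Rightarrow> real" and s t
    using integrable_mult_indicator[of "{s..t}" lborel f] that by simp
  define q where "q = from_nat_into (\<rat> \<inter> {0..1::real})"
  have "0 \<in> \<rat> \<inter> {0..1::real}" by simp
  then have q: "range q = \<rat> \<inter> {0..1}"
    unfolding q_def by (intro range_from_nat_into) (auto intro: countable_Int1 countable_rat)
  define \<phi> where "\<phi> n t = dist (\<gamma> t) (\<gamma> (q n))" for n t
  have \<phi>: "\<bar>\<phi> n t - \<phi> n s\<bar> \<le> dist (\<gamma> s) (\<gamma> t)" for n s t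
    unfolding \<phi>_def by (metis abs_dist_diff_le dist_commute)
  have "\<exists>h. integrable lborel h \<and> (\<forall>s t. 0 \<le> s \<longrightarrow> s \<le> t \<longrightarrow> t \<le> 1 \<longrightarrow> \<phi> n t - \<phi> n s
      = (LINT r:{s..t}|lborel. h r))" for n
  proof (rule dominated_increments_density[of 0 1 g "\<phi> n"])
    show "\<bar>\<phi> n t - \<phi> n s\<bar> \<le> (LINT r:{s..t}|lborel. g r)" if "0 \<le> s" "s \<le> t" "t \<le> 1" for s t
      using \<phi>[of n t s] g(2)[OF that] by simp
  qed (use g(1) in auto)
  then obtain h where h: "\<And>n. integrable lborel (h n)"
    "\<And>n s t. 0 \<le> s \<Longrightarrow> s \<le> t \<Longrightarrow> t \<le> 1 \<Longrightarrow> \<phi> n t - \<phi> n s = (LINT r:{s..t}|lborel. h n r)"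
    by metis
  have [measurable]: "h n \<in> borel_measurable borel" for n using h(1)[of n] by simp
  define P where "P f t = (LINT x|lborel. indicator {..t} x * f x)" for f :: "real \<Rightarrow> real"
      and t :: real
  have P: "P f t - P f s = (LINT r:{s..t}|lborel. f r)" if "integrable lborel f" "s \<le> t" for f s t
    unfolding P_def using integral_atMost_diff[OF that] .
  have P_abs: "dist (\<gamma> s) (\<gamma> t) \<le> \<bar>P f s - P f t\<bar>"
    if f: "integrable lborel f" "\<And>s t. 0 \<le> s \<Longrightarrow> s \<le> t \<Longrightarrow> t \<le> 1 \<Longrightarrow> dist (\<gamma> s) (\<gamma> t)
        \<le> (LINT r:{s..t}|lborel. f r)"
      and "s \<in> {0..1}" "t \<in> {0..1}" for f s t
    using f(2)[of s t] f(2)[of t s] P[OF f(1), of s t] P[OF f(1), of t s] that(3,4)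
    by (cases "s \<le> t") (auto simp: dist_commute)
  have Pder: "AE t in lborel. 0 < t \<and> t < 1 \<longrightarrow> (P f has_real_derivative f t) (at t)"
      if "integrable lborel f" for f
    by (rule AE_indefinite_integral_has_derivative[OF ks[OF that]]) (use P[OF that] in blast)
  have \<phi>der: "AE t in lborel. \<forall>n. 0 < t \<and> t < 1 \<longrightarrow> (\<phi> n has_real_derivative h n t) (at t)"
    unfolding AE_all_countable
    by (intro allI AE_indefinite_integral_has_derivative[OF ks[OF h(1)]]) (use h(2) in blast)
  have hk: "AE t in lborel. 0 < t \<and> t < 1 \<longrightarrow> (\<forall>n. \<bar>h n t\<bar> \<le> \<bar>k t\<bar>)"
    using \<phi>der Pder[OF k]
  proof eventually_elim
    case (elim t)
    show ?case
    proof (intro impI allI)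
      fix n assume t: "0 < t \<and> t < 1"
      have "((\<lambda>y. \<bar>\<phi> n y - \<phi> n t\<bar> / \<bar>y - t\<bar>) \<longlongrightarrow> \<bar>h n t\<bar>) (at t within {0..1})"
        "((\<lambda>y. \<bar>P k y - P k t\<bar> / \<bar>y - t\<bar>) \<longlongrightarrow> \<bar>k t\<bar>) (at t within {0..1})"
        using elim t by (auto intro!: tendsto_abs_difference_quotient)
      moreover have "eventually (\<lambda>y. \<bar>\<phi> n y - \<phi> n t\<bar> / \<bar>y - t\<bar>
          \<le> \<bar>P k y - P k t\<bar> / \<bar>y - t\<bar>) (at t within {0..1})"
      proof -
        have "\<bar>\<phi> n y - \<phi> n t\<bar> \<le> \<bar>P k y - P k t\<bar>" if "y \<in> {0..1}" for y
          using \<phi>[of n y t] P_abs[OF k gk, of t y] that t by auto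
        then have "\<forall>y. y \<noteq> t \<longrightarrow> y \<in> {0..1} \<longrightarrow> \<bar>\<phi> n y - \<phi> n t\<bar> / \<bar>y - t\<bar> \<le> \<bar>P k y - P k t\<bar> / \<bar>y - t\<bar>"
          by (intro allI impI divide_right_mono) simp_all
        then show ?thesis unfolding eventually_at_filter by (rule always_eventually)
      qed
      moreover have "at t within {0..1} \<noteq> bot"
        using t by (simp add: trivial_limit_within islimpt_Icc)
      ultimately show "\<bar>h n t\<bar> \<le> \<bar>k t\<bar>" by (intro tendsto_le[of "at t within {0..1}"])
    qed
  qed
  \<comment> \<open>cutting off at \<open>\<bar>k t\<bar>\<close> keeps the supremum finite at every point and is void almost everywhere
      in the unit interval\<close>
  define m where "m t = (SUP n. min \<bar>h n t\<bar> \<bar>k t\<bar>)" for t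
  have bdd: "bdd_above (range (\<lambda>n. min \<bar>h n t\<bar> \<bar>k t\<bar>))" for t
    by (rule bdd_aboveI2[of _ _ "\<bar>k t\<bar>"]) simp
  have [measurable]: "m \<in> borel_measurable borel"
    unfolding m_def[abs_def] using bdd by (intro borel_measurable_cSUP) auto
  have m_ge: "min \<bar>h n t\<bar> \<bar>k t\<bar> \<le> m t" for n t
    unfolding m_def by (rule cSUP_upper[OF _ bdd]) simp
  have m0: "0 \<le> m t" for t
    using m_ge[of 0 t] by linarith
  have "m t \<le> \<bar>k t\<bar>" for t
    unfolding m_def by (rule cSUP_least) auto
  then have m: "integrable lborel m"
    using m0 by (intro Bochner_Integration.integrable_bound[OF k]) auto
  have m_h: "AE t in lborel. 0 < t \<and> t < 1 \<longrightarrow> (\<forall>n. \<bar>h n t\<bar> \<le> m t)"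
    using hk
  proof eventually_elim
    case (elim t)
    show ?case
    proof (intro impI allI)
      fix n assume "0 < t \<and> t < 1"
      with elim have "min \<bar>h n t\<bar> \<bar>k t\<bar> = \<bar>h n t\<bar>" by simp
      then show "\<bar>h n t\<bar> \<le> m t" using m_ge[of n t] by simp
    qed
  qed
  have \<phi>m: "\<bar>\<phi> n t - \<phi> n s\<bar> \<le> (LINT r:{s..t}|lborel. m r)" if "0 \<le> s" "s \<le> t" "t \<le> 1" for n s t
  proof -
    have "\<bar>\<phi> n t - \<phi> n s\<bar> \<le> (LINT r|lborel. norm (indicator {s..t} r *\<^sub>R h n r))"
      unfolding h(2)[OF that] set_lebesgue_integral_def
      using integral_norm_bound[of lborel "\<lambda>r. indicator {s..t} r *\<^sub>R h n r"] by simp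
    also have "\<dots> \<le> (LINT r|lborel. indicator {s..t} r *\<^sub>R m r)"
    proof (rule Bochner_Integration.integral_mono_AE)
      show "AE r in lborel. norm (indicat_real {s..t} r *\<^sub>R h n r) \<le> indicat_real {s..t} r *\<^sub>R m r"
        using m_h AE_lborel_singleton[of 0] AE_lborel_singleton[of 1]
        by eventually_elim (use that in \<open>auto split: split_indicator\<close>)
      show "integrable lborel (\<lambda>x. norm (indicat_real {s..t} x *\<^sub>R h n x))"
        using fs[OF h(1)[of n], of s t] by (intro integrable_norm) simp
      show "integrable lborel (\<lambda>x. indicat_real {s..t} x *\<^sub>R m x)"
        using fs[OF m] by simp
    qed
    finally show ?thesis by (simp add: set_lebesgue_integral_def)
  qed
  have cont: "continuous_on {0..1} \<gamma>" by (rule ac_curve_on_imp_continuous_on[OF ac])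
  have near: "\<exists>n. dist (\<gamma> (q n)) (\<gamma> t) < e" if t: "t \<in> {0..1}" and e: "e > 0" for t e
  proof -
    obtain d where d: "d > 0" "\<And>y. y \<in> {0..1} \<Longrightarrow> dist y t < d \<Longrightarrow> dist (\<gamma> y) (\<gamma> t) < e"
      using cont t e unfolding continuous_on_iff by blast
    have "max 0 (t - d) < min 1 (t + d)" using t d by auto
    then obtain y where y: "y \<in> \<rat>" "max 0 (t - d) < y" "y < min 1 (t + d)"
      using Rats_dense_in_real by blast
    then have "y \<in> range q" "dist y t < d" "y \<in> {0..1}" by (auto simp: q dist_real_def)
    then show ?thesis using d(2) by blast
  qed
  have dm: "dist (\<gamma> s) (\<gamma> t) \<le> (LINT r:{s..t}|lborel. m r)" if st: "0 \<le> s" "s \<le> t" "t \<le> 1" for s t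
  proof (rule field_le_epsilon)
    fix e :: real assume "e > 0"
    then obtain n where n: "dist (\<gamma> (q n)) (\<gamma> t) < e / 2" using near[of t "e/2"] st by auto
    have "dist (\<gamma> s) (\<gamma> t) \<le> \<phi> n s + dist (\<gamma> (q n)) (\<gamma> t)"
      unfolding \<phi>_def by (rule dist_triangle)
    moreover have "\<phi> n t < e / 2" using n by (simp add: \<phi>_def dist_commute)
    ultimately show "dist (\<gamma> s) (\<gamma> t) \<le> (LINT r:{s..t}|lborel. m r) + e"
      using \<phi>m[OF st, of n] n by linarith
  qed
  have "AE t in lborel. 0 < t \<and> t < 1 \<longrightarrow>
       ((\<lambda>s. dist (\<gamma> s) (\<gamma> t) / \<bar>s - t\<bar>) \<longlongrightarrow> m t) (at t within {0..1})"
    using \<phi>der Pder[OF m] hk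
  proof eventually_elim
    case (elim t)
    show ?case
    proof (intro impI order_tendstoI)
      fix x assume t: "0 < t \<and> t < 1" and x: "m t < x"
      have "((\<lambda>y. \<bar>P m y - P m t\<bar> / \<bar>y - t\<bar>) \<longlongrightarrow> \<bar>m t\<bar>) (at t within {0..1})"
        using elim t by (auto intro!: tendsto_abs_difference_quotient)
      then have "eventually (\<lambda>y. \<bar>P m y - P m t\<bar> / \<bar>y - t\<bar> < x) (at t within {0..1})"
        using x m0 by (intro order_tendstoD(2)) auto
      moreover have "eventually (\<lambda>y. y \<in> {0..1}) (at t within {0..1})"
        by (simp add: eventually_at_filter)
      ultimately show "eventually (\<lambda>y. dist (\<gamma> y) (\<gamma> t) / \<bar>y - t\<bar> < x) (at t within {0..1})"
      proof eventually_elim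
        case (elim y)
        have "dist (\<gamma> y) (\<gamma> t) / \<bar>y - t\<bar> \<le> \<bar>P m y - P m t\<bar> / \<bar>y - t\<bar>"
          using P_abs[OF m dm, of y t] elim t by (intro divide_right_mono) auto
        then show ?case using elim by linarith
      qed
    next
      fix x assume t: "0 < t \<and> t < 1" and x: "x < m t"
      then obtain n where "x < min \<bar>h n t\<bar> \<bar>k t\<bar>"
        unfolding m_def by (subst (asm) less_cSUP_iff[OF _ bdd]) auto
      then have n: "x < \<bar>h n t\<bar>" by simp
      have "((\<lambda>y. \<bar>\<phi> n y - \<phi> n t\<bar> / \<bar>y - t\<bar>) \<longlongrightarrow> \<bar>h n t\<bar>) (at t within {0..1})"
        using elim t by (auto intro!: tendsto_abs_difference_quotient)
      from order_tendstoD(1)[OF this n]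
      show "eventually (\<lambda>y. x < dist (\<gamma> y) (\<gamma> t) / \<bar>y - t\<bar>) (at t within {0..1})"
      proof eventually_elim
        case (elim y)
        have "\<bar>\<phi> n y - \<phi> n t\<bar> / \<bar>y - t\<bar> \<le> dist (\<gamma> y) (\<gamma> t) / \<bar>y - t\<bar>"
          using \<phi>[of n t y] by (intro divide_right_mono) (auto simp: dist_commute)
        then show ?case using elim by linarith
      qed
    qed
  qed
  with m m0 dm show ?thesis by (rule that)
qed

lemma metric_derivative_eqI:
  assumes t: "0 < t" "t < 1" and "((\<lambda>s. dist (\<gamma> s) (\<gamma> t) / \<bar>s - t\<bar>) \<longlongrightarrow> L) (at t within {0..1})"
  shows "metric_derivative \<gamma> t = L"
  unfolding metric_derivative_def
  by (rule tendsto_Lim[OF _ assms(3)]) (use t in \<open>simp add: trivial_limit_within islimpt_Icc\<close>)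

section \<open>Energy bounds for curves\<close>

text \<open>
  The function \<open>R\<close> plays the role of the energy accumulated up to time \<open>t\<close>: by the Cauchy-Schwarz
  inequality an indefinite integral of the squared speed has this property.
\<close>

definition energy_bound :: "real \<Rightarrow> real \<Rightarrow> (real \<Rightarrow> real) \<Rightarrow> (real \<Rightarrow> 'a::metric_space) \<Rightarrow> bool" where
  "energy_bound a b R \<gamma> \<longleftrightarrow>
     (\<forall>s t. a \<le> s \<and> s \<le> t \<and> t \<le> b \<longrightarrow> (dist (\<gamma> s) (\<gamma> t))\<^sup>2 \<le> (t - s) * (R t - R s))"

lemma energy_boundD:
  "energy_bound a b R \<gamma> \<Longrightarrow> a \<le> s \<Longrightarrow> s \<le> t \<Longrightarrow> t \<le> b \<Longrightarrow> (dist (\<gamma> s) (\<gamma> t))\<^sup>2 \<le> (t - s) * (R t - R s)"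
  by (simp add: energy_bound_def)

lemma energy_bound_mono_on:
  assumes "energy_bound a b R \<gamma>"
  shows "mono_on {a..b} R"
proof (rule mono_onI)
  fix s t assume "s \<in> {a..b}" "t \<in> {a..b}" "s \<le> t"
  then have "0 \<le> (t - s) * (R t - R s)"
    using energy_boundD[OF assms, of s t] by (auto intro: order_trans[OF zero_le_power2])
  then show "R s \<le> R t"
    using \<open>s \<le> t\<close> by (cases "s = t") (auto simp: zero_le_mult_iff)
qed

lemma energy_bound_of_square_density:
  assumes g: "integrable lborel g" "integrable lborel (\<lambda>x. (g x)\<^sup>2)"
    and le: "\<And>s t. 0 \<le> s \<Longrightarrow> s \<le> t \<Longrightarrow> t \<le> 1 \<Longrightarrow> dist (\<gamma> s) (\<gamma> t) \<le> (LINT r:{s..t}|lborel. g r)"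
  shows "energy_bound 0 1 (\<lambda>t. LINT x|lborel. indicator {..t} x * (g x)\<^sup>2) \<gamma>"
  unfolding energy_bound_def
proof (intro allI impI)
  fix s t :: real assume st: "0 \<le> s \<and> s \<le> t \<and> t \<le> 1"
  have si: "set_integrable lborel {s..t} f" if "integrable lborel f" for f :: "real \<Rightarrow> real"
    using integrable_mult_indicator[of "{s..t}" lborel f] that by (simp add: set_integrable_def)
  have "(dist (\<gamma> s) (\<gamma> t))\<^sup>2 \<le> (LINT r:{s..t}|lborel. g r)\<^sup>2"
    using le st by (intro power_mono) auto
  also have "\<dots> \<le> (t - s) * (LINT r:{s..t}|lborel. (g r)\<^sup>2)"
    using st g by (intro set_integral_Cauchy_Schwarz si) auto
  also have "(LINT r:{s..t}|lborel. (g r)\<^sup>2) =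
      (LINT x|lborel. indicator {..t} x * (g x)\<^sup>2) - (LINT x|lborel. indicator {..s} x * (g x)\<^sup>2)"
    using st g by (subst integral_atMost_diff) auto
  finally show "(dist (\<gamma> s) (\<gamma> t))\<^sup>2 \<le> (t - s) *
      ((LINT x|lborel. indicator {..t} x * (g x)\<^sup>2) - (LINT x|lborel. indicator {..s} x * (g x)\<^sup>2))"
          .
qed

lemma finite_energy_imp_energy_bound:
  assumes ac: "ac_curve_on 0 1 \<gamma>"
    and E: "(\<integral>\<^sup>+t\<in>{0..1}. (ennreal (metric_derivative \<gamma> t))\<^sup>2 \<partial>lborel) \<le> ennreal C" and C: "0 \<le> C"
  obtains M where "energy_bound 0 1 M \<gamma>" "M 1 - M 0 \<le> C"
proof -
  obtain m where m: "integrable lborel m" "\<And>x. 0 \<le> m x"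
    "\<And>s t. 0 \<le> s \<Longrightarrow> s \<le> t \<Longrightarrow> t \<le> 1 \<Longrightarrow> dist (\<gamma> s) (\<gamma> t) \<le> (LINT r:{s..t}|lborel. m r)"
    "AE t in lborel. 0 < t \<and> t < 1 \<longrightarrow>
       ((\<lambda>s. dist (\<gamma> s) (\<gamma> t) / \<bar>s - t\<bar>) \<longlongrightarrow> m t) (at t within {0..1})"
    by (rule ac_curve_speed[OF ac]) (rule that; assumption)
  have [measurable]: "m \<in> borel_measurable borel" using m(1) by simp
  define g where "g x = indicator {0..1} x * m x" for x
  have [measurable]: "g \<in> borel_measurable borel" unfolding g_def[abs_def] by measurable
  have g1: "integrable lborel g"
    using integrable_mult_indicator[of "{0..1}" lborel m] m(1) by (simp add: g_def[abs_def])
  have "(\<integral>\<^sup>+x. ennreal ((g x)\<^sup>2) \<partial>lborel) = (\<integral>\<^sup>+t\<in>{0..1}. (ennreal (metric_derivative \<gamma> t))\<^sup>2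
      \<partial>lborel)"
  proof (rule nn_integral_cong_AE)
    show "AE x in lborel. ennreal ((g x)\<^sup>2) = (ennreal (metric_derivative \<gamma> x))\<^sup>2 * indicator {0..1}
        x"
      using m(4) AE_lborel_singleton[of 0] AE_lborel_singleton[of 1]
    proof eventually_elim
      case (elim x)
      show ?case
      proof (cases "x \<in> {0..1}")
        case True
        then have "metric_derivative \<gamma> x = m x"
          using elim by (intro metric_derivative_eqI) auto
        then show ?thesis using True m(2) by (simp add: g_def ennreal_power)
      qed (simp add: g_def)
    qed
  qed
  then have g2: "(\<integral>\<^sup>+x. ennreal ((g x)\<^sup>2) \<partial>lborel) \<le> ennreal C" using E by simp
  then have g2i: "integrable lborel (\<lambda>x. (g x)\<^sup>2)"
    by (intro integrableI_nonneg) (auto intro: order.strict_trans1)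
  have "(LINT x|lborel. (g x)\<^sup>2) \<le> C"
    using g2 g2i C by (subst (asm) nn_integral_eq_integral) auto
  define M where "M t = (LINT x|lborel. indicator {..t} x * (g x)\<^sup>2)" for t
  show ?thesis
  proof (rule that[of M])
    show "energy_bound 0 1 M \<gamma>"
      unfolding M_def[abs_def]
    proof (rule energy_bound_of_square_density[OF g1 g2i])
      fix s t :: real assume st: "0 \<le> s" "s \<le> t" "t \<le> 1"
      have "(LINT r:{s..t}|lborel. g r) = (LINT r:{s..t}|lborel. m r)"
        unfolding set_lebesgue_integral_def using st
        by (intro Bochner_Integration.integral_cong) (auto simp: g_def split: split_indicator)
      then show "dist (\<gamma> s) (\<gamma> t) \<le> (LINT r:{s..t}|lborel. g r)" using m(3)[OF st] by simp
    qed
    have "M 1 - M 0 = (LINT r:{0..1}|lborel. (g r)\<^sup>2)"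
      unfolding M_def using g2i by (subst integral_atMost_diff) auto
    also have "\<dots> = (LINT r|lborel. (g r)\<^sup>2)"
      unfolding set_lebesgue_integral_def by (intro Bochner_Integration.integral_cong) (auto simp:
          g_def split: split_indicator)
    finally show "M 1 - M 0 \<le> C" using \<open>(LINT x|lborel. (g x)\<^sup>2) \<le> C\<close> by simp
  qed
qed

text \<open>
  The extra summand \<open>B\<close> stands for the squared slope at \<open>\<gamma> t\<close>, and the factors \<open>c n\<close> for the distortion of
  distances by the flow during the time step.
\<close>

lemma square_speed_le_liminf:
  assumes lim: "((\<lambda>s. dist (\<gamma> s) (\<gamma> t) / \<bar>s - t\<bar>) \<longlongrightarrow> L) (at t within {0..1})"
    and y: "y \<longlonglongrightarrow> t" "eventually (\<lambda>n. y n \<noteq> t \<and> y n \<in> {0..1}) sequentially"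
    and c: "c \<longlonglongrightarrow> 1"
    and q: "eventually (\<lambda>n. c n * ((dist (\<gamma> (y n)) (\<gamma> t) / \<bar>y n - t\<bar>)\<^sup>2 + B) \<le> q n) sequentially"
  shows "ennreal (L\<^sup>2 + B) \<le> liminf (\<lambda>n. ennreal (q n))"
proof -
  have "filterlim y (at t within {0..1}) sequentially"
    unfolding filterlim_at using y by (auto elim: eventually_mono)
  from filterlim_compose[OF lim this]
  have "(\<lambda>n. c n * ((dist (\<gamma> (y n)) (\<gamma> t) / \<bar>y n - t\<bar>)\<^sup>2 + B)) \<longlonglongrightarrow> 1 * (L\<^sup>2 + B)"
    using c by (intro tendsto_mult tendsto_add tendsto_power tendsto_const)
  then have "(\<lambda>n. ennreal (c n * ((dist (\<gamma> (y n)) (\<gamma> t) / \<bar>y n - t\<bar>)\<^sup>2 + B)))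
      \<longlonglongrightarrow> ennreal (1 * (L\<^sup>2 + B))"
    by (rule tendsto_ennrealI)
  from lim_imp_Liminf[OF trivial_limit_sequentially this]
  have "ennreal (L\<^sup>2 + B) = liminf (\<lambda>n. ennreal (c n * ((dist (\<gamma> (y n)) (\<gamma> t) / \<bar>y n - t\<bar>)\<^sup>2 + B)))"
    by simp
  also have "\<dots> \<le> liminf (\<lambda>n. ennreal (q n))"
    using q by (intro Liminf_mono) (auto elim!: eventually_mono intro: ennreal_leI)
  finally show ?thesis .
qed

text \<open>
  The sign \<open>\<theta>\<close> selects increments to the right or to the left of \<open>t\<close>.
\<close>

lemma square_speed_le_lower_Dini_derivative:
  assumes t: "0 < t" "t < 1"
    and lim: "((\<lambda>s. dist (\<gamma> s) (\<gamma> t) / \<bar>s - t\<bar>) \<longlongrightarrow> L) (at t within {0..1})"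
    and \<theta>: "\<theta> = 1 \<or> \<theta> = - 1"
    and q: "\<And>\<tau>. 0 < \<tau> \<Longrightarrow> t + \<theta> * \<tau> \<in> {0<..<1} \<Longrightarrow>
      exp (- K * \<tau>) * ((dist (\<gamma> (t + \<theta> * \<tau>)) (\<gamma> t) / \<tau>)\<^sup>2 + B) \<le> q (t + \<theta> * \<tau>) / \<tau>"
  shows "ennreal (L\<^sup>2 + B) \<le> liminf (\<lambda>n. ennreal (real (Suc n) * q (t + \<theta> / real (Suc n))))"
proof -
  define \<tau> where "\<tau> n = 1 / real (Suc n)" for n
  have \<tau>: "\<tau> \<longlonglongrightarrow> 0" "\<And>n. 0 < \<tau> n"
    unfolding \<tau>_def[abs_def] by (intro LIMSEQ_Suc[OF lim_const_over_n]) simp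
  have "(\<lambda>n. t + \<theta> * \<tau> n) \<longlonglongrightarrow> t + \<theta> * 0" "(\<lambda>n. exp (- K * \<tau> n)) \<longlonglongrightarrow> exp (- K * 0)"
    by (intro tendsto_intros \<tau>)+
  then have y: "(\<lambda>n. t + \<theta> * \<tau> n) \<longlonglongrightarrow> t" and c: "(\<lambda>n. exp (- K * \<tau> n)) \<longlonglongrightarrow> 1" by simp_all
  have ev: "eventually (\<lambda>n. t + \<theta> * \<tau> n \<in> {0<..<1}) sequentially"
    using y t by (intro topological_tendstoD[OF y]) auto
  have "ennreal (L\<^sup>2 + B) \<le> liminf (\<lambda>n. ennreal (q (t + \<theta> * \<tau> n) / \<tau> n))"
  proof (rule square_speed_le_liminf[OF lim y _ c])
    show "eventually (\<lambda>n. t + \<theta> * \<tau> n \<noteq> t \<and> t + \<theta> * \<tau> n \<in> {0..1}) sequentially"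
      using ev
    proof eventually_elim
      case (elim n) then show ?case using \<theta> \<tau>(2)[of n] by auto
    qed
    show "eventually (\<lambda>n. exp (- K * \<tau> n) * ((dist (\<gamma> (t + \<theta> * \<tau> n)) (\<gamma> t) / \<bar>t + \<theta> * \<tau> n - t\<bar>)\<^sup>2 +
        B)
        \<le> q (t + \<theta> * \<tau> n) / \<tau> n) sequentially"
      using ev
    proof eventually_elim
      case (elim n)
      have "\<bar>t + \<theta> * \<tau> n - t\<bar> = \<tau> n" using \<theta> \<tau>(2)[of n] by auto
      then show ?case using q[OF \<tau>(2) elim] by simp
    qed
  qed
  then show ?thesis by (simp add: \<tau>_def mult.commute)
qed

lemma kinetic_energy_le:
  assumes ac: "ac_curve_on 0 1 \<gamma>" and R: "energy_bound 0 1 R \<gamma>"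
  shows "(\<integral>\<^sup>+t\<in>{0..1}. (ennreal (metric_derivative \<gamma> t))\<^sup>2 \<partial>lborel) \<le> ennreal (R 1 - R 0)"
proof -
  obtain m where m: "integrable lborel m" "\<And>x. 0 \<le> m x"
    "\<And>s t. 0 \<le> s \<Longrightarrow> s \<le> t \<Longrightarrow> t \<le> 1 \<Longrightarrow> dist (\<gamma> s) (\<gamma> t) \<le> (LINT r:{s..t}|lborel. m r)"
    "AE t in lborel. 0 < t \<and> t < 1 \<longrightarrow>
       ((\<lambda>s. dist (\<gamma> s) (\<gamma> t) / \<bar>s - t\<bar>) \<longlongrightarrow> m t) (at t within {0..1})"
    by (rule ac_curve_speed[OF ac]) (rule that; assumption)
  obtain Q where Q: "Q \<in> borel_measurable borel"
    "\<And>t. 0 < t \<Longrightarrow> t < 1 \<Longrightarrow> Q t = liminf (\<lambda>n. ennreal (real (Suc n) * (R (t + 0 / real (Suc n)) - R (t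
        - (1 - 0) / real (Suc n)))))"
    "(\<integral>\<^sup>+t\<in>{0..1}. Q t \<partial>lborel) \<le> ennreal (R 1 - R 0)"
    by (rule nn_integral_lower_Dini_derivative[OF energy_bound_mono_on[OF R] zero_le_one order_refl
        zero_le_one])
       (rule that; assumption)
  have "AE t in lborel. (ennreal (metric_derivative \<gamma> t))\<^sup>2 * indicator {0..1} t
      \<le> Q t * indicator {0..1} t"
    using m(4) AE_lborel_singleton[of 0] AE_lborel_singleton[of 1]
  proof eventually_elim
    case (elim t)
    show ?case
    proof (cases "0 < t \<and> t < 1")
      case t: True
      have "ennreal ((m t)\<^sup>2 + 0) \<le> liminf (\<lambda>n. ennreal (real (Suc n) * (R t - R (t + (- 1) / real
          (Suc n)))))"
      proof (rule square_speed_le_lower_Dini_derivative[where K=0])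
        show "((\<lambda>s. dist (\<gamma> s) (\<gamma> t) / \<bar>s - t\<bar>) \<longlongrightarrow> m t) (at t within {0..1})"
          using elim t by blast
        fix \<tau> :: real assume \<tau>: "0 < \<tau>" "t + - 1 * \<tau> \<in> {0<..<1}"
        then have "(dist (\<gamma> (t - \<tau>)) (\<gamma> t))\<^sup>2 \<le> (t - (t - \<tau>)) * (R t - R (t - \<tau>))"
          using t by (intro energy_boundD[OF R]) auto
        then have "(dist (\<gamma> (t - \<tau>)) (\<gamma> t))\<^sup>2 / \<tau>\<^sup>2 \<le> \<tau> * (R t - R (t - \<tau>)) / \<tau>\<^sup>2"
          by (intro divide_right_mono) simp_all
        then show "exp (- 0 * \<tau>) * ((dist (\<gamma> (t + - 1 * \<tau>)) (\<gamma> t) / \<tau>)\<^sup>2 + 0)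
            \<le> (R t - R (t + - 1 * \<tau>)) / \<tau>"
          using \<tau>(1) by (simp add: power_divide power2_eq_square)
      qed (use t in auto)
      moreover have "metric_derivative \<gamma> t = m t"
        using elim t by (intro metric_derivative_eqI) auto
      ultimately show ?thesis
        using m(2) t by (simp add: Q(2) ennreal_power)
    qed (use elim in \<open>auto split: split_indicator\<close>)
  qed
  then have "(\<integral>\<^sup>+t\<in>{0..1}. (ennreal (metric_derivative \<gamma> t))\<^sup>2 \<partial>lborel)
      \<le> (\<integral>\<^sup>+t\<in>{0..1}. Q t \<partial>lborel)"
    by (rule nn_integral_mono_AE)
  also note Q(3)
  finally show ?thesis .
qed

text \<open>
  The function is the difference quotient \<open>dist (z t) (z (t + \<tau>)) / \<tau>\<close> for a small step \<open>\<tau>\<close>. Its square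
  is at most a difference quotient of \<open>R\<close>, so its norm obeys the energy bound; it dominates the
  increments of the \<open>\<tau>\<close>-averages of \<open>dist (z s)\<close>, which differ little from the function itself.
\<close>

lemma Steklov_quotient_almost_upper_gradient:
  fixes z :: "real \<Rightarrow> 'a::metric_space"
  assumes R: "energy_bound 0 1 R z" and RC: "R 1 - R 0 \<le> C" and e: "0 < e"
  obtains g where "g \<in> borel_measurable borel" "integrable lborel (\<lambda>x. (g x)\<^sup>2)" "(LINT x|lborel. (g
      x)\<^sup>2) \<le> C"
    "\<And>x. x \<notin> {0..1} \<Longrightarrow> g x = 0"
    "\<And>s t. 0 \<le> s \<Longrightarrow> s \<le> t \<Longrightarrow> t \<le> 1 \<Longrightarrow> dist (z s) (z t) \<le> 2 * e + (LINT r:{s..t}|lborel. g r)"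
proof -
  define c where "c t = max 0 (min 1 t)" for t :: real
  define Z S where "Z t = z (c t)" and "S t = R (c t)" for t
  have S: "mono S"
    unfolding S_def c_def by (rule mono_on_clamp[OF energy_bound_mono_on[OF R]]) simp
  have SC: "S t - S s \<le> C" for s t
  proof -
    have "R (c t) \<le> R 1" "R 0 \<le> R (c s)"
      by (intro mono_onD[OF energy_bound_mono_on[OF R]]; simp add: c_def)+
    then show ?thesis using RC by (simp add: S_def)
  qed
  have C: "0 \<le> C" using SC[of 0 0] by simp
  have Z: "(dist (Z s) (Z t))\<^sup>2 \<le> (t - s) * (S t - S s)" if "s \<le> t" for s t
  proof -
    have "(dist (Z s) (Z t))\<^sup>2 \<le> (c t - c s) * (S t - S s)"
      unfolding Z_def S_def by (rule energy_boundD[OF R]) (use that in \<open>auto simp: c_def\<close>)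
    also have "\<dots> \<le> (t - s) * (S t - S s)"
      using monoD[OF S that] that by (intro mult_right_mono) (auto simp: c_def)
    finally show ?thesis .
  qed
  \<comment> \<open>within time \<open>\<tau>\<close> the curve moves by at most \<open>sqrt (\<tau> C) \<le> e\<close>\<close>
  define \<tau> where "\<tau> = e\<^sup>2 / (C + 1)"
  have \<tau>: "0 < \<tau>" using C e by (simp add: \<tau>_def)
  have \<tau>C: "r * C \<le> e\<^sup>2" if "0 \<le> r" "r \<le> \<tau>" for r
  proof -
    have "r * C \<le> \<tau> * (C + 1)" using that C by (intro mult_mono) auto
    then show ?thesis using C by (simp add: \<tau>_def)
  qed
  have osc: "dist (Z s) (Z t) \<le> e" if "\<bar>s - t\<bar> \<le> \<tau>" for s t
  proof -
    have *: "dist (Z s) (Z t) \<le> e" if "s \<le> t" "t - s \<le> \<tau>" for s t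
    proof (rule power2_le_imp_le)
      have "(dist (Z s) (Z t))\<^sup>2 \<le> (t - s) * C"
        using Z[OF that(1)] SC[of t s] that by (meson diff_ge_0_iff_ge mult_left_mono order_trans)
      also have "\<dots> \<le> e\<^sup>2" using that by (intro \<tau>C) auto
      finally show "(dist (Z s) (Z t))\<^sup>2 \<le> e\<^sup>2" .
    qed (use e in simp)
    show ?thesis using *[of s t] *[of t s] that by (cases "s \<le> t") (auto simp: dist_commute)
  qed
  have Z_cont: "continuous_on UNIV Z"
    unfolding continuous_on_iff
  proof (intro ballI allI impI)
    fix t r :: real assume r: "r > 0"
    let ?d = "r\<^sup>2 / (C + 1)"
    have "dist (Z s) (Z t) < r" if "dist s t < ?d" for s
    proof -
      have *: "dist (Z s) (Z t) < r" if st: "s \<le> t" "t - s < ?d" for s t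
      proof (rule power2_less_imp_less)
        have "(dist (Z s) (Z t))\<^sup>2 \<le> (t - s) * C"
          using Z[OF st(1)] SC[of t s] st by (meson diff_ge_0_iff_ge mult_left_mono order_trans)
        also have "\<dots> \<le> (t - s) * (C + 1)" using st by (simp add: mult_left_mono)
        also have "\<dots> < ?d * (C + 1)" using st C by (intro mult_strict_right_mono) auto
        also have "\<dots> = r\<^sup>2" using C by simp
        finally show "(dist (Z s) (Z t))\<^sup>2 < r\<^sup>2" .
      qed (use r in simp)
      show ?thesis using *[of s t] *[of t s] that by (cases "s
          \<le> t") (auto simp: dist_commute dist_real_def)
    qed
    moreover have "?d > 0" using r C by simp
    ultimately show "\<exists>d>0. \<forall>s\<in>UNIV. dist s t < d \<longrightarrow> dist (Z s) (Z t) < r" by blast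
  qed
  have "continuous_on UNIV (\<lambda>t. dist (Z t) (Z (t + \<tau>)))"
    by (intro continuous_on_dist continuous_on_compose2[OF Z_cont] continuous_intros) auto
  then have [measurable]: "(\<lambda>t. dist (Z t) (Z (t + \<tau>))) \<in> borel_measurable borel"
    by (rule borel_measurable_continuous_onI)
  define g where "g t = indicator {0..1} t * (dist (Z t) (Z (t + \<tau>)) / \<tau>)" for t
  have [measurable]: "g \<in> borel_measurable borel" unfolding g_def[abs_def] by measurable
  have "(\<integral>\<^sup>+t. ennreal ((g t)\<^sup>2) \<partial>lborel) \<le> (\<integral>\<^sup>+t\<in>{0..1}. ennreal ((S (t + \<tau>) - S t) / \<tau>) \<partial>lborel)"
  proof (rule nn_integral_mono)
    fix t
    have "(dist (Z t) (Z (t + \<tau>)) / \<tau>)\<^sup>2 \<le> \<tau> * (S (t + \<tau>) - S t) / \<tau>\<^sup>2"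
      using Z[of t "t + \<tau>"] \<tau> by (simp add: power_divide divide_right_mono)
    also have "\<dots> = (S (t + \<tau>) - S t) / \<tau>" using \<tau> by (simp add: power2_eq_square)
    finally show "ennreal ((g t)\<^sup>2) \<le> ennreal ((S (t + \<tau>) - S t) / \<tau>) * indicator {0..1} t"
      by (auto simp: g_def split: split_indicator intro: ennreal_leI)
  qed
  also have "\<dots> \<le> ennreal (S (1 + \<tau>) - S 0)"
    using S \<tau> by (intro nn_integral_mono_difference_quotient) auto
  also have "\<dots> \<le> ennreal C"
    by (intro ennreal_leI SC)
  finally have g2: "(\<integral>\<^sup>+t. ennreal ((g t)\<^sup>2) \<partial>lborel) \<le> ennreal C" .
  have g2i: "integrable lborel (\<lambda>x. (g x)\<^sup>2)"
    using g2 by (intro integrableI_nonneg) (auto intro: order.strict_trans1)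
  have g2C: "(LINT x|lborel. (g x)\<^sup>2) \<le> C"
    using g2 g2i C by (subst (asm) nn_integral_eq_integral) auto
  have g_supp: "g x = 0" if "x \<notin> {0..1}" for x using that by (simp add: g_def)
  have gi: "integrable lborel g"
    by (rule square_integrable_on_unit_interval_imp_integrable[OF _ g2i g_supp]) measurable
  have "dist (z s) (z t) \<le> 2 * e + (LINT r:{s..t}|lborel. g r)" if st: "0 \<le> s" "s \<le> t" "t \<le> 1"
      for s t
  proof -
    define \<phi> where "\<phi> r = dist (Z s) (Z r)" for r
    have "continuous_on UNIV \<phi>"
      unfolding \<phi>_def by (intro continuous_on_dist Z_cont continuous_intros)
    then have \<phi>i: "\<phi> integrable_on {u..v}" for u v
      by (intro integrable_continuous_real) (rule continuous_on_subset, auto)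
    let ?J = "integral {t..t+\<tau>} \<phi> - integral {s..s+\<tau>} \<phi>"
    have "((\<lambda>r. (\<phi> (r + \<tau>) - \<phi> r) / \<tau>) has_integral (?J / \<tau>)) {s..t}"
      using integral_shift_difference[OF \<phi>i st(2), of \<tau>] \<tau> by (intro has_integral_divide) simp
    moreover have "(g has_integral (LINT r:{s..t}|lborel. g r)) {s..t}"
    proof -
      have "set_integrable lborel {s..t} g"
        using integrable_mult_indicator[of "{s..t}" lborel g] gi by (simp add: set_integrable_def)
      from set_borel_integral_eq_integral[OF this] show ?thesis
        by (simp add: has_integral_integrable_integral)
    qed
    ultimately have "?J / \<tau> \<le> (LINT r:{s..t}|lborel. g r)"
    proof (rule has_integral_le)
      fix r assume r: "r \<in> {s..t}"
      have "\<phi> (r + \<tau>) - \<phi> r \<le> dist (Z r) (Z (r + \<tau>))"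
        unfolding \<phi>_def using dist_triangle[of "Z s" "Z (r + \<tau>)" "Z r"] by simp
      then show "(\<phi> (r + \<tau>) - \<phi> r) / \<tau> \<le> g r"
        using r st \<tau> by (simp add: g_def divide_right_mono)
    qed
    moreover have "\<phi> t - 2 * e \<le> ?J / \<tau>"
    proof -
      have "integral {t..t+\<tau>} (\<lambda>_. \<phi> t - e) \<le> integral {t..t+\<tau>} \<phi>"
      proof (rule integral_le[OF _ \<phi>i])
        fix r assume "r \<in> {t..t+\<tau>}"
        then have "dist (Z r) (Z t) \<le> e" by (intro osc) auto
        then show "\<phi> t - e \<le> \<phi> r"
          unfolding \<phi>_def using dist_triangle[of "Z s" "Z t" "Z r"] by linarith
      qed auto
      moreover have "integral {s..s+\<tau>} \<phi> \<le> integral {s..s+\<tau>} (\<lambda>_. e)"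
      proof (rule integral_le[OF \<phi>i])
        fix r assume "r \<in> {s..s+\<tau>}"
        then show "\<phi> r \<le> e" unfolding \<phi>_def by (intro osc) auto
      qed auto
      ultimately show ?thesis using \<tau> by (simp add: field_simps)
    qed
    moreover have "\<phi> t = dist (z s) (z t)"
      using st by (simp add: \<phi>_def Z_def c_def)
    ultimately show ?thesis by linarith
  qed
  then show ?thesis using that[of g] g2i g2C g_supp by simp
qed

text \<open>
  The sets \<open>S k\<close> of square integrable upper gradients of \<open>y\<close> up to an error \<open>1 / (k + 1)\<close> are convex and
  decreasing, and each contains an element of norm at most \<open>C\<close>. Their almost minimal elements converge
  to an upper gradient without error.
\<close>

lemma energy_bound_closure:
  fixes y :: "real \<Rightarrow> 'a::metric_space"
  assumes approx: "\<And>e. 0 < e \<Longrightarrow> \<exists>z R. energy_bound 0 1 R z \<and> R 1 - R 0 \<le> C \<and>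
      (\<forall>t\<in>{0..1}. dist (z t) (y t) \<le> e)"
  shows "ac_curve_on 0 1 y \<and> (\<exists>M. energy_bound 0 1 M y \<and> M 1 - M 0 \<le> C)"
proof -
  define S where "S k = {g. g \<in> borel_measurable borel \<and> integrable lborel (\<lambda>x. (g x)\<^sup>2) \<and>
      (\<forall>x. x \<notin> {0..1} \<longrightarrow> g x = 0) \<and>
    (\<forall>s t. 0 \<le> s \<longrightarrow> s \<le> t \<longrightarrow> t \<le> 1 \<longrightarrow> dist (y s) (y t)
        \<le> 1 / real (Suc k) + (LINT r:{s..t}|lborel. g r))}" for k
  have gi: "set_integrable lborel {s..t} g" if "g \<in> S k" for g k s t
  proof -
    have "integrable lborel g"
      by (rule square_integrable_on_unit_interval_imp_integrable) (use that in \<open>auto simp: S_def\<close>)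
    then show ?thesis
      using integrable_mult_indicator[of "{s..t}" lborel g] by (simp add: set_integrable_def)
  qed
  obtain G g where Gg: "\<And>i. G i \<in> S i" "g \<in> borel_measurable borel" "integrable lborel g"
    "integrable lborel (\<lambda>x. (g x)\<^sup>2)" "(LINT x|lborel. (g x)\<^sup>2) \<le> C"
    "\<And>A. A \<in> sets borel \<Longrightarrow> (\<lambda>i. LINT x:A|lborel. G i x) \<longlonglongrightarrow> (LINT x:A|lborel. g x)"
  proof (rule almost_minimisers_converge[of S C])
    fix i j :: nat assume ij: "i \<le> j"
    show "S j \<subseteq> S i"
    proof
      fix g assume g: "g \<in> S j"
      have ji: "1 / real (Suc j) \<le> 1 / real (Suc i)" using ij by (simp add: frac_le)
      have "dist (y s) (y t) \<le> 1 / real (Suc i) + (LINT r:{s..t}|lborel. g r)" if "0 \<le> s" "s \<le> t" "t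
          \<le> 1" for s t
      proof -
        have "dist (y s) (y t) \<le> 1 / real (Suc j) + (LINT r:{s..t}|lborel. g r)"
          using g that unfolding S_def by blast
        then show ?thesis using ji by linarith
      qed
      then show "g \<in> S i" using g unfolding S_def by blast
    qed
  next
    fix k g h assume gh: "g \<in> S k" "h \<in> S k"
    then have [measurable]: "g \<in> borel_measurable borel" "h \<in> borel_measurable borel"
        by (auto simp: S_def)
    let ?m = "\<lambda>x. (g x + h x) / 2"
    have "integrable lborel (\<lambda>x. (?m x)\<^sup>2)"
    proof (rule Bochner_Integration.integrable_bound)
      show "integrable lborel (\<lambda>x. (g x)\<^sup>2 + (h x)\<^sup>2)" using gh by (simp add: S_def)
      have "(?m x)\<^sup>2 \<le> (g x)\<^sup>2 + (h x)\<^sup>2" for x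
      proof -
        have "4 * (?m x)\<^sup>2 + (g x - h x)\<^sup>2 = 2 * ((g x)\<^sup>2 + (h x)\<^sup>2)"
          by (simp add: power2_eq_square algebra_simps)
        moreover have "A \<le> B" if "4 * A + D = 2 * B" "0 \<le> D" "0 \<le> A" for A B D :: real
          using that by linarith
        ultimately show ?thesis by (metis zero_le_power2)
      qed
      then show "AE x in lborel. norm ((?m x)\<^sup>2) \<le> norm ((g x)\<^sup>2 + (h x)\<^sup>2)" by simp
    qed measurable
    moreover have "dist (y s) (y t) \<le> 1 / real (Suc k) + (LINT r:{s..t}|lborel. ?m r)" if "0 \<le> s" "s
        \<le> t" "t \<le> 1" for s t
    proof -
      have "(LINT r:{s..t}|lborel. ?m r) = ((LINT r:{s..t}|lborel. g r) + (LINT r:{s..t}|lborel. h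
          r)) / 2"
        using gi[OF gh(1), of s t] gi[OF gh(2), of s t] by simp
      moreover have "dist (y s) (y t) \<le> 1 / real (Suc k) + (LINT r:{s..t}|lborel. g r)"
        "dist (y s) (y t) \<le> 1 / real (Suc k) + (LINT r:{s..t}|lborel. h r)"
        using gh that by (auto simp: S_def)
      ultimately show ?thesis by argo
    qed
    ultimately show "?m \<in> S k" using gh by (simp add: S_def)
  next
    fix k
    define e where "e = 1 / (4 * real (Suc k))"
    have e: "0 < e" by (simp add: e_def)
    obtain z R where zR: "energy_bound 0 1 R z" "R 1 - R 0 \<le> C" "\<And>t. t \<in> {0..1} \<Longrightarrow> dist (z t) (y t)
        \<le> e"
      using approx[OF e] by blast
    obtain g where g: "g \<in> borel_measurable borel" "integrable lborel (\<lambda>x. (g x)\<^sup>2)" "(LINT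
        x|lborel. (g x)\<^sup>2) \<le> C"
      "\<And>x. x \<notin> {0..1} \<Longrightarrow> g x = 0"
      "\<And>s t. 0 \<le> s \<Longrightarrow> s \<le> t \<Longrightarrow> t \<le> 1 \<Longrightarrow> dist (z s) (z t) \<le> 2 * e + (LINT r:{s..t}|lborel. g r)"
      by (rule Steklov_quotient_almost_upper_gradient[OF zR(1,2) e]) blast
    have "dist (y s) (y t) \<le> 1 / real (Suc k) + (LINT r:{s..t}|lborel. g r)" if st: "0 \<le> s" "s
        \<le> t" "t \<le> 1" for s t
    proof -
      have "dist (y s) (y t) \<le> dist (z s) (y s) + dist (z s) (z t) + dist (z t) (y t)"
        using dist_triangle[of "y s" "y t" "z s"] dist_triangle[of "z s" "y t" "z t"]
            by (simp add: dist_commute)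
      then have "dist (y s) (y t) \<le> 4 * e + (LINT r:{s..t}|lborel. g r)"
        using zR(3)[of s] zR(3)[of t] g(5)[OF st] st by simp
      moreover have "4 * e = 1 / real (Suc k)" by (simp add: e_def field_simps)
      ultimately show ?thesis by linarith
    qed
    then show "\<exists>g\<in>S k. (LINT x|lborel. (g x)\<^sup>2) \<le> C"
      using g unfolding S_def by blast
  qed (auto simp: S_def)
  have le: "dist (y s) (y t) \<le> (LINT r:{s..t}|lborel. g r)" if "0 \<le> s" "s \<le> t" "t \<le> 1" for s t
  proof (rule LIMSEQ_le_const)
    have "(\<lambda>i. 1 / real (Suc i) + (LINT r:{s..t}|lborel. G i r)) \<longlonglongrightarrow> 0 + (LINT r:{s..t}|lborel. g r)"
      by (intro tendsto_add Gg(6) LIMSEQ_Suc[OF lim_const_over_n]) simp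
    then show "(\<lambda>i. 1 / real (Suc i) + (LINT r:{s..t}|lborel. G i r)) \<longlonglongrightarrow> (LINT r:{s..t}|lborel. g r)"
      by simp
    show "\<exists>N. \<forall>n\<ge>N. dist (y s) (y t) \<le> 1 / real (Suc n) + (LINT r:{s..t}|lborel. G n r)"
      using Gg(1) that by (auto simp: S_def)
  qed
  have si: "set_integrable lborel {0..1} g"
    using integrable_mult_indicator[of "{0..1}" lborel g] Gg(3) by (simp add: set_integrable_def)
  then have "ac_curve_on 0 1 y"
    unfolding ac_curve_on_def using le by blast
  moreover define M where "M t = (LINT x|lborel. indicator {..t} x * (g x)\<^sup>2)" for t
  have "energy_bound 0 1 M y"
    unfolding M_def[abs_def] using Gg(3,4) le by (rule energy_bound_of_square_density)
  moreover have "M 1 - M 0 \<le> C"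
  proof -
    have "M 1 - M 0 = (LINT r:{0..1}|lborel. (g r)\<^sup>2)"
      unfolding M_def using Gg(4) by (subst integral_atMost_diff) auto
    also have "\<dots> \<le> (LINT r|lborel. (g r)\<^sup>2)"
      unfolding set_lebesgue_integral_def
      using integrable_mult_indicator[of "{0..1}" lborel "\<lambda>x. (g x)\<^sup>2"] Gg(4)
      by (intro Bochner_Integration.integral_mono) (auto split: split_indicator)
    finally show ?thesis using Gg(5) by simp
  qed
  ultimately show ?thesis by blast
qed

section \<open>The integrated evolution variational inequality\<close>

text \<open>
  The primitive of \<open>\<lambda>r. exp (l * r)\<close> that vanishes at \<open>0\<close>.
\<close>

definition exp_int :: "real \<Rightarrow> real \<Rightarrow> real" where
  "exp_int l t = (if l = 0 then t else (exp (l * t) - 1) / l)"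

lemma exp_int_has_derivative: "(exp_int l has_real_derivative exp (l * t)) (at t)"
proof (cases "l = 0")
  case True
  then have "exp_int l = (\<lambda>t. t)" by (auto simp: exp_int_def)
  then show ?thesis using True by simp
next
  case False
  then have eq: "exp_int l = (\<lambda>t. (exp (l * t) - 1) / l)" by (auto simp: exp_int_def)
  show ?thesis unfolding eq using False by (auto intro!: derivative_eq_intros)
qed

lemma exp_int_0 [simp]: "exp_int l 0 = 0"
  by (simp add: exp_int_def)

lemma exp_int_diff: "exp_int l t - exp_int l s = exp (l * s) * exp_int l (t - s)"
  by (simp add: exp_int_def right_diff_distrib exp_diff field_simps)

lemma exp_int_double: "exp_int l (2 * a) = exp_int l a * (1 + exp (l * a))"
  using exp_int_diff[of l "2 * a" a] by (simp add: algebra_simps)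

lemma one_minus_exp_eq: "1 - exp (l * a) = - l * exp_int l a"
  by (simp add: exp_int_def)

lemma exp_int_bounds:
  assumes "0 \<le> t"
  shows "t * exp (- \<bar>l\<bar> * t) \<le> exp_int l t" "exp_int l t \<le> t * exp (\<bar>l\<bar> * t)"
proof -
  have "\<exists>z. 0 \<le> z \<and> z \<le> t \<and> exp_int l t = t * exp (l * z)"
  proof (cases "t = 0")
    case True then show ?thesis by (intro exI[of _ 0]) (simp add: exp_int_def)
  next
    case False
    then have "0 < t" using assms by simp
    from MVT2[OF this, of "exp_int l" "\<lambda>t. exp (l * t)"] exp_int_has_derivative
    obtain z where "0 < z" "z < t" "exp_int l t - exp_int l 0 = (t - 0) * exp (l * z)" by blast
    then show ?thesis by (intro exI[of _ z]) simp
  qed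
  then obtain z where z: "0 \<le> z" "z \<le> t" "exp_int l t = t * exp (l * z)" by blast
  have "\<bar>l * z\<bar> \<le> \<bar>l\<bar> * t" using z by (simp add: abs_mult mult_left_mono)
  then show "t * exp (- \<bar>l\<bar> * t) \<le> exp_int l t" "exp_int l t \<le> t * exp (\<bar>l\<bar> * t)"
    unfolding z(3) using assms by (intro mult_left_mono; simp)+
qed

lemma exp_int_pos: "0 < t \<Longrightarrow> 0 < exp_int l t"
  using exp_int_bounds(1)[of t l] by (metis exp_gt_zero less_le_trans mult_pos_pos less_imp_le)

lemma lower_semicontinuous_closed_sublevel:
  assumes "lower_semicontinuous f"
  shows "closed {x. f x \<le> c}"
proof -
  have "open {x. c < f x}"
  proof (subst open_subopen, intro ballI)
    fix x assume "x \<in> {x. c < f x}"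
    then have x: "c < f x" by simp
    then have "c < Liminf (at x) f"
      using assms unfolding lower_semicontinuous_def by (blast intro: less_le_trans)
    then have "eventually (\<lambda>y. c < f y) (at x)" by (rule less_LiminfD)
    then have "eventually (\<lambda>y. c < f y) (nhds x)"
      using x by (simp add: eventually_nhds_conv_at)
    then show "\<exists>T. open T \<and> x \<in> T \<and> T \<subseteq> {x. c < f x}"
      by (auto simp: eventually_nhds)
  qed
  moreover have "{x. f x \<le> c} = - {x. c < f x}" by auto
  ultimately show ?thesis by (simp add: closed_Compl)
qed

lemma lower_semicontinuous_limit_le:
  assumes f: "lower_semicontinuous f" and y: "y \<longlonglongrightarrow> x"
    and c: "\<And>n. f (y n) \<le> ereal (c n)" "c \<longlonglongrightarrow> C"
  shows "f x \<le> ereal C"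
proof (rule ereal_le_epsilon2)
  fix e :: real assume "0 < e"
  then have "eventually (\<lambda>n. c n < C + e) sequentially"
    by (intro order_tendstoD(2)[OF c(2)]) simp
  then have "eventually (\<lambda>n. y n \<in> {x. f x \<le> ereal (C + e)}) sequentially"
  proof eventually_elim
    case (elim n)
    then show ?case using order_trans[OF c(1)[of n], of "ereal (C + e)"] by simp
  qed
  then have "x \<in> {x. f x \<le> ereal (C + e)}"
    using lower_semicontinuous_closed_sublevel[OF f] y
    by (intro Lim_in_closed_set[of _ y sequentially]) auto
  then show "f x \<le> ereal C + ereal e" by simp
qed

lemma effective_domain_real:
  assumes "x \<in> effective_domain f" "\<forall>x. f x \<noteq> - \<infinity>"
  shows "f x = ereal (real_of_ereal (f x))"
  using assms by (cases "f x") (auto simp: effective_domain_def)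

text \<open>
  Since \<open>f\<close> decreases along a trajectory, its value at the later time can stand in for its values in
  between, and the inequality no longer mentions derivatives or null sets.
\<close>

definition integrated_EVI :: "real \<Rightarrow> ('a::metric_space \<Rightarrow> ereal) \<Rightarrow> (real \<Rightarrow> 'a) \<Rightarrow> bool" where
  "integrated_EVI l f \<xi> \<longleftrightarrow>
     (\<forall>t>0. \<xi> t \<in> effective_domain f) \<and> continuous_on {0..} \<xi> \<and>
     (\<forall>s\<ge>0. \<forall>\<delta>>0. \<forall>v\<in>effective_domain f.
        exp (l * \<delta>) * (dist (\<xi> (s + \<delta>)) v)\<^sup>2 / 2 - (dist (\<xi> s) v)\<^sup>2 / 2
          \<le> exp_int l \<delta> * (real_of_ereal (f v) - real_of_ereal (f (\<xi> (s + \<delta>)))))"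

lemma EVI_weighted_square_distance_ac:
  fixes \<xi> :: "real \<Rightarrow> 'a::metric_space" and l K :: real and v :: 'a
  assumes ac: "ac_curve_on a b \<xi>" and ab: "0 < a" "a \<le> b"
  defines "Z \<equiv> \<lambda>t. exp (l * t) * (dist (\<xi> t) v)\<^sup>2 / 2 - K * exp_int l t"
  shows "\<exists>g. set_integrable lborel {a..b} g \<and>
    (\<forall>s t. a \<le> s \<longrightarrow> s \<le> t \<longrightarrow> t \<le> b \<longrightarrow> \<bar>Z t - Z s\<bar> \<le> (LINT r:{s..t}|lborel. g r))"
proof -
  obtain g where g: "set_integrable lborel {a..b} g"
    "\<And>s t. a \<le> s \<Longrightarrow> s \<le> t \<Longrightarrow> t \<le> b \<Longrightarrow> dist (\<xi> s) (\<xi> t) \<le> (LINT r:{s..t}|lborel. g r)"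
    using ac unfolding ac_curve_on_def by blast
  have "continuous_on {a..b} (\<lambda>t. dist (\<xi> t) v)"
    using ac_curve_on_imp_continuous_on[OF ac] by (intro continuous_on_dist continuous_on_const)
  then obtain x where "\<forall>t\<in>{a..b}. dist (\<xi> t) v \<le> dist (\<xi> x) v"
    using continuous_attains_sup[of "{a..b}" "\<lambda>t. dist (\<xi> t) v"] ab by auto
  then obtain B where B: "\<And>t. t \<in> {a..b} \<Longrightarrow> dist (\<xi> t) v \<le> B"
    by blast
  have B0: "0 \<le> B" using B[of a] ab by (auto intro: order_trans[OF zero_le_dist])
  define E where "E = exp (\<bar>l\<bar> * b)"
  have E: "exp (l * t) \<le> E" if "t \<in> {a..b}" for t
  proof -
    have "l * t \<le> \<bar>l\<bar> * t" using that ab by (intro mult_right_mono) auto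
    also have "\<dots> \<le> \<bar>l\<bar> * b" using that by (intro mult_left_mono) auto
    finally show ?thesis by (simp add: E_def)
  qed
  have E0: "0 \<le> E" by (simp add: E_def)
  have lip: "\<bar>exp (l * t) - exp (l * s)\<bar> \<le> \<bar>l\<bar> * E * (t - s) \<and> \<bar>exp_int l t - exp_int l s\<bar>
      \<le> E * (t - s)"
    if st: "a \<le> s" "s \<le> t" "t \<le> b" for s t
  proof (cases "s = t")
    case False
    then have lt: "s < t" using st by simp
    have "\<And>x. ((\<lambda>t. exp (l * t)) has_real_derivative l * exp (l * x)) (at x)"
      by (auto intro!: derivative_eq_intros)
    from MVT2[OF lt this]
    obtain z where z: "s < z" "z < t" "exp (l * t) - exp (l * s) = (t - s) * (l * exp (l * z))"
        by blast
    obtain w where w: "s < w" "w < t" "exp_int l t - exp_int l s = (t - s) * exp (l * w)"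
      using MVT2[OF lt exp_int_has_derivative] by blast
    have "exp (l * z) \<le> E" "exp (l * w) \<le> E" using E z w st by auto
    then have "(t - s) * (\<bar>l\<bar> * exp (l * z)) \<le> (t - s) * (\<bar>l\<bar> * E)" "(t - s) * exp (l * w)
        \<le> (t - s) * E"
      using st by (intro mult_left_mono; simp)+
    then show ?thesis using z(3) w(3) st by (simp add: abs_mult mult.commute mult.left_commute)
  qed simp
  define h where "h r = E * B * g r + (\<bar>l\<bar> * E * B\<^sup>2 / 2 + \<bar>K\<bar> * E)" for r
  show ?thesis
  proof (intro exI[of _ h] conjI allI impI)
    have c: "set_integrable lborel {s..t} (\<lambda>_. c)" for s t c :: real
      unfolding set_integrable_def by (intro integrable_scaleR_left integrable_real_indicator) (auto
          simp: emeasure_lborel_Icc_eq)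
    show "set_integrable lborel {a..b} h"
      unfolding h_def[abs_def] using g(1) c by (intro set_integral_add set_integrable_mult_right)
          auto
    fix s t assume st: "a \<le> s" "s \<le> t" "t \<le> b"
    let ?x = "dist (\<xi> s) v" and ?y = "dist (\<xi> t) v"
    have gs: "set_integrable lborel {s..t} g"
      using g(1) by (rule set_integrable_subset) (use st in auto)
    have xB: "?x \<le> B" "?y \<le> B" using B st by auto
    have "\<bar>?y\<^sup>2 - ?x\<^sup>2\<bar> = \<bar>?y - ?x\<bar> * (?y + ?x)"
      by (simp add: power2_eq_square square_diff_square_factored abs_mult mult.commute)
    also have "\<dots> \<le> dist (\<xi> s) (\<xi> t) * (2 * B)"
      using xB abs_dist_diff_le[of "\<xi> t" v "\<xi> s"] B0 by (intro mult_mono) (auto simp: dist_commute)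
    finally have sq: "\<bar>?y\<^sup>2 - ?x\<^sup>2\<bar> \<le> dist (\<xi> s) (\<xi> t) * (2 * B)" .
    have xB2: "?x\<^sup>2 \<le> B\<^sup>2" using xB by (intro power_mono) auto
    have "Z t - Z s = exp (l * t) * (?y\<^sup>2 - ?x\<^sup>2) / 2 + (exp (l * t) - exp (l * s)) * ?x\<^sup>2 / 2 - K *
        (exp_int l t - exp_int l s)"
      unfolding Z_def by (simp add: field_simps)
    then have "\<bar>Z t - Z s\<bar> \<le> exp (l * t) * \<bar>?y\<^sup>2 - ?x\<^sup>2\<bar> / 2 + \<bar>exp (l * t) - exp (l * s)\<bar> * ?x\<^sup>2 /
        2 + \<bar>K\<bar> * \<bar>exp_int l t - exp_int l s\<bar>"
    proof -
      have "\<bar>p + q - r\<bar> \<le> \<bar>p\<bar> + \<bar>q\<bar> + \<bar>r\<bar>" for p q r :: real by linarith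
      from this[of "exp (l * t) * (?y\<^sup>2 - ?x\<^sup>2) / 2" "(exp (l * t) - exp (l * s)) * ?x\<^sup>2 / 2" "K *
          (exp_int l t - exp_int l s)"]
      show "Z t - Z s = exp (l * t) * (?y\<^sup>2 - ?x\<^sup>2) / 2 + (exp (l * t) - exp (l * s)) * ?x\<^sup>2 / 2 - K
          * (exp_int l t - exp_int l s) \<Longrightarrow> ?thesis"
        by (simp only: abs_mult abs_divide abs_exp_cancel abs_power2 abs_numeral)
    qed
    also have "\<dots> \<le> E * (dist (\<xi> s) (\<xi> t) * (2 * B)) / 2 + (\<bar>l\<bar> * E * (t - s)) * B\<^sup>2 / 2 + \<bar>K\<bar> * (E *
        (t - s))"
      using sq xB2 lip[OF st] E[of t] st E0 by (intro add_mono divide_right_mono mult_mono) auto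
    also have "\<dots> = E * B * dist (\<xi> s) (\<xi> t) + (\<bar>l\<bar> * E * B\<^sup>2 / 2 + \<bar>K\<bar> * E) * (t - s)"
      by (simp add: algebra_simps)
    also have "\<dots> \<le> E * B * (LINT r:{s..t}|lborel. g r) + (\<bar>l\<bar> * E * B\<^sup>2 / 2 + \<bar>K\<bar> * E) * (t - s)"
      using g(2)[OF st] E0 B0 by (intro add_right_mono mult_left_mono) auto
    also have "\<dots> = (LINT r:{s..t}|lborel. h r)"
      unfolding h_def using gs c[of s t] st
      by (subst set_integral_add) (auto simp: set_lebesgue_integral_def)
    finally show "\<bar>Z t - Z s\<bar> \<le> (LINT r:{s..t}|lborel. h r)" .
  qed
qed

text \<open>
  The weight \<open>exp (l * t)\<close> absorbs the term with \<open>l / 2\<close>: the weighted squared distance has derivative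
  at most \<open>K * exp (l * t)\<close> almost everywhere.
\<close>

lemma EVI_weighted_square_distance_le:
  fixes \<xi> :: "real \<Rightarrow> 'a::metric_space"
  assumes evi: "EVI_trajectory l f x \<xi>" and fm: "\<forall>x. f x \<noteq> - \<infinity>"
    and v: "v \<in> effective_domain f" and ab: "0 < a" "a \<le> b"
    and K: "\<And>t. a < t \<Longrightarrow> t < b \<Longrightarrow> real_of_ereal (f v) - real_of_ereal (f (\<xi> t)) \<le> K"
  shows "exp (l * b) * (dist (\<xi> b) v)\<^sup>2 / 2 - exp (l * a) * (dist (\<xi> a) v)\<^sup>2 / 2
      \<le> K * (exp_int l b - exp_int l a)"
proof -
  define Z where "Z t = exp (l * t) * (dist (\<xi> t) v)\<^sup>2 / 2 - K * exp_int l t" for t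
  have "ac_curve_on a b \<xi>"
    using evi ab unfolding EVI_trajectory_def locally_ac_curve_def by blast
  from EVI_weighted_square_distance_ac[OF this ab, of l v K]
  obtain g where g: "set_integrable lborel {a..b} g"
    "\<And>s t. a \<le> s \<Longrightarrow> s \<le> t \<Longrightarrow> t \<le> b \<Longrightarrow> \<bar>Z t - Z s\<bar> \<le> (LINT r:{s..t}|lborel. g r)"
    unfolding Z_def by blast
  have "AE t in lborel. t > 0 \<longrightarrow>
        (\<exists>D. ((\<lambda>s. (dist (\<xi> s) v)\<^sup>2) has_real_derivative D) (at t) \<and>
             ereal (D / 2 + l / 2 * (dist (\<xi> t) v)\<^sup>2) \<le> f v - f (\<xi> t))"
    using evi v unfolding EVI_trajectory_def by blast
  then have "AE t in lborel. a < t \<and> t < b \<longrightarrow> (\<exists>D\<le>0. (Z has_real_derivative D) (at t))"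
  proof eventually_elim
    case (elim t)
    show ?case
    proof
      assume t: "a < t \<and> t < b"
      then obtain D where D: "((\<lambda>s. (dist (\<xi> s) v)\<^sup>2) has_real_derivative D) (at t)"
        "ereal (D / 2 + l / 2 * (dist (\<xi> t) v)\<^sup>2) \<le> f v - f (\<xi> t)"
        using elim ab by auto
      have xt: "\<xi> t \<in> effective_domain f" using evi t ab unfolding EVI_trajectory_def by auto
      have "f v - f (\<xi> t) = ereal (real_of_ereal (f v) - real_of_ereal (f (\<xi> t)))"
        using effective_domain_real[OF v fm] effective_domain_real[OF xt fm]
            by (metis ereal_minus(1))
      with D(2) have "D / 2 + l / 2 * (dist (\<xi> t) v)\<^sup>2
          \<le> real_of_ereal (f v) - real_of_ereal (f (\<xi> t))"
        by (metis ereal_less_eq(3))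
      then have le: "D / 2 + l / 2 * (dist (\<xi> t) v)\<^sup>2 - K \<le> 0" using K[of t] t by simp
      have "((\<lambda>t. exp (l * t)) has_real_derivative l * exp (l * t)) (at t)"
        by (auto intro!: derivative_eq_intros)
      from DERIV_diff[OF DERIV_cdivide[OF DERIV_mult[OF this D(1)],
          of 2] DERIV_cmult[OF exp_int_has_derivative[of l t], of K]]
      have "(Z has_real_derivative (l * exp (l * t) * (dist (\<xi> t) v)\<^sup>2 + D * exp (l * t)) / 2 - K *
          exp (l * t)) (at t)"
        unfolding Z_def by simp
      moreover have "(l * exp (l * t) * (dist (\<xi> t) v)\<^sup>2 + D * exp (l * t)) / 2 - K * exp (l * t) =
          exp (l * t) * (D / 2 + l / 2 * (dist (\<xi> t) v)\<^sup>2 - K)"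
        by (simp add: algebra_simps add_divide_distrib)
      moreover have "exp (l * t) * (D / 2 + l / 2 * (dist (\<xi> t) v)\<^sup>2 - K) \<le> 0"
        using le by (simp add: mult_le_0_iff)
      ultimately show "\<exists>D\<le>0. (Z has_real_derivative D) (at t)" by metis
    qed
  qed
  from antimono_if_derivative_nonpos_AE[OF ab(2) g this]
  have "Z b \<le> Z a" .
  then show ?thesis by (simp add: Z_def algebra_simps)
qed

lemma EVI_trajectory_continuous:
  assumes evi: "EVI_trajectory l f x \<xi>"
  shows "continuous_on {0..} \<xi>"
  unfolding continuous_on
proof
  fix t :: real assume "t \<in> {0..}"
  then consider "t = 0" | "0 < t" by fastforce
  then show "(\<xi> \<longlongrightarrow> \<xi> t) (at t within {0..})"
  proof cases
    case 1
    have "(\<xi> \<longlongrightarrow> \<xi> 0) (at_right 0)" using evi by (simp add: EVI_trajectory_def)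
    moreover have "at 0 within {0..} = at_right (0::real)"
      by (rule at_within_nhd[of _ UNIV]) auto
    ultimately show ?thesis using 1 by simp
  next
    case 2
    have "ac_curve_on (t / 2) (t + 1) \<xi>"
      using evi 2 unfolding EVI_trajectory_def locally_ac_curve_def by auto
    then have "continuous_on {t/2..t+1} \<xi>" by (rule ac_curve_on_imp_continuous_on)
    then have "isCont \<xi> t"
      using 2 by (intro continuous_on_interior[of "{t/2..t+1}"]) auto
    then show ?thesis by (simp add: isCont_def tendsto_within_subset[of _ _ _ UNIV])
  qed
qed

text \<open>
  Otherwise let \<open>p\<close> be the last time in \<open>{s..t}\<close> at which \<open>f\<close> along the trajectory is at most \<open>f (\<xi> s)\<close>; it
  exists by lower semicontinuity. After \<open>p\<close> the energy exceeds \<open>f (\<xi> p)\<close>, so the inequality tested with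
  \<open>\<xi> p\<close> keeps the trajectory at distance zero from \<open>\<xi> p\<close>, against \<open>f (\<xi> t) > f (\<xi> p)\<close>.
\<close>

lemma EVI_energy_decreasing:
  fixes \<xi> :: "real \<Rightarrow> 'a::metric_space"
  assumes evi: "EVI_trajectory l f x \<xi>" and fm: "\<forall>x. f x \<noteq> - \<infinity>" and lsc: "lower_semicontinuous f"
    and st: "0 < s" "s \<le> t"
  shows "f (\<xi> t) \<le> f (\<xi> s)"
proof (rule ccontr)
  assume less: "\<not> f (\<xi> t) \<le> f (\<xi> s)"
  have dom: "\<xi> r \<in> effective_domain f" if "0 < r" for r
    using evi that unfolding EVI_trajectory_def by blast
  let ?A = "{s..t} \<inter> \<xi> -` {y. f y \<le> f (\<xi> s)}"
  have "closed ?A"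
  proof (rule continuous_closed_preimage)
    show "continuous_on {s..t} \<xi>"
      using EVI_trajectory_continuous[OF evi] by (rule continuous_on_subset) (use st in auto)
  qed (auto intro: lower_semicontinuous_closed_sublevel[OF lsc])
  then have "compact ({s..t} \<inter> ?A)" by (intro compact_Int_closed) auto
  then have "compact ?A" by (simp add: Int_assoc[symmetric])
  moreover have "s \<in> ?A" using st by simp
  ultimately obtain p where p: "p \<in> ?A" "\<And>r. r \<in> ?A \<Longrightarrow> r \<le> p"
    using compact_attains_sup[of ?A] by blast
  have "p \<noteq> t" using p(1) less by auto
  then have pt: "s \<le> p" "p < t" "f (\<xi> p) \<le> f (\<xi> s)" using p(1) by auto
  have "exp (l * t) * (dist (\<xi> t) (\<xi> p))\<^sup>2 / 2 - exp (l * p) * (dist (\<xi> p) (\<xi> p))\<^sup>2 / 2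
      \<le> 0 * (exp_int l t - exp_int l p)"
  proof (rule EVI_weighted_square_distance_le[OF evi fm dom])
    fix r assume r: "p < r" "r < t"
    then have "r \<notin> ?A" using p(2)[of r] by auto
    then have "f (\<xi> s) < f (\<xi> r)" using r pt by (auto simp: not_le)
    then have "f (\<xi> p) \<le> f (\<xi> r)" using pt(3) by simp
    then show "real_of_ereal (f (\<xi> p)) - real_of_ereal (f (\<xi> r)) \<le> 0"
      using effective_domain_real[OF dom fm, of p] effective_domain_real[OF dom fm, of r] r pt st
      by (metis diff_le_0_iff_le ereal_less_eq(3) less_le_trans less_trans)
  qed (use pt st in auto)
  then have "exp (l * t) * (dist (\<xi> t) (\<xi> p))\<^sup>2 \<le> 0" by simp
  then have "\<xi> t = \<xi> p" by (simp add: mult_le_0_iff)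
  then show False using less pt(3) by simp
qed

text \<open>
  For a positive initial time, bound \<open>f\<close> along the trajectory from below by its final value; the initial
  time \<open>0\<close> follows by continuity.
\<close>

lemma EVI_trajectory_imp_integrated_EVI:
  fixes \<xi> :: "real \<Rightarrow> 'a::metric_space"
  assumes evi: "EVI_trajectory l f x \<xi>" and fm: "\<forall>x. f x \<noteq> - \<infinity>" and lsc: "lower_semicontinuous f"
  shows "integrated_EVI l f \<xi>"
proof -
  have dom: "\<xi> r \<in> effective_domain f" if "0 < r" for r
    using evi that unfolding EVI_trajectory_def by blast
  have cont: "continuous_on {0..} \<xi>" by (rule EVI_trajectory_continuous[OF evi])
  let ?F = "\<lambda>x. real_of_ereal (f x)"
  have pos: "exp (l * \<delta>) * (dist (\<xi> (s + \<delta>)) v)\<^sup>2 / 2 - (dist (\<xi> s) v)\<^sup>2 / 2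
          \<le> exp_int l \<delta> * (?F v - ?F (\<xi> (s + \<delta>)))"
    if s: "0 < s" and d: "0 < \<delta>" and v: "v \<in> effective_domain f" for s \<delta> v
  proof -
    have "exp (l * (s + \<delta>)) * (dist (\<xi> (s + \<delta>)) v)\<^sup>2 / 2 - exp (l * s) * (dist (\<xi> s) v)\<^sup>2 / 2
        \<le> (?F v - ?F (\<xi> (s + \<delta>))) * (exp_int l (s + \<delta>) - exp_int l s)"
    proof (rule EVI_weighted_square_distance_le[OF evi fm v])
      fix r assume r: "s < r" "r < s + \<delta>"
      have "f (\<xi> (s + \<delta>)) \<le> f (\<xi> r)"
        using r s by (intro EVI_energy_decreasing[OF evi fm lsc]) auto
      moreover have "f (\<xi> (s + \<delta>)) = ereal (?F (\<xi> (s + \<delta>)))" "f (\<xi> r) = ereal (?F (\<xi> r))"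
        using r s by (intro effective_domain_real dom fm; simp)+
      ultimately have "?F (\<xi> (s + \<delta>)) \<le> ?F (\<xi> r)" by (metis ereal_less_eq(3))
      then show "?F v - ?F (\<xi> r) \<le> ?F v - ?F (\<xi> (s + \<delta>))" by simp
    qed (use s d in auto)
    then have "exp (l * s) * (exp (l * \<delta>) * (dist (\<xi> (s + \<delta>)) v)\<^sup>2 / 2 - (dist (\<xi> s) v)\<^sup>2 / 2)
       \<le> exp (l * s) * (exp_int l \<delta> * (?F v - ?F (\<xi> (s + \<delta>))))"
      by (simp add: exp_int_diff distrib_left exp_add algebra_simps)
    then show ?thesis by (rule mult_left_le_imp_le) simp
  qed
  have zero: "exp (l * \<delta>) * (dist (\<xi> \<delta>) v)\<^sup>2 / 2 - (dist (\<xi> 0) v)\<^sup>2 / 2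
          \<le> exp_int l \<delta> * (?F v - ?F (\<xi> \<delta>))"
    if d: "0 < \<delta>" and v: "v \<in> effective_domain f" for \<delta> v
  proof -
    have x0: "(\<xi> \<longlongrightarrow> \<xi> 0) (at_right 0)" using evi by (simp add: EVI_trajectory_def)
    have ei: "((\<lambda>s. exp_int l (\<delta> - s)) \<longlongrightarrow> exp_int l (\<delta> - 0)) (at_right 0)"
    proof (rule isCont_tendsto_compose[of _ "exp_int l"])
      show "isCont (exp_int l) (\<delta> - 0)" by (rule DERIV_isCont[OF exp_int_has_derivative])
    qed (intro tendsto_intros)
    have "((\<lambda>s. exp (l * (\<delta> - s)) * (dist (\<xi> \<delta>) v)\<^sup>2 / 2 - (dist (\<xi> s) v)\<^sup>2 / 2) \<longlongrightarrow>
        exp (l * (\<delta> - 0)) * (dist (\<xi> \<delta>) v)\<^sup>2 / 2 - (dist (\<xi> 0) v)\<^sup>2 / 2) (at_right 0)"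
      by (intro tendsto_intros x0) simp_all
    moreover have "((\<lambda>s. exp_int l (\<delta> - s) * (?F v - ?F (\<xi> \<delta>)))
        \<longlongrightarrow> exp_int l (\<delta> - 0) * (?F v - ?F (\<xi> \<delta>))) (at_right 0)"
      by (intro tendsto_mult tendsto_const ei)
    moreover have "eventually (\<lambda>s. exp (l * (\<delta> - s)) * (dist (\<xi> \<delta>) v)\<^sup>2 / 2 - (dist (\<xi> s) v)\<^sup>2 / 2
         \<le> exp_int l (\<delta> - s) * (?F v - ?F (\<xi> \<delta>))) (at_right 0)"
      using eventually_at_right_real[OF d]
    proof eventually_elim
      case (elim s)
      then show ?case using pos[of s "\<delta> - s" v] v by simp
    qed
    ultimately have "exp (l * (\<delta> - 0)) * (dist (\<xi> \<delta>) v)\<^sup>2 / 2 - (dist (\<xi> 0) v)\<^sup>2 / 2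
        \<le> exp_int l (\<delta> - 0) * (?F v - ?F (\<xi> \<delta>))"
      by (intro tendsto_le[of "at_right 0"]) (auto simp: trivial_limit_at_right_real)
    then show ?thesis by simp
  qed
  show ?thesis
    unfolding integrated_EVI_def
  proof (intro conjI allI impI ballI dom cont)
    fix s \<delta> :: real and v assume "0 \<le> s" "0 < \<delta>" "v \<in> effective_domain f"
    then show "exp (l * \<delta>) * (dist (\<xi> (s + \<delta>)) v)\<^sup>2 / 2 - (dist (\<xi> s) v)\<^sup>2 / 2
          \<le> exp_int l \<delta> * (?F v - ?F (\<xi> (s + \<delta>)))"
      using pos[of s \<delta> v] zero[of \<delta> v] by (cases "s = 0") auto
  qed
qed

section \<open>Contraction and slope along trajectories\<close>

lemma integrated_EVI_dom: "integrated_EVI l f \<xi> \<Longrightarrow> 0 < t \<Longrightarrow> \<xi> t \<in> effective_domain f"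
  by (simp add: integrated_EVI_def)

lemma integrated_EVI_continuous: "integrated_EVI l f \<xi> \<Longrightarrow> continuous_on {0..} \<xi>"
  by (simp add: integrated_EVI_def)

lemma integrated_EVID:
  "integrated_EVI l f \<xi> \<Longrightarrow> 0 \<le> s \<Longrightarrow> 0 < \<delta> \<Longrightarrow> v \<in> effective_domain f \<Longrightarrow>
     exp (l * \<delta>) * (dist (\<xi> (s + \<delta>)) v)\<^sup>2 - (dist (\<xi> s) v)\<^sup>2
       \<le> 2 * exp_int l \<delta> * (real_of_ereal (f v) - real_of_ereal (f (\<xi> (s + \<delta>))))"
proof -
  assume "integrated_EVI l f \<xi>" "0 \<le> s" "0 < \<delta>" "v \<in> effective_domain f"
  then have "exp (l * \<delta>) * (dist (\<xi> (s + \<delta>)) v)\<^sup>2 / 2 - (dist (\<xi> s) v)\<^sup>2 / 2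
       \<le> exp_int l \<delta> * (real_of_ereal (f v) - real_of_ereal (f (\<xi> (s + \<delta>))))"
    by (simp add: integrated_EVI_def)
  then show ?thesis by (simp add: field_simps)
qed

lemma integrated_EVI_energy_decrease:
  assumes "integrated_EVI l f \<xi>" "0 \<le> s" "0 < \<delta>" "\<xi> s \<in> effective_domain f"
  shows "exp (l * \<delta>) * (dist (\<xi> s) (\<xi> (s + \<delta>)))\<^sup>2
    \<le> 2 * exp_int l \<delta> * (real_of_ereal (f (\<xi> s)) - real_of_ereal (f (\<xi> (s + \<delta>))))"
  using integrated_EVID[OF assms] by (simp add: dist_commute)

lemma exp_mult_le_exp_abs: "0 \<le> t \<Longrightarrow> t \<le> T \<Longrightarrow> exp (l * t) \<le> exp (\<bar>l\<bar> * T)"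
  for l t T :: real
proof -
  assume t: "0 \<le> t" "t \<le> T"
  have "l * t \<le> \<bar>l\<bar> * t" using t by (intro mult_right_mono) auto
  also have "\<dots> \<le> \<bar>l\<bar> * T" using t by (intro mult_left_mono) auto
  finally show ?thesis by simp
qed

text \<open>
  For a time step \<open>\<delta>\<close> move first one trajectory, then the other, testing each with the current position of
  the other. Averaging over the two orders cancels the mixed terms and leaves \<open>exp_int l \<delta>\<close> times the
  decrease of the total energy \<open>\<Psi>\<close>. Over \<open>T / \<delta>\<close> steps these errors telescope to a quantity that vanishes
  with \<open>\<delta>\<close>.
\<close>

lemma integrated_EVI_contraction_dom:
  assumes \<xi>: "integrated_EVI l f \<xi>" and \<zeta>: "integrated_EVI l f \<zeta>"
    and sr: "0 \<le> s" "0 \<le> r" "\<xi> s \<in> effective_domain f" "\<zeta> r \<in> effective_domain f" and T: "0 < T"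
  shows "exp (l * T) * dist (\<xi> (s + T)) (\<zeta> (r + T)) \<le> dist (\<xi> s) (\<zeta> r)"
proof -
  let ?F = "\<lambda>x. real_of_ereal (f x)"
  define d where "d t = dist (\<xi> (s + t)) (\<zeta> (r + t))" for t
  define \<Psi> where "\<Psi> t = ?F (\<xi> (s + t)) + ?F (\<zeta> (r + t))" for t
  define A where "A = exp (\<bar>l\<bar> * (2 * T))"
  have dom: "\<xi> (s + t) \<in> effective_domain f" "\<zeta> (r + t) \<in> effective_domain f" if "0 \<le> t" for t
    using that sr integrated_EVI_dom[OF \<xi>, of "s + t"] integrated_EVI_dom[OF \<zeta>, of "r + t"]
    by (cases "t = 0"; simp)+
  have dec: "\<Psi> (t + \<delta>) \<le> \<Psi> t" if "0 \<le> t" "0 < \<delta>" for t \<delta>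
  proof -
    have "0 \<le> 2 * exp_int l \<delta> * (?F (\<xi> (s + t)) - ?F (\<xi> (s + t + \<delta>)))"
      by (rule order_trans[OF _ integrated_EVI_energy_decrease[OF \<xi>]]) (use that sr dom in auto)
    moreover have "0 \<le> 2 * exp_int l \<delta> * (?F (\<zeta> (r + t)) - ?F (\<zeta> (r + t + \<delta>)))"
      by (rule order_trans[OF _ integrated_EVI_energy_decrease[OF \<zeta>]]) (use that sr dom in auto)
    ultimately show ?thesis
      using exp_int_pos[OF that(2), of l] by (simp add: \<Psi>_def zero_le_mult_iff add.assoc)
  qed
  have step: "exp (l * \<delta>) * (exp (l * \<delta>) * (d (t + \<delta>))\<^sup>2) - (d t)\<^sup>2
      \<le> exp_int l \<delta> * (\<Psi> t - \<Psi> (t + \<delta>))"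
    if t: "0 \<le> t" "0 < \<delta>" for t \<delta>
  proof -
    let ?x = "\<xi> (s + t)" and ?x' = "\<xi> (s + t + \<delta>)" and ?y = "\<zeta> (r + t)" and ?y' = "\<zeta> (r + t + \<delta>)"
    let ?e = "exp (l * \<delta>)" and ?I = "exp_int l \<delta>"
    have D: "?x \<in> effective_domain f" "?y \<in> effective_domain f" "?x' \<in> effective_domain f" "?y' \<in>
        effective_domain f"
      using dom[of t] dom[of "t + \<delta>"] t by (simp_all add: add.assoc)
    have 1: "?e * (dist ?x' ?y)\<^sup>2 - (dist ?x ?y)\<^sup>2 \<le> 2 * ?I * (?F ?y - ?F ?x')"
      by (rule integrated_EVID[OF \<xi>]) (use t sr D in auto)
    have 2: "?e * (?e * (dist ?y' ?x')\<^sup>2 - (dist ?y ?x')\<^sup>2) \<le> ?e * (2 * ?I * (?F ?x' - ?F ?y'))"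
      by (intro mult_left_mono integrated_EVID[OF \<zeta>]) (use t sr D in auto)
    have 3: "?e * (dist ?y' ?x)\<^sup>2 - (dist ?y ?x)\<^sup>2 \<le> 2 * ?I * (?F ?x - ?F ?y')"
      by (rule integrated_EVID[OF \<zeta>]) (use t sr D in auto)
    have 4: "?e * (?e * (dist ?x' ?y')\<^sup>2 - (dist ?x ?y')\<^sup>2) \<le> ?e * (2 * ?I * (?F ?y' - ?F ?x'))"
      by (intro mult_left_mono integrated_EVID[OF \<xi>]) (use t sr D in auto)
    have "2 * (?e * (?e * (dist ?x' ?y')\<^sup>2)) - 2 * (dist ?x ?y)\<^sup>2 \<le>
        2 * ?I * (?F ?y - ?F ?x') + ?e * (2 * ?I * (?F ?x' - ?F ?y')) + 2 * ?I * (?F ?x - ?F ?y') +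
            ?e * (2 * ?I * (?F ?y' - ?F ?x'))"
      using 1 2 3 4 by (simp add: dist_commute right_diff_distrib)
    also have "\<dots> = 2 * (?I * (?F ?x + ?F ?y - (?F ?x' + ?F ?y')))"
      by (simp add: algebra_simps)
    finally show ?thesis by (simp add: d_def \<Psi>_def add.assoc)
  qed
  have iter: "exp (l * (2 * (real k * \<delta>))) * (d (real k * \<delta>))\<^sup>2
      \<le> (d 0)\<^sup>2 + A * exp_int l \<delta> * (\<Psi> 0 - \<Psi> (real k * \<delta>))"
    if \<delta>: "0 < \<delta>" and "real k * \<delta> \<le> T" for k \<delta>
    using that(2)
  proof (induction k)
    case (Suc k)
    let ?t = "real k * \<delta>"
    have t: "0 \<le> ?t" "?t \<le> T" using Suc.prems \<delta> by (simp_all add: algebra_simps)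
    have Suc_t: "real (Suc k) * \<delta> = ?t + \<delta>" by (simp add: algebra_simps)
    have eA: "exp (l * (2 * ?t)) \<le> A"
      unfolding A_def using t by (intro exp_mult_le_exp_abs) auto
    have "exp (l * (2 * (?t + \<delta>))) * (d (?t + \<delta>))\<^sup>2
        = exp (l * (2 * ?t)) * (exp (l * \<delta>) * (exp (l * \<delta>) * (d (?t + \<delta>))\<^sup>2))"
    proof -
      have "l * (2 * (?t + \<delta>)) = l * (2 * ?t) + (l * \<delta> + l * \<delta>)" by (simp add: algebra_simps)
      then show ?thesis by (simp only: exp_add mult.assoc)
    qed
    also have "\<dots> \<le> exp (l * (2 * ?t)) * ((d ?t)\<^sup>2 + exp_int l \<delta> * (\<Psi> ?t - \<Psi> (?t + \<delta>)))"
      using step[OF t(1) \<delta>] by (intro mult_left_mono) auto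
    also have "\<dots> = exp (l * (2 * ?t)) * (d ?t)\<^sup>2 + exp (l * (2 * ?t)) * (exp_int l \<delta> * (\<Psi> ?t - \<Psi> (?t
        + \<delta>)))"
      by (simp add: distrib_left)
    also have "\<dots> \<le> ((d 0)\<^sup>2 + A * exp_int l \<delta> * (\<Psi> 0 - \<Psi> ?t)) + A * (exp_int l \<delta> * (\<Psi> ?t - \<Psi> (?t +
        \<delta>)))"
      using Suc.IH[OF t(2)] eA dec[OF t(1) \<delta>] exp_int_pos[OF \<delta>, of l]
      by (intro add_mono mult_right_mono) auto
    also have "\<dots> = (d 0)\<^sup>2 + A * exp_int l \<delta> * (\<Psi> 0 - \<Psi> (?t + \<delta>))"
      by (simp add: algebra_simps)
    finally show ?case by (simp only: Suc_t)
  qed simp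
  have "exp (l * (2 * T)) * (d T)\<^sup>2 \<le> (d 0)\<^sup>2"
  proof (rule LIMSEQ_le_const)
    let ?b = "\<lambda>n. (d 0)\<^sup>2 + A * exp_int l (T / real (Suc n)) * (\<Psi> 0 - \<Psi> T)"
    have "(\<lambda>n. exp_int l (T / real (Suc n))) \<longlonglongrightarrow> exp_int l 0"
      by (intro isCont_tendsto_compose[of _ "exp_int l"] DERIV_isCont[OF exp_int_has_derivative]
          LIMSEQ_Suc[OF lim_const_over_n])
    then have "?b \<longlonglongrightarrow> (d 0)\<^sup>2 + A * exp_int l 0 * (\<Psi> 0 - \<Psi> T)"
      by (intro tendsto_intros)
    then show "?b \<longlonglongrightarrow> (d 0)\<^sup>2" by simp
    have "exp (l * (2 * T)) * (d T)\<^sup>2 \<le> ?b n" for n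
      using iter[of "T / real (Suc n)" "Suc n"] T by simp
    then show "\<exists>N. \<forall>n\<ge>N. exp (l * (2 * T)) * (d T)\<^sup>2 \<le> ?b n" by blast
  qed
  moreover have "exp (l * (2 * T)) * (d T)\<^sup>2 = (exp (l * T) * d T)\<^sup>2"
    by (simp add: power_mult_distrib exp_double[symmetric] algebra_simps)
  ultimately have "(exp (l * T) * d T)\<^sup>2 \<le> (d 0)\<^sup>2" by simp
  then have "exp (l * T) * d T \<le> d 0"
    by (rule power2_le_imp_le) (simp add: d_def)
  then show ?thesis by (simp add: d_def)
qed

text \<open>
  At positive times a trajectory lies in the effective domain, so the initial times are approached from
  above.
\<close>

lemma integrated_EVI_contraction:
  assumes \<xi>: "integrated_EVI l f \<xi>" and \<zeta>: "integrated_EVI l f \<zeta>"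
    and sr: "0 \<le> s" "0 \<le> r" and T: "0 \<le> T"
  shows "exp (l * T) * dist (\<xi> (s + T)) (\<zeta> (r + T)) \<le> dist (\<xi> s) (\<zeta> r)"
proof (cases "T = 0")
  case False
  then have T: "0 < T" using T by simp
  define h where "h n = 1 / real (Suc n)" for n
  have h: "h \<longlonglongrightarrow> 0" "\<And>n. 0 < h n"
    unfolding h_def[abs_def] by (intro LIMSEQ_Suc[OF lim_const_over_n]) simp
  have cont: "(\<lambda>n. z (a + h n)) \<longlonglongrightarrow> z a" if "integrated_EVI l f z" "0 \<le> a" for z a
  proof (rule continuous_on_tendsto_compose[OF integrated_EVI_continuous[OF that(1)]])
    show "(\<lambda>n. a + h n) \<longlonglongrightarrow> a" using tendsto_add[OF tendsto_const[of a] h(1)] by simp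
  qed (use that h(2) in \<open>auto intro!: always_eventually add_nonneg_pos less_imp_le\<close>)
  show ?thesis
  proof (rule LIMSEQ_le)
    show "(\<lambda>n. exp (l * T) * dist (\<xi> (s + T + h n)) (\<zeta> (r + T + h n)))
        \<longlonglongrightarrow> exp (l * T) * dist (\<xi> (s + T)) (\<zeta> (r + T))"
      by (intro tendsto_mult tendsto_const tendsto_dist cont \<xi> \<zeta>) (use sr T in auto)
    show "(\<lambda>n. dist (\<xi> (s + h n)) (\<zeta> (r + h n))) \<longlonglongrightarrow> dist (\<xi> s) (\<zeta> r)"
      by (intro tendsto_dist cont \<xi> \<zeta> sr)
    have "exp (l * T) * dist (\<xi> (s + h n + T)) (\<zeta> (r + h n + T)) \<le> dist (\<xi> (s + h n)) (\<zeta> (r + h n))"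
        for n
    proof -
      have "0 < s + h n" "0 < r + h n" using h(2)[of n] sr by simp_all
      then show ?thesis
        by (intro integrated_EVI_contraction_dom[OF \<xi> \<zeta> _ _ integrated_EVI_dom[OF \<xi>]
            integrated_EVI_dom[OF \<zeta>] T]) auto
    qed
    then show "\<exists>N. \<forall>n\<ge>N. exp (l * T) * dist (\<xi> (s + T + h n)) (\<zeta> (r + T + h n))
        \<le> dist (\<xi> (s + h n)) (\<zeta> (r + h n))"
      by (simp add: add.commute add.left_commute)
  qed
qed simp

text \<open>
  The quadratic term disappears in the limit \<open>y \<rightarrow> x\<close>; outside the effective domain the quotient is \<open>0\<close>.
\<close>

lemma descending_slope_scaled_le:
  assumes fm: "\<forall>x. f x \<noteq> - \<infinity>" and x: "x \<in> effective_domain f" and \<epsilon>: "0 < \<epsilon>" and L: "0 \<le> L"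
    and le: "\<And>y. y \<in> effective_domain f \<Longrightarrow>
      real_of_ereal (f x) - real_of_ereal (f y) \<le> L * dist y x + k * (dist y x)\<^sup>2"
    and k: "0 \<le> k"
  shows "descending_slope (\<lambda>x. ereal \<epsilon> * f x) x \<le> ereal (\<epsilon> * L)"
proof -
  obtain c where "f x = ereal c" using effective_domain_real[OF x fm] by blast
  then have dx: "x \<in> effective_domain (\<lambda>x. ereal \<epsilon> * f x)" by (simp add: effective_domain_def)
  show ?thesis
  proof (cases "x isolated_in UNIV")
  case True
  then show ?thesis using dx \<epsilon> L by (simp add: descending_slope_def)
next
  case False
  let ?q = "\<lambda>y. max (- (ereal \<epsilon> * f y - ereal \<epsilon> * f x)) 0 / ereal (dist y x)"
  have q: "?q y \<le> ereal (\<epsilon> * (L + k * dist y x))" if "y \<noteq> x" for y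
  proof -
    have d: "0 < dist y x" using that by simp
    have fx: "f x = ereal (real_of_ereal (f x))" by (rule effective_domain_real[OF x fm])
    have pos: "0 \<le> \<epsilon> * (L + k * dist y x)" using \<epsilon> L k by simp
    show ?thesis
    proof (cases "f y = \<infinity>")
      case True
      then have "- (ereal \<epsilon> * f y - ereal \<epsilon> * f x) = - \<infinity>"
        using \<epsilon> by (subst fx) simp
      then show ?thesis using pos d by simp
    next
      case False
      then have ydom: "y \<in> effective_domain f" by (simp add: effective_domain_def)
      then have fy: "f y = ereal (real_of_ereal (f y))" using fm by (rule effective_domain_real)
      have "?q y = ereal (max (- (\<epsilon> * real_of_ereal (f y) - \<epsilon> * real_of_ereal (f x))) 0 / dist y x)"
        using d by (subst fx, subst fy) (simp add: ereal_max[symmetric] zero_ereal_def del: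
            ereal_max)
      also have "\<dots> \<le> ereal (\<epsilon> * (L + k * dist y x))"
      proof -
        have "\<epsilon> * (real_of_ereal (f x) - real_of_ereal (f y))
            \<le> \<epsilon> * (L * dist y x + k * (dist y x)\<^sup>2)"
          using le[OF ydom] \<epsilon> by (intro mult_left_mono) auto
        moreover have "0 \<le> \<epsilon> * (L + k * dist y x) * dist y x" using pos d by simp
        ultimately have "max (- (\<epsilon> * real_of_ereal (f y) - \<epsilon> * real_of_ereal (f x))) 0
            \<le> \<epsilon> * (L + k * dist y x) * dist y x"
          by (simp add: algebra_simps power2_eq_square)
        then show ?thesis using d by (simp add: divide_le_eq)
      qed
      finally show ?thesis .
    qed
  qed
  have "Limsup (at x) ?q \<le> Limsup (at x) (\<lambda>y. ereal (\<epsilon> * (L + k * dist y x)))"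
    using q by (intro Limsup_mono) (auto simp: eventually_at_filter)
  also have "\<dots> = ereal (\<epsilon> * (L + k * dist x x))"
  proof (rule lim_imp_Limsup)
    show "at x \<noteq> bot"
      using False unfolding isolated_in_def by (metis UNIV_I at_eq_bot_iff Int_UNIV_right)
    have "((\<lambda>y. \<epsilon> * (L + k * dist y x)) \<longlongrightarrow> \<epsilon> * (L + k * dist x x)) (at x)"
      by (intro tendsto_intros)
    then show "((\<lambda>y. ereal (\<epsilon> * (L + k * dist y x))) \<longlongrightarrow> ereal (\<epsilon> * (L + k * dist x x))) (at x)"
      by simp
  qed
  finally show ?thesis using False dx by (simp add: descending_slope_def)
qed
qed

text \<open>
  Compare, for a test point \<open>y\<close>, the squared distances from \<open>y\<close> before and after the step \<open>\<delta> n\<close>: they differ by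
  at most about \<open>2 L (\<delta> n) dist y (\<xi> t)\<close>. Dividing the integrated inequality by \<open>\<delta> n\<close> and using lower
  semicontinuity of \<open>f\<close> at \<open>\<xi> t\<close> bounds \<open>f (\<xi> t) - f y\<close>.
\<close>

lemma integrated_EVI_slope_le_speed:
  assumes \<xi>: "integrated_EVI l f \<xi>" and fm: "\<forall>x. f x \<noteq> - \<infinity>" and lsc: "lower_semicontinuous f"
    and t: "0 < t" and \<epsilon>: "0 < \<epsilon>" and L: "0 \<le> L"
    and \<delta>: "\<And>n. 0 < \<delta> n" "\<delta> \<longlonglongrightarrow> 0" "\<And>n. dist (\<xi> t) (\<xi> (t + \<delta> n)) \<le> L * \<delta> n"
  shows "descending_slope (\<lambda>x. ereal \<epsilon> * f x) (\<xi> t) \<le> ereal (\<epsilon> * L)"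
proof (rule descending_slope_scaled_le[OF fm integrated_EVI_dom[OF \<xi> t] \<epsilon> L, where k="\<bar>l\<bar> / 2"])
  fix y assume y: "y \<in> effective_domain f"
  let ?F = "\<lambda>x. real_of_ereal (f x)"
  define d where "d = dist y (\<xi> t)"
  define c where "c n = ?F y - l * d\<^sup>2 / 2 + L * d * exp (2 * \<bar>l\<bar> * \<delta> n)" for n
  have le: "?F (\<xi> (t + \<delta> n)) \<le> c n" for n
  proof -
    let ?I = "exp_int l (\<delta> n)" and ?e = "exp (l * \<delta> n)" and ?d = "dist (\<xi> (t + \<delta> n)) y"
    have I: "0 < ?I" by (rule exp_int_pos[OF \<delta>(1)])
    have "d \<le> dist (\<xi> t) (\<xi> (t + \<delta> n)) + ?d"
      unfolding d_def by (metis dist_commute dist_triangle)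
    then have "d - L * \<delta> n \<le> ?d" using \<delta>(3)[of n] by simp
    have "d\<^sup>2 - 2 * L * \<delta> n * d \<le> ?d\<^sup>2"
    proof (cases "0 \<le> d - L * \<delta> n")
      case True
      then have "(d - L * \<delta> n)\<^sup>2 \<le> ?d\<^sup>2" using \<open>d - L * \<delta> n \<le> ?d\<close> by (intro power_mono)
      moreover have "(d - L * \<delta> n)\<^sup>2 = d\<^sup>2 - 2 * L * \<delta> n * d + (L * \<delta> n)\<^sup>2"
        by (simp add: power2_diff algebra_simps)
      ultimately show ?thesis using zero_le_power2[of "L * \<delta> n"] by linarith
    next
      case False
      then have "d * d \<le> L * \<delta> n * d" by (intro mult_right_mono) (auto simp: d_def)
      then have "d\<^sup>2 - 2 * L * \<delta> n * d \<le> 0"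
      proof -
        have "0 \<le> L * \<delta> n * d" using L \<delta>(1)[of n] by (simp add: d_def)
        with \<open>d * d \<le> L * \<delta> n * d\<close> show ?thesis by (simp add: power2_eq_square)
      qed
      then show ?thesis using zero_le_power2[of ?d] by linarith
    qed
    then have "?e * (d\<^sup>2 - 2 * L * \<delta> n * d) \<le> ?e * ?d\<^sup>2" by (intro mult_left_mono) auto
    moreover have "?e * ?d\<^sup>2 - d\<^sup>2 \<le> 2 * ?I * (?F y - ?F (\<xi> (t + \<delta> n)))"
      using integrated_EVID[OF \<xi> _ \<delta>(1) y, of t n] t by (simp add: d_def dist_commute)
    ultimately have "2 * ?I * (?F (\<xi> (t + \<delta> n)) - ?F y) \<le> d\<^sup>2 * (1 - ?e) + 2 * (L * d) * (\<delta> n * ?e)"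
      by (simp add: algebra_simps)
    also have "1 - ?e = - l * ?I" by (rule one_minus_exp_eq)
    also have "d\<^sup>2 * (- l * ?I) + 2 * (L * d) * (\<delta> n * ?e)
        \<le> d\<^sup>2 * (- l * ?I) + 2 * (L * d) * (exp (2 * \<bar>l\<bar> * \<delta> n) * ?I)"
    proof -
      have "\<delta> n * ?e \<le> \<delta> n * exp (\<bar>l\<bar> * \<delta> n)"
        using \<delta>(1)[of n] exp_mult_le_exp_abs[of "\<delta> n" "\<delta> n" l] by (intro mult_left_mono) auto
      also have "\<dots> = exp (2 * \<bar>l\<bar> * \<delta> n) * (\<delta> n * exp (- \<bar>l\<bar> * \<delta> n))"
      proof -
        have "exp (\<bar>l\<bar> * \<delta> n) = exp (2 * \<bar>l\<bar> * \<delta> n) * exp (- \<bar>l\<bar> * \<delta> n)"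
          by (simp add: exp_add[symmetric])
        then show ?thesis by simp
      qed
      also have "\<dots> \<le> exp (2 * \<bar>l\<bar> * \<delta> n) * ?I"
        using exp_int_bounds(1)[of "\<delta> n" l] \<delta>(1)[of n] by (intro mult_left_mono) auto
      finally show ?thesis using L by (intro add_left_mono mult_left_mono) (auto simp: d_def)
    qed
    also have "\<dots> = 2 * ?I * (- l * d\<^sup>2 / 2 + L * d * exp (2 * \<bar>l\<bar> * \<delta> n))"
      by (simp add: algebra_simps)
    finally have "?F (\<xi> (t + \<delta> n)) - ?F y \<le> - l * d\<^sup>2 / 2 + L * d * exp (2 * \<bar>l\<bar> * \<delta> n)"
      using I by simp
    then show ?thesis by (simp add: c_def)
  qed
  have "f (\<xi> t) \<le> ereal (?F y - l * d\<^sup>2 / 2 + L * d)"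
  proof (rule lower_semicontinuous_limit_le[OF lsc, of "\<lambda>n. \<xi> (t + \<delta> n)"])
    have "(\<lambda>n. t + \<delta> n) \<longlonglongrightarrow> t" using tendsto_add[OF tendsto_const[of t] \<delta>(2)] by simp
    then show "(\<lambda>n. \<xi> (t + \<delta> n)) \<longlonglongrightarrow> \<xi> t"
      by (rule continuous_on_tendsto_compose[OF integrated_EVI_continuous[OF \<xi>]])
         (use t \<delta>(1) in \<open>auto intro!: always_eventually add_pos_pos less_imp_le\<close>)
    show "f (\<xi> (t + \<delta> n)) \<le> ereal (c n)" for n
      using le[of n] effective_domain_real[OF integrated_EVI_dom[OF \<xi>] fm,
          of "t + \<delta> n"] t \<delta>(1)[of n]
      by (metis add_pos_pos ereal_less_eq(3))
    have "c \<longlonglongrightarrow> ?F y - l * d\<^sup>2 / 2 + L * d * exp (2 * \<bar>l\<bar> * 0)"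
      unfolding c_def[abs_def] by (intro tendsto_intros \<delta>(2)) auto
    then show "c \<longlonglongrightarrow> ?F y - l * d\<^sup>2 / 2 + L * d" by simp
  qed
  then have "?F (\<xi> t) \<le> ?F y - l * d\<^sup>2 / 2 + L * d"
    using effective_domain_real[OF integrated_EVI_dom[OF \<xi> t] fm] by (metis ereal_less_eq(3))
  moreover have "- l * d\<^sup>2 / 2 \<le> \<bar>l\<bar> / 2 * d\<^sup>2"
    using mult_right_mono[of "- l" "\<bar>l\<bar>" "d\<^sup>2"] by simp
  ultimately show "?F (\<xi> t) - ?F y \<le> L * dist y (\<xi> t) + \<bar>l\<bar> / 2 * (dist y (\<xi> t))\<^sup>2"
    unfolding d_def[symmetric] by simp
qed simp

text \<open>
  Divide \<open>{r..r + \<tau>}\<close> into \<open>n + 1\<close> equal steps of length \<open>\<delta>\<close>. In each step \<open>f\<close> drops by about the squared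
  displacement over \<open>2 \<delta>\<close>, and by contraction no displacement is much smaller than the one that follows at
  time \<open>r + \<tau>\<close>. The total drop therefore bounds the speed at \<open>r + \<tau>\<close>, hence the slope. The exponent
  \<open>4 \<bar>l\<bar> \<tau>\<close> collects all distortions.
\<close>

lemma integrated_EVI_slope_le_energy_drop:
  assumes \<xi>: "integrated_EVI l f \<xi>" and fm: "\<forall>x. f x \<noteq> - \<infinity>" and lsc: "lower_semicontinuous f"
    and r: "0 < r" and \<tau>: "0 < \<tau>" and \<epsilon>: "0 < \<epsilon>"
  shows "descending_slope (\<lambda>x. ereal \<epsilon> * f x) (\<xi> (r + \<tau>)) \<le>
    ereal (\<epsilon> * sqrt (2 * exp (4 * \<bar>l\<bar> * \<tau>) * (real_of_ereal (f (\<xi> r)) - real_of_ereal (f (\<xi> (r +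
        \<tau>)))) / \<tau>))"
proof (rule integrated_EVI_slope_le_speed[OF \<xi> fm lsc _ \<epsilon>, where \<delta>="\<lambda>n. \<tau> / real (Suc n)"])
  let ?F = "\<lambda>x. real_of_ereal (f x)"
  let ?Q = "2 * exp (4 * \<bar>l\<bar> * \<tau>) * (?F (\<xi> r) - ?F (\<xi> (r + \<tau>))) / \<tau>"
  have key: "(dist (\<xi> (r + \<tau>)) (\<xi> (r + \<tau> + \<tau> / real (Suc n))))\<^sup>2 \<le> (\<tau> / real (Suc n))\<^sup>2 * ?Q" for n
  proof -
    define N where "N = real (Suc n)"
    define \<delta> where "\<delta> = \<tau> / N"
    have N: "0 < N" "N * \<delta> = \<tau>" by (simp_all add: N_def \<delta>_def)
    have \<delta>: "0 < \<delta>" using \<tau> N by (simp add: \<delta>_def)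
    have \<delta>\<tau>: "\<delta> \<le> \<tau>" using \<tau> by (simp add: \<delta>_def N_def divide_le_eq)
    define D where "D = (dist (\<xi> (r + \<tau>)) (\<xi> (r + \<tau> + \<delta>)))\<^sup>2"
    define B where "B = exp (- 4 * \<bar>l\<bar> * \<tau>) * D / (2 * \<delta>)"
    have B: "B \<le> ?F (\<xi> (r + t)) - ?F (\<xi> (r + t + \<delta>))" if t: "0 \<le> t" "t + \<delta> \<le> \<tau>" for t
    proof -
      let ?T = "\<tau> - t"
      have "exp (l * ?T) * dist (\<xi> (r + t + ?T)) (\<xi> (r + t + \<delta> + ?T))
          \<le> dist (\<xi> (r + t)) (\<xi> (r + t + \<delta>))"
        by (rule integrated_EVI_contraction[OF \<xi> \<xi>]) (use r t \<delta> in auto)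
      then have "(exp (l * ?T) * dist (\<xi> (r + t + ?T)) (\<xi> (r + t + \<delta> + ?T)))\<^sup>2
          \<le> (dist (\<xi> (r + t)) (\<xi> (r + t + \<delta>)))\<^sup>2"
        by (intro power_mono) auto
      then have 1: "exp (l * (2 * ?T)) * D \<le> (dist (\<xi> (r + t)) (\<xi> (r + t + \<delta>)))\<^sup>2"
        by (simp add: power_mult_distrib D_def exp_double[symmetric] algebra_simps)
      have 2: "exp (l * \<delta>) * (dist (\<xi> (r + t)) (\<xi> (r + t + \<delta>)))\<^sup>2
          \<le> 2 * exp_int l \<delta> * (?F (\<xi> (r + t)) - ?F (\<xi> (r + t + \<delta>)))"
        by (rule integrated_EVI_energy_decrease[OF \<xi>]) (use r t \<delta> integrated_EVI_dom[OF \<xi>] in auto)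
      have drop: "0 \<le> ?F (\<xi> (r + t)) - ?F (\<xi> (r + t + \<delta>))"
        using order_trans[OF _ 2, of 0] exp_int_pos[OF \<delta>, of l] by (simp add: zero_le_mult_iff)
      have E: "exp (- 4 * \<bar>l\<bar> * \<tau>) \<le> exp (- \<bar>l\<bar> * \<delta>) * (exp (l * \<delta>) * exp (l * (2 * ?T)))"
      proof -
        have "- l * (\<delta> + 2 * ?T) \<le> \<bar>l\<bar> * (\<delta> + 2 * ?T)" using t \<delta> by (intro mult_right_mono) auto
        moreover have "\<bar>l\<bar> * (2 * \<delta> + 2 * ?T) \<le> \<bar>l\<bar> * (4 * \<tau>)" using t \<delta>\<tau>
            by (intro mult_left_mono) auto
        ultimately have "- 4 * \<bar>l\<bar> * \<tau> \<le> - \<bar>l\<bar> * \<delta> + (l * \<delta> + l * (2 * ?T))"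
            by (simp add: algebra_simps)
        then show ?thesis by (simp only: exp_add[symmetric] exp_le_cancel_iff)
      qed
      have "exp (- 4 * \<bar>l\<bar> * \<tau>) * D \<le> exp (- \<bar>l\<bar> * \<delta>) * (exp (l * \<delta>) * (exp (l * (2 * ?T)) * D))"
        using mult_right_mono[OF E, of D] by (simp add: D_def mult.assoc)
      also have "\<dots> \<le> exp (- \<bar>l\<bar> * \<delta>) * (2 * exp_int l \<delta> * (?F (\<xi> (r + t)) - ?F (\<xi> (r + t + \<delta>))))"
        using 1 2 by (intro mult_left_mono order_trans[OF mult_left_mono[OF 1] 2]) auto
      also have "\<dots> = exp (- \<bar>l\<bar> * \<delta>) * exp_int l \<delta> * (2 * (?F (\<xi> (r + t)) - ?F (\<xi> (r + t + \<delta>))))"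
        by simp
      also have "\<dots> \<le> \<delta> * (2 * (?F (\<xi> (r + t)) - ?F (\<xi> (r + t + \<delta>))))"
      proof (rule mult_right_mono)
        have "exp (- \<bar>l\<bar> * \<delta>) * exp_int l \<delta> \<le> exp (- \<bar>l\<bar> * \<delta>) * (\<delta> * exp (\<bar>l\<bar> * \<delta>))"
          using exp_int_bounds(2)[of \<delta> l] \<delta> by (intro mult_left_mono) auto
        also have "\<dots> = \<delta> * (exp (- (\<bar>l\<bar> * \<delta>)) * exp (\<bar>l\<bar> * \<delta>))" by simp
        also have "\<dots> = \<delta>" by (simp add: exp_minus)
        finally show "exp (- \<bar>l\<bar> * \<delta>) * exp_int l \<delta> \<le> \<delta>" .
      qed (use drop in simp)
      finally have "exp (- 4 * \<bar>l\<bar> * \<tau>) * D \<le> (?F (\<xi> (r + t)) - ?F (\<xi> (r + t + \<delta>))) * (2 * \<delta>)"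
        by (simp only: mult_ac)
      moreover have "0 < 2 * \<delta>" using \<delta> by simp
      ultimately show ?thesis unfolding B_def by (simp only: pos_divide_le_eq)
    qed
    have sum: "real k * B \<le> ?F (\<xi> r) - ?F (\<xi> (r + real k * \<delta>))" if "k \<le> Suc n" for k
      using that
    proof (induction k)
      case (Suc k)
      have "real (Suc k) * \<delta> \<le> N * \<delta>" using Suc.prems \<delta>
          by (intro mult_right_mono) (auto simp: N_def)
      then have "B \<le> ?F (\<xi> (r + real k * \<delta>)) - ?F (\<xi> (r + real k * \<delta> + \<delta>))"
        using \<delta> N by (intro B) (auto simp: algebra_simps)
      moreover have "r + real k * \<delta> + \<delta> = r + real (Suc k) * \<delta>" by (simp add: algebra_simps)
      ultimately show ?case using Suc by (simp add: algebra_simps)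
    qed simp
    have "N * B \<le> ?F (\<xi> r) - ?F (\<xi> (r + \<tau>))"
      using sum[of "Suc n"] N(2) unfolding N_def by simp
    then have "2 * exp (4 * \<bar>l\<bar> * \<tau>) / \<tau> * \<delta>\<^sup>2 * (N * B)
        \<le> 2 * exp (4 * \<bar>l\<bar> * \<tau>) / \<tau> * \<delta>\<^sup>2 * (?F (\<xi> r) - ?F (\<xi> (r + \<tau>)))"
      using \<tau> by (intro mult_left_mono) auto
    moreover have "2 * exp (4 * \<bar>l\<bar> * \<tau>) / \<tau> * \<delta>\<^sup>2 * (N * B) = D"
    proof -
      have "2 * exp (4 * \<bar>l\<bar> * \<tau>) / \<tau> * \<delta>\<^sup>2 * (N * B)
          = (exp (4 * \<bar>l\<bar> * \<tau>) * exp (- 4 * \<bar>l\<bar> * \<tau>)) * D * (N * \<delta>) / \<tau>"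
        unfolding B_def using \<delta> by (simp add: power2_eq_square)
      also have "\<dots> = D" using N(2) \<tau> by (simp add: exp_minus)
      finally show ?thesis .
    qed
    ultimately have "D \<le> \<delta>\<^sup>2 * ?Q" by (simp add: algebra_simps)
    then show ?thesis by (simp add: D_def \<delta>_def N_def)
  qed
  show "0 \<le> sqrt ?Q"
  proof -
    have "0 \<le> (\<tau> / real (Suc 0))\<^sup>2 * ?Q" by (rule order_trans[OF _ key]) simp
    moreover have "0 < (\<tau> / real (Suc 0))\<^sup>2" using \<tau> by simp
    ultimately have "0 \<le> ?Q" using mult_pos_neg not_le by blast
    then show ?thesis by simp
  qed
  show "dist (\<xi> (r + \<tau>)) (\<xi> (r + \<tau> + \<tau> / real (Suc n))) \<le> sqrt ?Q * (\<tau> / real (Suc n))" for n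
  proof -
    have "dist (\<xi> (r + \<tau>)) (\<xi> (r + \<tau> + \<tau> / real (Suc n))) \<le> sqrt ((\<tau> / real (Suc n))\<^sup>2 * ?Q)"
      by (rule real_le_rsqrt[OF key])
    also have "\<dots> = \<tau> / real (Suc n) * sqrt ?Q"
      using \<tau> by (simp only: real_sqrt_mult real_sqrt_abs) simp
    finally show ?thesis by (simp only: mult.commute)
  qed
  show "(\<lambda>n. \<tau> / real (Suc n)) \<longlonglongrightarrow> 0" by (intro LIMSEQ_Suc[OF lim_const_over_n])
qed (use r \<tau> in auto)

text \<open>
  The discrete form, for a time step \<open>\<tau>\<close>, of the estimate on which the recovery sequence rests: \<open>\<zeta>\<close> and \<open>\<xi>\<close>
  are the trajectories of two nearby points of a curve, stopped at the times \<open>\<sigma>\<close> and \<open>\<sigma> + \<delta>\<close>. The flow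
  time grows at speed \<open>2 \<epsilon>\<close> because the argument retains only a quarter of the squared slope.
\<close>

lemma integrated_EVI_joint_energy_estimate:
  fixes \<xi> \<zeta> :: "real \<Rightarrow> 'a::metric_space"
  assumes \<xi>: "integrated_EVI l f \<xi>" and \<zeta>: "integrated_EVI l f \<zeta>"
    and fm: "\<forall>x. f x \<noteq> - \<infinity>" and lsc: "lower_semicontinuous f"
    and \<sigma>: "0 \<le> \<sigma>" and \<tau>: "0 < \<tau>" and \<epsilon>: "0 < \<epsilon>" and \<delta>: "\<delta> = 2 * \<epsilon> * \<tau>"
    and dom: "\<zeta> \<sigma> \<in> effective_domain f"
  defines "P \<equiv> e2ennreal (descending_slope (\<lambda>x. ereal \<epsilon> * f x) (\<xi> (\<sigma> + \<delta>)))"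
  shows "P < \<infinity>"
    and "exp (- 3 * \<bar>l\<bar> * \<delta>) * ((dist (\<zeta> \<sigma>) (\<xi> (\<sigma> + \<delta>)) / \<tau>)\<^sup>2 + (enn2real P)\<^sup>2)
      \<le> exp (\<bar>l\<bar> * (2 * \<sigma> + \<delta>)) * (dist (\<zeta> 0) (\<xi> 0))\<^sup>2 / \<tau>\<^sup>2
        + 4 * \<epsilon> * (real_of_ereal (f (\<zeta> \<sigma>)) - real_of_ereal (f (\<xi> (\<sigma> + \<delta>)))) / \<tau>"
proof -
  let ?F = "\<lambda>x. real_of_ereal (f x)"
  define m where "m = \<xi> (\<sigma> + \<delta> / 2)"
  define u where "u = \<xi> (\<sigma> + \<delta>)"
  define v where "v = \<zeta> \<sigma>"
  have d0: "0 < \<delta>" using \<epsilon> \<tau> by (simp add: \<delta>)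
  have half: "\<xi> (\<sigma> + \<delta> / 2 + \<delta> / 2) = u"
  proof -
    have "\<sigma> + \<delta> / 2 + \<delta> / 2 = \<sigma> + \<delta>" by simp
    then show ?thesis by (simp only: u_def)
  qed
  define E where "E = exp (\<bar>l\<bar> * \<delta>)"
  have E: "0 < E" by (simp add: E_def)
  define Q where "Q = 2 * exp (4 * \<bar>l\<bar> * (\<delta> / 2)) * (?F m - ?F u) / (\<delta> / 2)"
  have "descending_slope (\<lambda>x. ereal \<epsilon> * f x) u \<le> ereal (\<epsilon> * sqrt Q)"
    using integrated_EVI_slope_le_energy_drop[OF \<xi> fm lsc _ _ \<epsilon>, of "\<sigma> + \<delta> / 2" "\<delta> / 2"] \<sigma> d0
    unfolding Q_def m_def half by simp
  then have "P \<le> e2ennreal (ereal (\<epsilon> * sqrt Q))"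
    unfolding P_def u_def[symmetric] by (rule e2ennreal_mono)
  then have P: "P \<le> ennreal (\<epsilon> * sqrt Q)" by (simp add: e2ennreal_ereal)
  then show "P < \<infinity>" by (simp add: order.strict_trans1)
  define I2 e where "I2 = exp_int l (\<delta> / 2)" and "e = exp (l * (\<delta> / 2))"
  have I2: "0 < I2" unfolding I2_def using d0 by (intro exp_int_pos) simp
  have e0: "0 < e" by (simp add: e_def)
  have I: "exp_int l \<delta> = I2 * (1 + e)"
    using exp_int_double[of l "\<delta> / 2"] by (simp add: I2_def e_def)
  have drop: "0 \<le> ?F m - ?F u"
  proof -
    have "0 \<le> 2 * exp_int l (\<delta> / 2) * (?F m - ?F (\<xi> (\<sigma> + \<delta> / 2 + \<delta> / 2)))"
      unfolding m_def
      by (rule order_trans[OF _ integrated_EVI_energy_decrease[OF \<xi>]]) (use \<sigma> d0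
          integrated_EVI_dom[OF \<xi>] in auto)
    then show ?thesis using I2 unfolding half I2_def[symmetric] by (simp add: zero_le_mult_iff)
  qed
  have E2: "exp (4 * \<bar>l\<bar> * (\<delta> / 2)) = E\<^sup>2"
    by (simp add: E_def power2_eq_square exp_add[symmetric])
  have Q: "Q = 4 * E\<^sup>2 * (?F m - ?F u) / \<delta>"
    unfolding Q_def E2 using d0 by simp
  have Q0: "0 \<le> Q" unfolding Q using drop d0 by simp
  have P2: "(enn2real P)\<^sup>2 \<le> \<epsilon>\<^sup>2 * Q"
  proof -
    have "enn2real P \<le> \<epsilon> * sqrt Q"
      using P \<epsilon> Q0 by (intro enn2real_leI) auto
    then have "(enn2real P)\<^sup>2 \<le> (\<epsilon> * sqrt Q)\<^sup>2" by (intro power_mono) auto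
    then show ?thesis using Q0 by (simp add: power_mult_distrib)
  qed
  \<comment> \<open>In one full step only \<open>f u\<close> would appear; the first half step has \<open>f m\<close>, and the surplus \<open>f m
      - f u\<close> bounds the slope.\<close>
  have J1: "e * (dist m v)\<^sup>2 - (dist (\<xi> \<sigma>) v)\<^sup>2 \<le> 2 * I2 * (?F v - ?F m)"
    unfolding m_def v_def e_def I2_def using integrated_EVID[OF \<xi> \<sigma> _ dom, of "\<delta> / 2"] d0 by simp
  have "e * (dist u v)\<^sup>2 - (dist m v)\<^sup>2 \<le> 2 * I2 * (?F v - ?F u)"
    using integrated_EVID[OF \<xi> _ _ dom, of "\<sigma> + \<delta> / 2" "\<delta> / 2"] d0 \<sigma> unfolding half
    by (simp add: m_def v_def e_def I2_def)
  then have "e * (e * (dist u v)\<^sup>2 - (dist m v)\<^sup>2) \<le> e * (2 * I2 * (?F v - ?F u))"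
    using e0 by (intro mult_left_mono) auto
  then have J: "e\<^sup>2 * (dist u v)\<^sup>2 + 2 * I2 * (?F m - ?F u)
      \<le> (dist (\<xi> \<sigma>) v)\<^sup>2 + 2 * exp_int l \<delta> * (?F v - ?F u)"
    using J1 unfolding I by (simp add: algebra_simps power2_eq_square)
  have contr: "(dist (\<xi> \<sigma>) v)\<^sup>2 \<le> exp (\<bar>l\<bar> * (2 * \<sigma>)) * (dist (\<zeta> 0) (\<xi> 0))\<^sup>2"
  proof -
    have "exp (l * \<sigma>) * dist (\<xi> \<sigma>) v \<le> dist (\<xi> 0) (\<zeta> 0)"
      using integrated_EVI_contraction[OF \<xi> \<zeta>, of 0 0 \<sigma>] \<sigma> by (simp add: v_def)
    then have "exp (- l * \<sigma>) * (exp (l * \<sigma>) * dist (\<xi> \<sigma>) v) \<le> exp (- l * \<sigma>) * dist (\<xi> 0) (\<zeta> 0)"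
      by (intro mult_left_mono) auto
    moreover have "exp (- l * \<sigma>) * exp (l * \<sigma>) = 1" by (simp add: exp_minus)
    ultimately have "dist (\<xi> \<sigma>) v \<le> exp (- l * \<sigma>) * dist (\<xi> 0) (\<zeta> 0)"
      by (simp only: mult.assoc[symmetric] mult_1_left)
    also have "\<dots> \<le> exp (\<bar>l\<bar> * \<sigma>) * dist (\<xi> 0) (\<zeta> 0)"
      using exp_mult_le_exp_abs[of \<sigma> \<sigma> "- l"] \<sigma> by (intro mult_right_mono) auto
    finally have "(dist (\<xi> \<sigma>) v)\<^sup>2 \<le> (exp (\<bar>l\<bar> * \<sigma>) * dist (\<xi> 0) (\<zeta> 0))\<^sup>2"
      by (intro power_mono) auto
    then show ?thesis
      by (simp add: power_mult_distrib exp_double[symmetric] dist_commute mult.left_commute)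
  qed
  have bI: "\<delta> \<le> E * exp_int l \<delta>" "exp_int l \<delta> \<le> \<delta> * E"
  proof -
    have "E * (\<delta> * exp (- \<bar>l\<bar> * \<delta>)) \<le> E * exp_int l \<delta>"
      using exp_int_bounds(1)[of \<delta> l] d0 E by (intro mult_left_mono) auto
    moreover have "E * (\<delta> * exp (- \<bar>l\<bar> * \<delta>)) = \<delta>" by (simp add: E_def exp_minus)
    ultimately show "\<delta> \<le> E * exp_int l \<delta>" by (simp only:)
    show "exp_int l \<delta> \<le> \<delta> * E" using exp_int_bounds(2)[of \<delta> l] d0 by (simp add: E_def)
  qed
  have Ipos: "0 < exp_int l \<delta>" using d0 by (rule exp_int_pos)
  have eE: "1 \<le> E * e\<^sup>2" "1 + e \<le> 2 * E"
  proof -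
    have "E * e\<^sup>2 = exp (\<bar>l\<bar> * \<delta> + l * \<delta>)"
      by (simp add: E_def e_def power2_eq_square exp_add[symmetric])
    moreover have "0 \<le> (\<bar>l\<bar> + l) * \<delta>" using d0 by (intro mult_nonneg_nonneg) auto
    ultimately show "1 \<le> E * e\<^sup>2" by (simp add: distrib_right)
    have "e \<le> E" unfolding e_def E_def using d0 by (intro exp_mult_le_exp_abs) auto
    moreover have "1 \<le> E" unfolding E_def using d0 by simp
    ultimately show "1 + e \<le> 2 * E" by simp
  qed
  \<comment> \<open>multiplying by \<open>c\<close>, which is close to \<open>1 / \<tau>\<^sup>2\<close>, turns the term with \<open>f\<close> into a difference
      quotient\<close>
  define c where "c = 2 * \<epsilon> / (exp_int l \<delta> * \<tau>)"
  have c0: "0 < c" using Ipos \<epsilon> \<tau> by (simp add: c_def)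
  have c\<delta>: "c = \<delta> / (exp_int l \<delta> * \<tau>\<^sup>2)"
    using \<tau> Ipos by (simp add: c_def \<delta> power2_eq_square)
  have cE: "1 / (E * \<tau>\<^sup>2) \<le> c" "c \<le> E / \<tau>\<^sup>2"
    unfolding c\<delta> using bI Ipos \<tau> E by (simp_all add: field_simps)
  have t1: "exp (- 3 * \<bar>l\<bar> * \<delta>) * (dist v u / \<tau>)\<^sup>2 \<le> c * (e\<^sup>2 * (dist u v)\<^sup>2)"
  proof -
    have "exp (- 3 * \<bar>l\<bar> * \<delta>) = 1 / E ^ 3"
      by (simp add: E_def exp_of_nat_mult[symmetric] exp_minus[symmetric] divide_inverse mult.assoc)
    also have "1 / E ^ 3 \<le> 1 / E ^ 2"
      unfolding E_def using d0 by (intro divide_left_mono power_increasing) auto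
    also have "\<dots> \<le> \<tau>\<^sup>2 * c * e\<^sup>2"
    proof -
      have "1 / E \<le> \<tau>\<^sup>2 * c" "1 / E \<le> e\<^sup>2" using cE(1) eE(1) E \<tau> by (simp_all add: field_simps)
      then have "1 / E * (1 / E) \<le> \<tau>\<^sup>2 * c * e\<^sup>2" using E c0 by (intro mult_mono) auto
      then show ?thesis by (simp add: power2_eq_square)
    qed
    finally have "exp (- 3 * \<bar>l\<bar> * \<delta>) * (dist v u / \<tau>)\<^sup>2 \<le> (\<tau>\<^sup>2 * c * e\<^sup>2) * (dist v u / \<tau>)\<^sup>2"
      by (intro mult_right_mono) auto
    also have "\<dots> = c * (e\<^sup>2 * (dist u v)\<^sup>2)"
      using \<tau> by (simp add: power_divide dist_commute)
    finally show ?thesis .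
  qed
  have t2: "exp (- 3 * \<bar>l\<bar> * \<delta>) * (enn2real P)\<^sup>2 \<le> c * (2 * I2 * (?F m - ?F u))"
  proof -
    have "exp (- 3 * \<bar>l\<bar> * \<delta>) = 1 / E ^ 3"
      by (simp add: E_def exp_of_nat_mult[symmetric] exp_minus[symmetric] divide_inverse mult.assoc)
    then have "exp (- 3 * \<bar>l\<bar> * \<delta>) * (enn2real P)\<^sup>2 \<le> 1 / E ^ 3 * (\<epsilon>\<^sup>2 * Q)"
      using P2 E by (simp add: divide_right_mono)
    also have "\<dots> = 4 * \<epsilon>\<^sup>2 / (E * \<delta>) * (?F m - ?F u)"
      unfolding Q using E by (simp add: power2_eq_square power3_eq_cube)
    also have "\<dots> \<le> 8 * \<epsilon>\<^sup>2 / ((1 + e) * \<delta>) * (?F m - ?F u)"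
    proof (rule mult_right_mono)
      have "4 * \<epsilon>\<^sup>2 * (1 + e) \<le> 4 * \<epsilon>\<^sup>2 * (2 * E)" using eE(2) by (intro mult_left_mono) auto
      then show "4 * \<epsilon>\<^sup>2 / (E * \<delta>) \<le> 8 * \<epsilon>\<^sup>2 / ((1 + e) * \<delta>)"
        using E e0 d0 by (simp add: divide_le_eq le_divide_eq pos_divide_le_eq mult.commute
            mult.left_commute)
    qed (rule drop)
    also have "8 * \<epsilon>\<^sup>2 / ((1 + e) * \<delta>) = 4 * \<epsilon> / ((1 + e) * \<tau>)"
      unfolding \<delta> using e0 \<epsilon> \<tau> by (simp add: power2_eq_square)
    also have "\<dots> = c * (2 * I2)"
      unfolding c_def I using I2 e0 \<tau> by simp
    finally show ?thesis by simp
  qed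
  have "exp (- 3 * \<bar>l\<bar> * \<delta>) * ((dist v u / \<tau>)\<^sup>2 + (enn2real P)\<^sup>2)
      \<le> c * (e\<^sup>2 * (dist u v)\<^sup>2 + 2 * I2 * (?F m - ?F u))"
    using t1 t2 by (simp add: distrib_left)
  also have "\<dots> \<le> c * ((dist (\<xi> \<sigma>) v)\<^sup>2 + 2 * exp_int l \<delta> * (?F v - ?F u))"
    using J c0 by (intro mult_left_mono) auto
  also have "\<dots> = c * (dist (\<xi> \<sigma>) v)\<^sup>2 + 4 * \<epsilon> * (?F v - ?F u) / \<tau>"
    using Ipos \<tau> by (simp add: c_def distrib_left)
  also have "c * (dist (\<xi> \<sigma>) v)\<^sup>2 \<le> E / \<tau>\<^sup>2 * (exp (\<bar>l\<bar> * (2 * \<sigma>)) * (dist (\<zeta> 0) (\<xi> 0))\<^sup>2)"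
    using cE(2) contr E by (intro mult_mono) auto
  also have "\<dots> = exp (\<bar>l\<bar> * (2 * \<sigma> + \<delta>)) * (dist (\<zeta> 0) (\<xi> 0))\<^sup>2 / \<tau>\<^sup>2"
    by (simp add: E_def distrib_left exp_add)
  finally show "exp (- 3 * \<bar>l\<bar> * \<delta>) * ((dist (\<zeta> \<sigma>) (\<xi> (\<sigma> + \<delta>)) / \<tau>)\<^sup>2 + (enn2real P)\<^sup>2)
      \<le> exp (\<bar>l\<bar> * (2 * \<sigma> + \<delta>)) * (dist (\<zeta> 0) (\<xi> 0))\<^sup>2 / \<tau>\<^sup>2
        + 4 * \<epsilon> * (?F (\<zeta> \<sigma>) - ?F (\<xi> (\<sigma> + \<delta>))) / \<tau>"
    by (simp add: u_def v_def)
qed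

section \<open>Regularising a curve by the flow\<close>

text \<open>
  This is \<open>sqrt (p P) + sqrt (q Q) \<le> sqrt ((p + q) (P + Q))\<close>, applied to the two parts of \<open>{s..t}\<close> on either
  side of \<open>b\<close>.
\<close>

lemma energy_bound_combine:
  assumes 1: "energy_bound a b R \<gamma>" and 2: "energy_bound b c R \<gamma>"
  shows "energy_bound a c R \<gamma>"
  unfolding energy_bound_def
proof (intro allI impI)
  fix s t assume st: "a \<le> s \<and> s \<le> t \<and> t \<le> c"
  consider "t \<le> b" | "b \<le> s" | "s < b" "b < t" by linarith
  then show "(dist (\<gamma> s) (\<gamma> t))\<^sup>2 \<le> (t - s) * (R t - R s)"
  proof cases
    case 3
    define p q where "p = dist (\<gamma> s) (\<gamma> b)" and "q = dist (\<gamma> b) (\<gamma> t)"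
    define P Q where "P = R b - R s" and "Q = R t - R b"
    have p: "p\<^sup>2 \<le> (b - s) * P" and q: "q\<^sup>2 \<le> (t - b) * Q"
      using energy_boundD[OF 1, of s b] energy_boundD[OF 2, of b t] 3 st
          by (auto simp: p_def q_def P_def Q_def)
    have "0 \<le> (b - s) * P" "0 \<le> (t - b) * Q" using p q by (meson order_trans zero_le_power2)+
    then have PQ: "0 \<le> P" "0 \<le> Q" using 3 by (simp_all add: zero_le_mult_iff)
    have "(p * q)\<^sup>2 \<le> ((b - s) * P) * ((t - b) * Q)"
      unfolding power_mult_distrib using p q by (intro mult_mono) (auto intro: order_trans[OF
          zero_le_power2])
    also have "4 * \<dots> \<le> ((b - s) * Q + (t - b) * P)\<^sup>2"
    proof -
      have "0 \<le> ((b - s) * Q - (t - b) * P)\<^sup>2" by simp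
      then show ?thesis by (simp add: power2_eq_square algebra_simps)
    qed
    finally have "(2 * (p * q))\<^sup>2 \<le> ((b - s) * Q + (t - b) * P)\<^sup>2" by (simp add: power_mult_distrib)
    then have pq: "2 * (p * q) \<le> (b - s) * Q + (t - b) * P"
      by (rule power2_le_imp_le) (use PQ 3 in auto)
    have "dist (\<gamma> s) (\<gamma> t) \<le> p + q" unfolding p_def q_def by (rule dist_triangle)
    then have "(dist (\<gamma> s) (\<gamma> t))\<^sup>2 \<le> (p + q)\<^sup>2" by (intro power_mono) auto
    also have "\<dots> = p\<^sup>2 + q\<^sup>2 + 2 * (p * q)" by (simp add: power2_sum)
    also have "\<dots> \<le> (b - s) * P + (t - b) * Q + ((b - s) * Q + (t - b) * P)" using p q pq by linarith
    also have "\<dots> = (t - s) * (R t - R s)" by (simp add: P_def Q_def algebra_simps)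
    finally show ?thesis .
  qed (use energy_boundD[OF 1, of s t] energy_boundD[OF 2, of s t] st in auto)
qed

text \<open>
  The flow time is largest in the middle and vanishes at the end points, which are therefore kept. Its
  derivative is \<open>2 \<epsilon>\<close> in absolute value throughout, and this is what yields control of the slope
  everywhere along the curve.
\<close>

definition regularised_curve :: "('a::metric_space \<Rightarrow> real \<Rightarrow> 'a) \<Rightarrow> real \<Rightarrow> (real \<Rightarrow> 'a) \<Rightarrow> real \<Rightarrow> 'a"
    where
  "regularised_curve S \<epsilon> \<gamma> = (\<lambda>t\<in>{0..1}. S (\<gamma> t) (2 * \<epsilon> * min t (1 - t)))"

locale EVI_flow =
  fixes l :: real and f :: "'a::metric_space \<Rightarrow> ereal" and S :: "'a \<Rightarrow> real \<Rightarrow> 'a"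
  assumes flow: "integrated_EVI l f (S x)" and start: "S x 0 = x"
    and fm: "\<forall>x. f x \<noteq> - \<infinity>" and lsc: "lower_semicontinuous f"
begin

abbreviation F where "F x \<equiv> real_of_ereal (f x)"

lemma regularised_curve_dom:
  assumes "\<gamma> 0 \<in> effective_domain f" "\<gamma> 1 \<in> effective_domain f" "0 < \<epsilon>" "t \<in> {0..1}"
  shows "regularised_curve S \<epsilon> \<gamma> t \<in> effective_domain f"
proof -
  consider "t = 0" | "t = 1" | "0 < t" "t < 1" using assms(4) by fastforce
  then show ?thesis
  proof cases
    case 3
    then show ?thesis using assms(3) by (auto simp: regularised_curve_def intro!:
        integrated_EVI_dom[OF flow])
  qed (use assms in \<open>auto simp: regularised_curve_def start\<close>)
qed

text \<open>
  The point with the longer flow time is \<open>t\<close>; it lies on the same side of \<open>1/2\<close> as \<open>s\<close>. Both halves of the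
  unit interval are treated by this one estimate.
\<close>

lemma regularised_curve_estimate:
  assumes dom: "\<gamma> 0 \<in> effective_domain f" "\<gamma> 1 \<in> effective_domain f" and \<epsilon>: "0 < \<epsilon>"
    and M: "energy_bound 0 1 M \<gamma>"
    and s: "s \<in> {0..1}" and t: "t \<in> {0..1}" and st: "s \<noteq> t"
    and closer: "min t (1 - t) = min s (1 - s) + \<bar>t - s\<bar>"
  defines "u \<equiv> regularised_curve S \<epsilon> \<gamma>" and "\<tau> \<equiv> \<bar>t - s\<bar>"
  shows "e2ennreal (descending_slope (\<lambda>x. ereal \<epsilon> * f x) (u t)) < \<infinity>"
    and "exp (- 6 * \<bar>l\<bar> * \<epsilon> * \<tau>) * ((dist (u s) (u t) / \<tau>)\<^sup>2 + (enn2real (e2ennreal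
        (descending_slope (\<lambda>x. ereal \<epsilon> * f x) (u t))))\<^sup>2)
      \<le> (exp (3 * \<bar>l\<bar> * \<epsilon>) * \<bar>M t - M s\<bar> + 4 * \<epsilon> * (F (u s) - F (u t))) / \<tau>"
proof -
  let ?\<sigma> = "2 * \<epsilon> * min s (1 - s)" and ?\<delta> = "2 * \<epsilon> * \<tau>"
  have \<tau>: "0 < \<tau>" using st by (simp add: \<tau>_def)
  have us: "u s = S (\<gamma> s) ?\<sigma>" using s by (simp add: u_def regularised_curve_def)
  have "2 * \<epsilon> * min t (1 - t) = ?\<sigma> + ?\<delta>" unfolding closer \<tau>_def by (simp add: algebra_simps)
  then have ut: "u t = S (\<gamma> t) (?\<sigma> + ?\<delta>)" using t by (simp add: u_def regularised_curve_def)
  have \<sigma>: "0 \<le> ?\<sigma>" using s \<epsilon> by simp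
  have ds: "S (\<gamma> s) ?\<sigma> \<in> effective_domain f"
    using regularised_curve_dom[OF dom \<epsilon> s] unfolding u_def[symmetric] us .
  note est = integrated_EVI_joint_energy_estimate[OF flow[of "\<gamma> t"] flow[of "\<gamma> s"] fm lsc \<sigma> \<tau> \<epsilon> refl
      ds,
      folded us ut, unfolded start]
  show "e2ennreal (descending_slope (\<lambda>x. ereal \<epsilon> * f x) (u t)) < \<infinity>" by (rule est(1))
  have "(dist (\<gamma> s) (\<gamma> t))\<^sup>2 \<le> \<tau> * \<bar>M t - M s\<bar>"
  proof (cases "s \<le> t")
    case True
    have "(dist (\<gamma> s) (\<gamma> t))\<^sup>2 \<le> (t - s) * (M t - M s)" using True s t
        by (intro energy_boundD[OF M]) auto
    also have "\<dots> \<le> (t - s) * \<bar>M t - M s\<bar>" using True by (intro mult_left_mono) auto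
    finally show ?thesis using True by (simp add: \<tau>_def)
  next
    case False
    then have "(dist (\<gamma> t) (\<gamma> s))\<^sup>2 \<le> (s - t) * (M s - M t)" using s t
        by (intro energy_boundD[OF M]) auto
    also have "\<dots> \<le> (s - t) * \<bar>M t - M s\<bar>" using False by (intro mult_left_mono) auto
    finally show ?thesis using False by (simp add: \<tau>_def dist_commute)
  qed
  then have "exp (\<bar>l\<bar> * (2 * ?\<sigma> + ?\<delta>)) * (dist (\<gamma> s) (\<gamma> t))\<^sup>2
      \<le> exp (3 * \<bar>l\<bar> * \<epsilon>) * (\<tau> * \<bar>M t - M s\<bar>)"
  proof (intro mult_mono)
    have "2 * min s (1 - s) + \<tau> \<le> 3 / 2" using closer \<tau> s t unfolding \<tau>_def
        by (auto simp: min_def split: if_splits)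
    then have "\<epsilon> * (2 * (2 * min s (1 - s) + \<tau>)) \<le> \<epsilon> * 3" using \<epsilon> by (intro mult_left_mono) auto
    then have "\<bar>l\<bar> * (2 * ?\<sigma> + ?\<delta>) \<le> \<bar>l\<bar> * (\<epsilon> * 3)"
        by (intro mult_left_mono) (auto simp: algebra_simps)
    then show "exp (\<bar>l\<bar> * (2 * ?\<sigma> + ?\<delta>)) \<le> exp (3 * \<bar>l\<bar> * \<epsilon>)" by (simp add: algebra_simps)
  qed auto
  then have "exp (\<bar>l\<bar> * (2 * ?\<sigma> + ?\<delta>)) * (dist (\<gamma> s) (\<gamma> t))\<^sup>2 / \<tau>\<^sup>2
      \<le> exp (3 * \<bar>l\<bar> * \<epsilon>) * (\<tau> * \<bar>M t - M s\<bar>) / \<tau>\<^sup>2"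
    by (rule divide_right_mono) simp
  also have "\<dots> = exp (3 * \<bar>l\<bar> * \<epsilon>) * \<bar>M t - M s\<bar> / \<tau>" using \<tau> by (simp add: power2_eq_square)
  finally have "exp (\<bar>l\<bar> * (2 * ?\<sigma> + ?\<delta>)) * (dist (\<gamma> s) (\<gamma> t))\<^sup>2 / \<tau>\<^sup>2
      \<le> exp (3 * \<bar>l\<bar> * \<epsilon>) * \<bar>M t - M s\<bar> / \<tau>" .
  moreover have "- 3 * \<bar>l\<bar> * ?\<delta> = - 6 * \<bar>l\<bar> * \<epsilon> * \<tau>" by simp
  ultimately show "exp (- 6 * \<bar>l\<bar> * \<epsilon> * \<tau>) * ((dist (u s) (u t) / \<tau>)\<^sup>2 + (enn2real (e2ennreal
      (descending_slope (\<lambda>x. ereal \<epsilon> * f x) (u t))))\<^sup>2)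
      \<le> (exp (3 * \<bar>l\<bar> * \<epsilon>) * \<bar>M t - M s\<bar> + 4 * \<epsilon> * (F (u s) - F (u t))) / \<tau>"
    using est(2) unfolding add_divide_distrib by argo
qed

text \<open>
  The function \<open>R\<close> collects the right-hand side of the estimate on both halves, with the constant chosen so
  that the two expressions agree at \<open>1/2\<close>. A multiple of it bounds the energy of \<open>u\<close>, which makes \<open>u\<close>
  absolutely continuous; its left quotients before \<open>1/2\<close> and right quotients after \<open>1/2\<close> dominate the
  integrand.
\<close>

lemma Theta_regularised_curve_le:
  assumes dom: "\<gamma> 0 \<in> effective_domain f" "\<gamma> 1 \<in> effective_domain f" and \<epsilon>: "0 < \<epsilon>"
    and M: "energy_bound 0 1 M \<gamma>"
  defines "u \<equiv> regularised_curve S \<epsilon> \<gamma>"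
  shows "Theta (\<lambda>x. ereal \<epsilon> * f x) (\<gamma> 0) (\<gamma> 1) u
      \<le> ennreal (exp (3 * \<bar>l\<bar> * \<epsilon>) * (M 1 - M 0) + 4 * \<epsilon> * (F (\<gamma> 0) + F (\<gamma> 1) - 2 * F (u (1/2))))"
    and "ac_curve_on 0 1 u"
proof -
  define A where "A = exp (3 * \<bar>l\<bar> * \<epsilon>)"
  define R where "R t = (if t \<le> 1/2 then A * M t - 4 * \<epsilon> * F (u t)
      else A * M t + 4 * \<epsilon> * F (u t) - 8 * \<epsilon> * F (u (1/2)))" for t
  define P where "P t = e2ennreal (descending_slope (\<lambda>x. ereal \<epsilon> * f x) (u t))" for t
  have M_mono: "M s \<le> M t" if "0 \<le> s" "s \<le> t" "t \<le> 1" for s t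
    using mono_onD[OF energy_bound_mono_on[OF M], of s t] that by simp
  have left: "exp (- 6 * \<bar>l\<bar> * \<epsilon> * (t - s)) * ((dist (u s) (u t) / (t - s))\<^sup>2 + (enn2real (P t))\<^sup>2)
      \<le> (R t - R s) / (t - s)"
      "P t < \<infinity>"
    if st: "0 \<le> s" "s < t" "t \<le> 1/2" for s t
    using regularised_curve_estimate[OF dom \<epsilon> M, of s t] st M_mono[of s t]
    unfolding u_def[symmetric] P_def[symmetric] A_def[symmetric]
    by (auto simp: R_def algebra_simps)
  have right: "exp (- 6 * \<bar>l\<bar> * \<epsilon> * (t - s)) * ((dist (u t) (u s) / (t - s))\<^sup>2 + (enn2real (P s))\<^sup>2)
      \<le> (R t - R s) / (t - s)"
      "P s < \<infinity>"
    if st: "1/2 \<le> s" "s < t" "t \<le> 1" for s t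
  proof -
    have "R t - R s = A * (M t - M s) + 4 * \<epsilon> * (F (u t) - F (u s))"
    proof (cases "s = 1/2")
      case True
      have "\<not> t \<le> 1/2" using st True by simp
      then show ?thesis unfolding True by (simp add: R_def algebra_simps)
    next
      case False
      then have "\<not> s \<le> 1/2" "\<not> t \<le> 1/2" using st by simp_all
      then show ?thesis by (simp add: R_def algebra_simps)
    qed
    moreover have "\<bar>s - t\<bar> = t - s" "\<bar>M s - M t\<bar> = M t - M s"
      using st M_mono[of s t] by auto
    moreover have "s \<in> {0..1}" "t \<in> {0..1}" "t \<noteq> s" "min s (1 - s) = min t (1 - t) + \<bar>s - t\<bar>"
      using st by auto
    note regularised_curve_estimate[OF dom \<epsilon> M this(2,1,3,4), folded u_def A_def]
    ultimately show "exp (- 6 * \<bar>l\<bar> * \<epsilon> * (t - s)) * ((dist (u t) (u s) / (t - s))\<^sup>2 + (enn2real (P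
        s))\<^sup>2) \<le> (R t - R s) / (t - s)" "P s < \<infinity>"
      by (simp_all add: P_def)
  qed
  \<comment> \<open>removes the exponential factor of the estimate, as time steps are at most \<open>1\<close>\<close>
  define B where "B = exp (6 * \<bar>l\<bar> * \<epsilon>)"
  have half: "(dist (u s) (u t))\<^sup>2 \<le> (t - s) * (B * R t - B * R s)"
    if st: "0 \<le> s" "s < t" "t \<le> 1" and est: "exp (- 6 * \<bar>l\<bar> * \<epsilon> * (t - s)) * ((dist (u s) (u t) / (t
        - s))\<^sup>2 + Q\<^sup>2) \<le> (R t - R s) / (t - s)"
    for s t Q
  proof -
    have "\<bar>l\<bar> * \<epsilon> * (t - s) \<le> \<bar>l\<bar> * \<epsilon> * 1" using st \<epsilon> by (intro mult_left_mono) auto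
    then have "exp (- 6 * \<bar>l\<bar> * \<epsilon>) * (dist (u s) (u t) / (t - s))\<^sup>2
        \<le> exp (- 6 * \<bar>l\<bar> * \<epsilon> * (t - s)) * ((dist (u s) (u t) / (t - s))\<^sup>2 + Q\<^sup>2)"
      by (intro mult_mono) auto
    also note est
    finally have "B * (t - s)\<^sup>2 * (exp (- 6 * \<bar>l\<bar> * \<epsilon>) * (dist (u s) (u t) / (t - s))\<^sup>2)
        \<le> B * (t - s)\<^sup>2 * ((R t - R s) / (t - s))"
      by (intro mult_left_mono) (auto simp: B_def)
    moreover have "B * exp (- 6 * \<bar>l\<bar> * \<epsilon>) = 1" by (simp add: B_def exp_minus)
    then have "B * (t - s)\<^sup>2 * (exp (- 6 * \<bar>l\<bar> * \<epsilon>) * (dist (u s) (u t) / (t - s))\<^sup>2)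
        = (dist (u s) (u t))\<^sup>2"
      using st by (simp add: power_divide)
    moreover have "B * (t - s)\<^sup>2 * ((R t - R s) / (t - s)) = (t - s) * (B * R t - B * R s)"
    proof -
      have "B * (t - s)\<^sup>2 * ((R t - R s) / (t - s)) = B * (t - s) * (R t - R s)"
        using st by (simp add: power2_eq_square)
      also have "\<dots> = (t - s) * (B * R t - B * R s)"
        by (simp only: right_diff_distrib mult_ac)
      finally show ?thesis .
    qed
    ultimately show ?thesis by simp
  qed
  have "energy_bound 0 (1/2) (\<lambda>t. B * R t) u"
    unfolding energy_bound_def
  proof (intro allI impI)
    fix s t :: real assume "0 \<le> s \<and> s \<le> t \<and> t \<le> 1/2"
    then show "(dist (u s) (u t))\<^sup>2 \<le> (t - s) * (B * R t - B * R s)"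
      using half[OF _ _ _ left(1), of s t] by (cases "s = t") auto
  qed
  moreover have "energy_bound (1/2) 1 (\<lambda>t. B * R t) u"
    unfolding energy_bound_def
  proof (intro allI impI)
    fix s t :: real assume "1/2 \<le> s \<and> s \<le> t \<and> t \<le> 1"
    then show "(dist (u s) (u t))\<^sup>2 \<le> (t - s) * (B * R t - B * R s)"
      using half[of s t "enn2real (P s)"] right(1)[of s t] by (cases "s
          = t") (auto simp: dist_commute)
  qed
  ultimately have RB: "energy_bound 0 1 (\<lambda>t. B * R t) u" by (rule energy_bound_combine)
  have "0 < B" by (simp add: B_def)
  then have R_mono: "mono_on {0..1} R"
    using energy_bound_mono_on[OF RB] by (auto simp: monotone_on_def)
  show ac: "ac_curve_on 0 1 u"
  proof -
    have "\<exists>z R'. energy_bound 0 1 R' z \<and> R' 1 - R' 0 \<le> B * R 1 - B * R 0 \<and>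
        (\<forall>t\<in>{0..1}. dist (z t) (u t) \<le> e)" if "0 < e" for e
      using RB that by (intro exI[of _ u] exI[of _ "\<lambda>t. B * R t"]) auto
    from energy_bound_closure[OF this] show ?thesis by blast
  qed
  obtain m where m: "integrable lborel m" "\<And>x. 0 \<le> m x"
    "\<And>s t. 0 \<le> s \<Longrightarrow> s \<le> t \<Longrightarrow> t \<le> 1 \<Longrightarrow> dist (u s) (u t) \<le> (LINT r:{s..t}|lborel. m r)"
    "AE t in lborel. 0 < t \<and> t < 1 \<longrightarrow>
       ((\<lambda>s. dist (u s) (u t) / \<bar>s - t\<bar>) \<longlongrightarrow> m t) (at t within {0..1})"
    by (rule ac_curve_speed[OF ac]) (rule that; assumption)
  have R_mono1: "mono_on {0..1/2} R" and R_mono2: "mono_on {1/2..1} R"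
    by (rule monotone_on_subset[OF R_mono]; auto)+
  have h12: "(0::real) \<le> 1/2" "(1/2::real) \<le> 1" by simp_all
  obtain Q1 where Q1: "Q1 \<in> borel_measurable borel"
    "\<And>t. 0 < t \<Longrightarrow> t < 1/2 \<Longrightarrow> Q1 t = liminf (\<lambda>n. ennreal (real (Suc n) * (R (t + 0 / real (Suc n)) - R
        (t - (1 - 0) / real (Suc n)))))"
    "(\<integral>\<^sup>+t\<in>{0..1/2}. Q1 t \<partial>lborel) \<le> ennreal (R (1/2) - R 0)"
    by (rule nn_integral_lower_Dini_derivative[OF R_mono1 h12(1) order_refl zero_le_one])
       (rule that; assumption)
  obtain Q2 where Q2: "Q2 \<in> borel_measurable borel"
    "\<And>t. 1/2 < t \<Longrightarrow> t < 1 \<Longrightarrow> Q2 t = liminf (\<lambda>n. ennreal (real (Suc n) * (R (t + 1 / real (Suc n)) - R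
        (t - (1 - 1) / real (Suc n)))))"
    "(\<integral>\<^sup>+t\<in>{1/2..1}. Q2 t \<partial>lborel) \<le> ennreal (R 1 - R (1/2))"
    by (rule nn_integral_lower_Dini_derivative[OF R_mono2 h12(2) zero_le_one order_refl])
       (rule that; assumption)
  have "AE t in lborel. ((ennreal (metric_derivative u t))\<^sup>2 + (P t)\<^sup>2) * indicator {0..1} t
      \<le> Q1 t * indicator {0..1/2} t + Q2 t * indicator {1/2..1} t"
    using m(4) AE_lborel_singleton[of 0] AE_lborel_singleton[of 1] AE_lborel_singleton[of "1/2"]
  proof eventually_elim
    case (elim t)
    have sum: "(ennreal (metric_derivative u t))\<^sup>2 + (P t)\<^sup>2
        = ennreal ((m t)\<^sup>2 + (enn2real (P t))\<^sup>2)"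
      if "0 < t" "t < 1" "P t < \<infinity>"
    proof -
      have "metric_derivative u t = m t"
        using elim that by (intro metric_derivative_eqI) auto
      moreover have "P t = ennreal (enn2real (P t))"
        using that(3) by simp
      ultimately show ?thesis
        using m(2)[of t] by (metis ennreal_plus ennreal_power enn2real_nonneg zero_le_power2)
    qed
    consider "t < 0 \<or> 1 < t" | "0 < t" "t < 1/2" | "1/2 < t" "t < 1"
      using elim by fastforce
    then show ?case
    proof cases
      case 1
      then show ?thesis by (auto split: split_indicator)
    next
      case 2
      have "ennreal ((m t)\<^sup>2 + (enn2real (P t))\<^sup>2) \<le>
          liminf (\<lambda>n. ennreal (real (Suc n) * (R t - R (t + (- 1) / real (Suc n)))))"
      proof (rule square_speed_le_lower_Dini_derivative[where K="6 * \<bar>l\<bar> * \<epsilon>"])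
        fix \<tau> :: real assume \<tau>: "0 < \<tau>" "t + - 1 * \<tau> \<in> {0<..<1}"
        show "exp (- (6 * \<bar>l\<bar> * \<epsilon>) * \<tau>) * ((dist (u (t + - 1 * \<tau>)) (u t) / \<tau>)\<^sup>2 + (enn2real (P
            t))\<^sup>2)
            \<le> (R t - R (t + - 1 * \<tau>)) / \<tau>"
          using left(1)[of "t - \<tau>" t] \<tau> 2 by simp
      qed (use elim 2 in auto)
      moreover have "P t < \<infinity>" using left(2)[of 0 t] 2 by auto
      ultimately show ?thesis using 2 sum by (auto simp: Q1(2))
    next
      case 3
      have "ennreal ((m t)\<^sup>2 + (enn2real (P t))\<^sup>2) \<le>
          liminf (\<lambda>n. ennreal (real (Suc n) * (R (t + 1 / real (Suc n)) - R t)))"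
      proof (rule square_speed_le_lower_Dini_derivative[where K="6 * \<bar>l\<bar> * \<epsilon>"
          and q="\<lambda>s. R s - R t"])
        fix \<tau> :: real assume \<tau>: "0 < \<tau>" "t + 1 * \<tau> \<in> {0<..<1}"
        show "exp (- (6 * \<bar>l\<bar> * \<epsilon>) * \<tau>) * ((dist (u (t + 1 * \<tau>)) (u t) / \<tau>)\<^sup>2 + (enn2real (P t))\<^sup>2)
            \<le> (R (t + 1 * \<tau>) - R t) / \<tau>"
          using right(1)[of t "t + \<tau>"] \<tau> 3 by simp
      qed (use elim 3 in auto)
      moreover have "P t < \<infinity>" using right(2)[of t 1] 3 by auto
      ultimately show ?thesis using 3 sum by (auto simp: Q2(2))
    qed
  qed
  then have "(\<integral>\<^sup>+t\<in>{0..1}. ((ennreal (metric_derivative u t))\<^sup>2 + (P t)\<^sup>2) \<partial>lborel)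
      \<le> (\<integral>\<^sup>+t. Q1 t * indicator {0..1/2} t + Q2 t * indicator {1/2..1} t \<partial>lborel)"
    by (rule nn_integral_mono_AE)
  also have "\<dots> = (\<integral>\<^sup>+t\<in>{0..1/2}. Q1 t \<partial>lborel) + (\<integral>\<^sup>+t\<in>{1/2..1}. Q2 t \<partial>lborel)"
    using Q1(1) Q2(1) by (intro nn_integral_add) auto
  also have "\<dots> \<le> ennreal (R (1/2) - R 0) + ennreal (R 1 - R (1/2))"
    by (intro add_mono Q1(3) Q2(3))
  also have "\<dots> = ennreal (R 1 - R 0)"
    using mono_onD[OF R_mono, of 0 "1/2"] mono_onD[OF R_mono, of "1/2" 1]
    by (subst ennreal_plus[symmetric]) auto
  also have "R 1 - R 0 = A * (M 1 - M 0) + 4 * \<epsilon> * (F (\<gamma> 0) + F (\<gamma> 1) - 2 * F (u (1/2)))"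
    by (simp add: R_def u_def regularised_curve_def start algebra_simps)
  finally have fin: "(\<integral>\<^sup>+t\<in>{0..1}. ((ennreal (metric_derivative u t))\<^sup>2 + (P t)\<^sup>2) \<partial>lborel)
      \<le> ennreal (A * (M 1 - M 0) + 4 * \<epsilon> * (F (\<gamma> 0) + F (\<gamma> 1) - 2 * F (u (1/2))))" .
  have "u 0 = \<gamma> 0" "u 1 = \<gamma> 1" by (simp_all add: u_def regularised_curve_def start)
  then show "Theta (\<lambda>x. ereal \<epsilon> * f x) (\<gamma> 0) (\<gamma> 1) u
      \<le> ennreal (exp (3 * \<bar>l\<bar> * \<epsilon>) * (M 1 - M 0) + 4 * \<epsilon> * (F (\<gamma> 0) + F (\<gamma> 1) - 2 * F (u (1/2))))"
    using fin ac by (simp add: Theta_def P_def A_def)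
qed

text \<open>
  Continuity at time \<open>0\<close> of finitely many trajectories suffices, since the contraction carries it over to
  nearby initial points.
\<close>

lemma flow_uniformly_near_start:
  assumes K: "compact K" and e: "0 < e"
  obtains \<eta> where "0 < \<eta>" "\<And>x r. x \<in> K \<Longrightarrow> 0 \<le> r \<Longrightarrow> r \<le> \<eta> \<Longrightarrow> dist (S x r) x \<le> e"
proof -
  \<comment> \<open>points at distance \<open>\<rho>\<close> stay within \<open>e / 3\<close> of each other up to time \<open>1\<close>\<close>
  define \<rho> where "\<rho> = e / (3 * exp \<bar>l\<bar>)"
  have \<rho>: "0 < \<rho>" using e by (simp add: \<rho>_def)
  have \<rho>e: "exp \<bar>l\<bar> * \<rho> = e / 3" "\<rho> \<le> e / 3"
  proof -
    show "exp \<bar>l\<bar> * \<rho> = e / 3" by (simp add: \<rho>_def)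
    have "1 * \<rho> \<le> exp \<bar>l\<bar> * \<rho>" using \<rho> by (intro mult_right_mono) auto
    then show "\<rho> \<le> e / 3" by (simp add: \<open>exp \<bar>l\<bar> * \<rho> = e / 3\<close>)
  qed
  have "\<exists>d>0. \<forall>r. 0 \<le> r \<and> r < d \<longrightarrow> dist (S x r) x < e / 3" for x
  proof -
    obtain d where "0 < d" "\<forall>r\<in>{0..}. dist r 0 < d \<longrightarrow> dist (S x r) (S x 0) < e / 3"
      using integrated_EVI_continuous[OF flow[of x]] e unfolding continuous_on_iff
      by (metis atLeast_iff divide_pos_pos order_refl zero_less_numeral)
    then show ?thesis by (intro exI[of _ d]) (auto simp: start)
  qed
  then obtain d where d: "\<And>x. 0 < d x" "\<And>x r. 0 \<le> r \<Longrightarrow> r < d x \<Longrightarrow> dist (S x r) x < e / 3"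
    by metis
  have "K \<subseteq> (\<Union>x\<in>K. ball x \<rho>)" using \<rho> by auto
  then obtain X where X: "X \<subseteq> K" "finite X" "K \<subseteq> (\<Union>x\<in>X. ball x \<rho>)"
    using compactE_image[OF K, of K "\<lambda>x. ball x \<rho>"] by auto
  define \<eta> where "\<eta> = Min (insert 1 (d ` X)) / 2"
  have \<eta>: "0 < \<eta>" using X(2) d(1) by (auto simp: \<eta>_def)
  have \<eta>_less: "\<eta> < c" if "c \<in> insert 1 (d ` X)" for c
  proof -
    have "Min (insert 1 (d ` X)) \<le> c" using that X(2) by (intro Min_le) auto
    moreover have "0 < c" using that d(1) by auto
    ultimately show ?thesis using \<eta> unfolding \<eta>_def by linarith
  qed
  have "dist (S y r) y \<le> e" if y: "y \<in> K" and r: "0 \<le> r" "r \<le> \<eta>" for y r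
  proof -
    obtain x where x: "x \<in> X" "dist x y < \<rho>" using X(3) y by auto
    have "exp (l * r) * dist (S x (0 + r)) (S y (0 + r)) \<le> dist (S x 0) (S y 0)"
      using r by (intro integrated_EVI_contraction[OF flow flow]) auto
    then have "exp (- (l * r)) * (exp (l * r) * dist (S x r) (S y r)) \<le> exp (- (l * r)) * dist x y"
      by (intro mult_left_mono) (auto simp: start)
    moreover have "exp (- (l * r)) * (exp (l * r) * dist (S x r) (S y r)) = dist (S x r) (S y r)"
      by (simp add: exp_minus)
    moreover have "exp (- (l * r)) * dist x y \<le> exp \<bar>l\<bar> * \<rho>"
      using x(2) r \<eta>_less[of 1] exp_mult_le_exp_abs[of r 1 "- l"] by (intro mult_mono) auto
    ultimately have "dist (S x r) (S y r) \<le> e / 3" using \<rho>e(1) by simp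
    moreover have "dist (S x r) x < e / 3"
      using r \<eta>_less[of "d x"] x(1) by (intro d(2)) auto
    ultimately show ?thesis
      using dist_triangle[of "S y r" y "S x r"] dist_triangle[of "S x r" y x] x(2) \<rho>e(2)
      by (simp add: dist_commute)
  qed
  with \<eta> show ?thesis by (rule that)
qed

end

section \<open>Moving the end points along geodesics\<close>

lemma energy_bound_dist_le:
  assumes M: "energy_bound 0 1 M y" and "M 1 - M 0 \<le> C" and s: "s \<in> {0..1}" and t: "t \<in> {0..1}"
  shows "dist (y s) (y t) \<le> sqrt (\<bar>s - t\<bar> * C)"
proof -
  have mono: "M a \<le> M b" if "0 \<le> a" "a \<le> b" "b \<le> 1" for a b
    using mono_onD[OF energy_bound_mono_on[OF M], of a b] that by simp
  have *: "dist (y s) (y t) \<le> sqrt (\<bar>s - t\<bar> * C)" if st: "0 \<le> s" "s \<le> t" "t \<le> 1" for s t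
  proof (rule real_le_rsqrt)
    have "(dist (y s) (y t))\<^sup>2 \<le> (t - s) * (M t - M s)" using st by (intro energy_boundD[OF M]) auto
    also have "\<dots> \<le> (t - s) * C"
      using st mono[of 0 s] mono[of t 1] assms(2) by (intro mult_left_mono) auto
    finally show "(dist (y s) (y t))\<^sup>2 \<le> \<bar>s - t\<bar> * C" using st by simp
  qed
  show ?thesis
    using *[of s t] *[of t s] s t by (cases "s \<le> t") (auto simp: dist_commute abs_minus_commute)
qed

lemma geodesic_spaceE:
  fixes x y :: "'a::metric_space"
  assumes "geodesic_space TYPE('a)"
  obtains g :: "real \<Rightarrow> 'a" where "g 0 = x" "g 1 = y"
    "\<And>s t. s \<in> {0..1} \<Longrightarrow> t \<in> {0..1} \<Longrightarrow> dist (g s) (g t) = \<bar>s - t\<bar> * dist x y"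
  using assms unfolding geodesic_space_def by metis

text \<open>
  Run through a geodesic from \<open>p\<close> to \<open>y 0\<close> on \<open>{0..a}\<close>, through \<open>y\<close> at higher speed on \<open>{a..1 - a}\<close>, and through a
  geodesic from \<open>y 1\<close> to \<open>q\<close> on \<open>{1 - a..1}\<close>. The clamped summands of \<open>R\<close> are active on one of these
  intervals each.
\<close>

lemma geodesic_extension:
  fixes y :: "real \<Rightarrow> 'a::metric_space" and p q :: 'a
  assumes geo: "geodesic_space TYPE('a)" and M: "energy_bound 0 1 M y" and C: "M 1 - M 0 \<le> C"
    and a: "0 < a" "a < 1/2"
  obtains \<gamma> R where "energy_bound 0 1 R \<gamma>" "\<gamma> 0 = p" "\<gamma> 1 = q"
    "R 1 - R 0 \<le> (dist p (y 0))\<^sup>2 / a + (dist (y 1) q)\<^sup>2 / a + C / (1 - 2 * a)"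
    "\<And>t. t \<in> {0..1} \<Longrightarrow> dist (\<gamma> t) (y t) \<le> dist p (y 0) + dist (y 1) q + sqrt (a / (1 - 2 * a) * C)"
proof -
  obtain g0 :: "real \<Rightarrow> 'a" where g0: "g0 0 = p" "g0 1 = y 0"
    "\<And>s t. s \<in> {0..1} \<Longrightarrow> t \<in> {0..1} \<Longrightarrow> dist (g0 s) (g0 t) = \<bar>s - t\<bar> * dist p (y 0)"
    using geodesic_spaceE[OF geo, of p "y 0"] by blast
  obtain g1 :: "real \<Rightarrow> 'a" where g1: "g1 0 = y 1" "g1 1 = q"
    "\<And>s t. s \<in> {0..1} \<Longrightarrow> t \<in> {0..1} \<Longrightarrow> dist (g1 s) (g1 t) = \<bar>s - t\<bar> * dist (y 1) q"
    using geodesic_spaceE[OF geo, of "y 1" q] by blast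
  define k where "k = 1 - 2 * a"
  have k: "0 < k" using a by (simp add: k_def)
  define d0 d1 where "d0 = dist p (y 0)" and "d1 = dist (y 1) q"
  define \<gamma> where "\<gamma> t = (if t < a then g0 (t / a) else if t
      \<le> 1 - a then y ((t - a) / k) else g1 ((t - (1 - a)) / a))" for t
  define R where "R t = d0\<^sup>2 / a\<^sup>2 * min t a + M (max 0 (min 1 ((t - a) / k))) / k + d1\<^sup>2 / a\<^sup>2 *
      max 0 (t - (1 - a))" for t
  have kk: "(1 - a - a) / k = 1" using k by (simp add: k_def)
  have \<gamma>0: "\<gamma> t = g0 (t / a)" if "t \<le> a" for t
    using that a g0(2) by (auto simp: \<gamma>_def)
  have \<gamma>1: "\<gamma> t = g1 ((t - (1 - a)) / a)" if "1 - a \<le> t" for t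
    using that a g1(1) kk by (cases "t = 1 - a") (auto simp: \<gamma>_def)
  have \<gamma>m: "\<gamma> t = y ((t - a) / k)" if "a \<le> t" "t \<le> 1 - a" for t
    using that by (simp add: \<gamma>_def)
  have in01: "(t - a) / k \<in> {0..1}" if "a \<le> t" "t \<le> 1 - a" for t
    using that k by (simp add: k_def field_simps)
  have 1: "energy_bound 0 a R \<gamma>"
    unfolding energy_bound_def
  proof (intro allI impI)
    fix s t assume st: "0 \<le> s \<and> s \<le> t \<and> t \<le> a"
    have "dist (\<gamma> s) (\<gamma> t) = \<bar>s / a - t / a\<bar> * d0"
      using st a by (simp add: \<gamma>0 g0(3) d0_def)
    also have "\<bar>s / a - t / a\<bar> = (t - s) / a"
      using st a by (simp add: diff_divide_distrib[symmetric] abs_divide)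
    finally have "(dist (\<gamma> s) (\<gamma> t))\<^sup>2 = (t - s) * (d0\<^sup>2 / a\<^sup>2 * (t - s))"
      by (simp add: power_mult_distrib power_divide) (simp add: power2_eq_square)
    moreover have "R t - R s = d0\<^sup>2 / a\<^sup>2 * (t - s)"
    proof -
      have "(t - a) / k \<le> 0" "(s - a) / k \<le> 0"
        using st k by (intro divide_nonpos_pos; simp)+
      then have "max 0 (min 1 ((t - a) / k)) = 0" "max 0 (min 1 ((s - a) / k)) = 0"
        by linarith+
      then show ?thesis using st a unfolding R_def by (simp add: right_diff_distrib)
    qed
    ultimately show "(dist (\<gamma> s) (\<gamma> t))\<^sup>2 \<le> (t - s) * (R t - R s)" by simp
  qed
  have 2: "energy_bound a (1 - a) R \<gamma>"
    unfolding energy_bound_def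
  proof (intro allI impI)
    fix s t assume st: "a \<le> s \<and> s \<le> t \<and> t \<le> 1 - a"
    have I: "(s - a) / k \<in> {0..1}" "(t - a) / k \<in> {0..1}" using in01 st by auto
    have le: "(s - a) / k \<le> (t - a) / k" using st k by (simp add: divide_right_mono)
    have "(dist (\<gamma> s) (\<gamma> t))\<^sup>2 \<le> ((t - a) / k - (s - a) / k) * (M ((t - a) / k) - M ((s - a) / k))"
      using st I le by (simp add: \<gamma>m energy_boundD[OF M])
    also have "(t - a) / k - (s - a) / k = (t - s) / k"
        by (simp add: diff_divide_distrib[symmetric])
    also have "(t - s) / k * (M ((t - a) / k) - M ((s - a) / k))
        = (t - s) * (M ((t - a) / k) / k - M ((s - a) / k) / k)"
      by (simp only: diff_divide_distrib[symmetric,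
          of "M _"] times_divide_eq_left times_divide_eq_right)
    also have "M ((t - a) / k) / k - M ((s - a) / k) / k = R t - R s"
    proof -
      have "max 0 (min 1 ((t - a) / k)) = (t - a) / k" "max 0 (min 1 ((s - a) / k)) = (s - a) / k"
        using I by auto
      moreover have "min t a = a" "min s a = a" "max 0 (t - (1 - a)) = 0" "max 0 (s - (1 - a)) = 0"
        using st by auto
      ultimately show ?thesis unfolding R_def by (simp only:)
    qed
    finally show "(dist (\<gamma> s) (\<gamma> t))\<^sup>2 \<le> (t - s) * (R t - R s)" .
  qed
  have 3: "energy_bound (1 - a) 1 R \<gamma>"
    unfolding energy_bound_def
  proof (intro allI impI)
    fix s t assume st: "1 - a \<le> s \<and> s \<le> t \<and> t \<le> 1"
    have "dist (\<gamma> s) (\<gamma> t) = \<bar>(s - (1 - a)) / a - (t - (1 - a)) / a\<bar> * d1"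
      using st a by (simp add: \<gamma>1 g1(3) d1_def)
    also have "\<bar>(s - (1 - a)) / a - (t - (1 - a)) / a\<bar> = (t - s) / a"
      using st a by (simp add: diff_divide_distrib[symmetric] abs_divide)
    finally have "(dist (\<gamma> s) (\<gamma> t))\<^sup>2 = (t - s) * (d1\<^sup>2 / a\<^sup>2 * (t - s))"
      by (simp add: power_mult_distrib power_divide) (simp add: power2_eq_square)
    moreover have "R t - R s = d1\<^sup>2 / a\<^sup>2 * (t - s)"
    proof -
      have "1 \<le> (r - a) / k" if "1 - a \<le> r" for r using that k by (simp add: k_def field_simps)
      then have "max 0 (min 1 ((t - a) / k)) = 1" "max 0 (min 1 ((s - a) / k)) = 1"
        using st by (simp_all add: min_def)
      moreover have "min t a = a" "min s a = a" using st a by auto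
      ultimately show ?thesis using st unfolding R_def by (simp add: right_diff_distrib)
    qed
    ultimately show "(dist (\<gamma> s) (\<gamma> t))\<^sup>2 \<le> (t - s) * (R t - R s)" by simp
  qed
  have sq: "dist (y s) (y t) \<le> sqrt (a / k * C)" if "s \<in> {0..1}" "t \<in> {0..1}" "\<bar>s - t\<bar> \<le> a / k"
      for s t
  proof -
    have "0 \<le> C" using C mono_onD[OF energy_bound_mono_on[OF M], of 0 1] by simp
    then have "\<bar>s - t\<bar> * C \<le> a / k * C" using that(3) by (intro mult_right_mono)
    then show ?thesis
      using energy_bound_dist_le[OF M C that(1,2)] by (meson order_trans real_sqrt_le_mono)
  qed
  have ak: "a \<le> a / k" using a k by (simp add: k_def field_simps)
  show ?thesis
  proof (rule that[of R \<gamma>])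
    show "energy_bound 0 1 R \<gamma>"
      using energy_bound_combine[OF energy_bound_combine[OF 1 2] 3] .
    show "\<gamma> 0 = p" using \<gamma>0[of 0] a g0(1) by simp
    show "\<gamma> 1 = q" using \<gamma>1[of 1] a g1(2) by simp
    have "R 1 - R 0 = d0\<^sup>2 / a\<^sup>2 * a + (M 1 - M 0) / k + d1\<^sup>2 / a\<^sup>2 * a"
    proof -
      have "1 \<le> (1 - a) / k" "(0 - a) / k \<le> 0" using a k by (simp_all add: k_def field_simps)
      then have "max 0 (min 1 ((1 - a) / k)) = 1" "max 0 (min 1 ((0 - a) / k)) = 0"
        by (simp_all add: min_def)
      then show ?thesis using a unfolding R_def by (simp add: diff_divide_distrib)
    qed
    also have "\<dots> \<le> d0\<^sup>2 / a + C / k + d1\<^sup>2 / a"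
      using C k a by (simp add: power2_eq_square divide_right_mono)
    finally show "R 1 - R 0 \<le> (dist p (y 0))\<^sup>2 / a + (dist (y 1) q)\<^sup>2 / a + C / (1 - 2 * a)"
      by (simp add: d0_def d1_def k_def)
    fix t :: real assume t: "t \<in> {0..1}"
    have "dist (\<gamma> t) (y t) \<le> d0 + d1 + sqrt (a / k * C)"
    proof -
      have d: "0 \<le> d0" "0 \<le> d1" by (simp_all add: d0_def d1_def)
      consider "t \<le> a" | "a \<le> t" "t \<le> 1 - a" | "1 - a \<le> t" by linarith
      then show ?thesis
      proof cases
        case 1
        have "dist (g0 (t / a)) (g0 1) = \<bar>t / a - 1\<bar> * d0"
          using 1 t a by (simp add: g0(3) d0_def)
        also have "\<dots> \<le> 1 * d0" using 1 t a d by (intro mult_right_mono) auto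
        finally have "dist (\<gamma> t) (y 0) \<le> d0" using \<gamma>0[OF 1] g0(2) by simp
        moreover have "dist (y 0) (y t) \<le> sqrt (a / k * C)" using 1 t ak by (intro sq) auto
        ultimately show ?thesis using dist_triangle[of "\<gamma> t" "y t" "y 0"] d by linarith
      next
        case 2
        have "\<bar>(t - a) / k - t\<bar> \<le> a / k"
        proof -
          have "(t - a) / k - t = a * (2 * t - 1) / k" using k by (simp add: k_def field_simps)
          moreover have "\<bar>a * (2 * t - 1)\<bar> \<le> a * 1" unfolding abs_mult using a t
              by (intro mult_mono) auto
          ultimately show ?thesis using k by (simp add: abs_divide divide_right_mono)
        qed
        then have "dist (y ((t - a) / k)) (y t) \<le> sqrt (a / k * C)"
          using in01[OF 2] t by (intro sq) auto
        then show ?thesis using \<gamma>m[OF 2] d by simp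
      next
        case 3
        have "dist (g1 ((t - (1 - a)) / a)) (g1 0) = \<bar>(t - (1 - a)) / a - 0\<bar> * d1"
          using 3 t a by (intro g1(3)[folded d1_def]) (auto simp: divide_le_eq)
        also have "\<dots> \<le> 1 * d1" using 3 t a d by (intro mult_right_mono) (auto simp: divide_le_eq)
        finally have "dist (\<gamma> t) (y 1) \<le> d1" using \<gamma>1[OF 3] g1(1) by simp
        moreover have "dist (y 1) (y t) \<le> sqrt (a / k * C)" using 3 t ak by (intro sq) auto
        ultimately show ?thesis using dist_triangle[of "\<gamma> t" "y t" "y 1"] d by linarith
      qed
    qed
    then show "dist (\<gamma> t) (y t) \<le> dist p (y 0) + dist (y 1) q + sqrt (a / (1 - 2 * a) * C)"
      by (simp add: d0_def d1_def k_def)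
  qed
qed

section \<open>The lower bound\<close>

lemma descending_slope_zero: "descending_slope (\<lambda>_. 0) x = 0"
proof (cases "x isolated_in UNIV")
  case True
  then show ?thesis by (simp add: descending_slope_def effective_domain_def)
next
  case False
  have "at x \<noteq> bot"
    using False unfolding isolated_in_def by (metis UNIV_I at_eq_bot_iff Int_UNIV_right)
  moreover have "(\<lambda>y. max (- (0 - 0)) 0 / ereal (dist y x)) = (\<lambda>_. 0)"
    by (simp add: zero_ereal_def[symmetric])
  ultimately show ?thesis
    using False by (simp add: descending_slope_def effective_domain_def Limsup_const)
qed

lemma Theta_zero:
  "Theta (\<lambda>_. 0) x0 x1 \<gamma> =
     (if ac_curve_on 0 1 \<gamma> \<and> \<gamma> 0 = x0 \<and> \<gamma> 1 = x1
      then \<integral>\<^sup>+t\<in>{0..1}. (ennreal (metric_derivative \<gamma> t))\<^sup>2 \<partial>lborel else \<infinity>)"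
proof -
  have "e2ennreal 0 = 0" by (metis e2ennreal_ereal ennreal_0 zero_ereal_def)
  then show ?thesis by (simp add: Theta_def descending_slope_zero)
qed

lemma limitin_curve_space_iff:
  fixes ys :: "nat \<Rightarrow> real \<Rightarrow> 'a::metric_space"
  assumes y: "y \<in> mspace curve_space" and ys: "range ys \<subseteq> mspace curve_space"
  shows "limitin (mtopology_of curve_space) ys y sequentially \<longleftrightarrow>
    (\<forall>e>0. eventually (\<lambda>h. \<forall>t\<in>{0..1}. dist (ys h t) (y t) \<le> e) sequentially)"
proof -
  interpret Metric_space "mspace (curve_space :: (real \<Rightarrow> 'a) metric)" "mdist curve_space"
    by (rule Metric_space_mspace_mdist)
  have ysm: "ys h \<in> mspace curve_space" for h using ys by auto
  have md: "mdist curve_space (ys h) y \<le> e \<longleftrightarrow> (\<forall>t\<in>{0..1}. dist (ys h t) (y t) \<le> e)" for h e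
    using cfunspace_mdist_le[of "ys h" "top_of_set {0..1}" euclidean_metric y e] ysm[of h] y
    unfolding curve_space_def by simp
  have "limitin (mtopology_of curve_space) ys y sequentially \<longleftrightarrow>
     (\<forall>e>0. eventually (\<lambda>h. mdist curve_space (ys h) y < e) sequentially)"
    unfolding mtopology_of_def limitin_metric using y ysm by simp
  also have "\<dots> \<longleftrightarrow> (\<forall>e>0. eventually (\<lambda>h. mdist curve_space (ys h) y \<le> e) sequentially)"
  proof (intro iffI allI impI)
    fix e :: real assume "\<forall>e>0. eventually (\<lambda>h. mdist curve_space (ys h) y \<le> e) sequentially" "0
        < e"
    moreover have "0 < e / 2" using \<open>0 < e\<close> by simp
    ultimately have "eventually (\<lambda>h. mdist curve_space (ys h) y \<le> e / 2) sequentially" by blast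
    then show "eventually (\<lambda>h. mdist curve_space (ys h) y < e) sequentially"
      by eventually_elim (use \<open>0 < e\<close> in simp)
  next
    fix e :: real assume "\<forall>e>0. eventually (\<lambda>h. mdist curve_space (ys h) y < e) sequentially" "0
        < e"
    then have "eventually (\<lambda>h. mdist curve_space (ys h) y < e) sequentially" by blast
    then show "eventually (\<lambda>h. mdist curve_space (ys h) y \<le> e) sequentially"
      by (rule eventually_mono) simp
  qed
  finally show ?thesis by (simp add: md)
qed

lemma kinetic_energy_le_Theta:
  assumes "Theta f x0 x1 \<gamma> < \<infinity>"
  shows "ac_curve_on 0 1 \<gamma>" "\<gamma> 0 = x0" "\<gamma> 1 = x1"
    "(\<integral>\<^sup>+t\<in>{0..1}. (ennreal (metric_derivative \<gamma> t))\<^sup>2 \<partial>lborel) \<le> Theta f x0 x1 \<gamma>"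
proof -
  show *: "ac_curve_on 0 1 \<gamma>" "\<gamma> 0 = x0" "\<gamma> 1 = x1"
    using assms by (auto simp: Theta_def split: if_splits)
  then show "(\<integral>\<^sup>+t\<in>{0..1}. (ennreal (metric_derivative \<gamma> t))\<^sup>2 \<partial>lborel) \<le> Theta f x0 x1 \<gamma>"
    by (auto simp: Theta_def intro!: nn_integral_mono split: split_indicator)
qed

text \<open>
  If infinitely many of the values were at most some \<open>c\<close> smaller than the limit functional, the closure of
  energy bounds would give \<open>y\<close> an energy of at most \<open>c\<close>.
\<close>

lemma Theta_liminf:
  fixes y :: "real \<Rightarrow> 'a::metric_space"
  assumes x0: "x0h \<longlonglongrightarrow> x0" and x1: "x1h \<longlonglongrightarrow> x1"
    and conv: "\<And>e. 0 < e \<Longrightarrow> eventually (\<lambda>h. \<forall>t\<in>{0..1}. dist (ys h t) (y t) \<le> e) sequentially"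
  shows "Theta (\<lambda>_. 0) x0 x1 y \<le> liminf (\<lambda>h. Theta (fh h) (x0h h) (x1h h) (ys h))"
  unfolding le_Liminf_iff
proof (intro allI impI)
  fix c assume c: "c < Theta (\<lambda>_. 0) x0 x1 y"
  show "eventually (\<lambda>h. c < Theta (fh h) (x0h h) (x1h h) (ys h)) sequentially"
  proof (rule ccontr)
    assume "\<not> eventually (\<lambda>h. c < Theta (fh h) (x0h h) (x1h h) (ys h)) sequentially"
    then have freq: "frequently (\<lambda>h. Theta (fh h) (x0h h) (x1h h) (ys h) \<le> c) sequentially"
      by (simp add: frequently_def not_le)
    define C where "C = enn2real c"
    have cC: "c = ennreal C" "0 \<le> C" using c by (auto simp: C_def less_top[symmetric]
        ennreal_enn2real_if)
    have near: "\<exists>h. Theta (fh h) (x0h h) (x1h h) (ys h) \<le> c \<and> (\<forall>t\<in>{0..1}. dist (ys h t) (y t) \<le> e) \<and>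
        dist (x0h h) x0 < e \<and> dist (x1h h) x1 < e" if e: "0 < e" for e
    proof -
      have "eventually (\<lambda>h. (\<forall>t\<in>{0..1}. dist (ys h t) (y t) \<le> e) \<and> dist (x0h h) x0 < e \<and>
          dist (x1h h) x1 < e) sequentially"
        using conv[OF e] tendstoD[OF x0 e] tendstoD[OF x1 e] by eventually_elim blast
      from frequently_ex[OF frequently_eventually_frequently[OF freq this]] show ?thesis by blast
    qed
    have fin: "Theta (fh h) (x0h h) (x1h h) (ys h) < \<infinity>" if "Theta (fh h) (x0h h) (x1h h) (ys h) \<le> c"
        for h
      using that cC by (auto intro: order.strict_trans1)
    have "\<exists>z R. energy_bound 0 1 R z \<and> R 1 - R 0 \<le> C \<and> (\<forall>t\<in>{0..1}. dist (z t) (y t) \<le> e)" if e: "0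
        < e" for e
    proof -
      obtain h where h: "Theta (fh h) (x0h h) (x1h h) (ys h) \<le> c" "\<forall>t\<in>{0..1}. dist (ys h t) (y t)
          \<le> e"
        using near[OF e] by blast
      note k = kinetic_energy_le_Theta[OF fin[OF h(1)]]
      obtain M where "energy_bound 0 1 M (ys h)" "M 1 - M 0 \<le> C"
        using finite_energy_imp_energy_bound[OF k(1) _ cC(2)] order_trans[OF k(4) h(1)] cC(1)
            by metis
      then show ?thesis using h(2) by blast
    qed
    from energy_bound_closure[OF this] obtain M where ac: "ac_curve_on 0 1 y"
        and M: "energy_bound 0 1 M y" "M 1 - M 0 \<le> C"
      by blast
    have "y 0 = x0 \<and> y 1 = x1"
    proof -
      have "dist (y 0) x0 \<le> 2 * e \<and> dist (y 1) x1 \<le> 2 * e" if e: "0 < e" for e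
      proof -
        obtain h where h: "Theta (fh h) (x0h h) (x1h h) (ys h) \<le> c" "\<forall>t\<in>{0..1}. dist (ys h t) (y t)
            \<le> e"
          "dist (x0h h) x0 < e" "dist (x1h h) x1 < e"
          using near[OF e] by blast
        have "ys h 0 = x0h h" "ys h 1 = x1h h" using kinetic_energy_le_Theta[OF fin[OF h(1)]]
            by auto
        moreover have "dist (ys h 0) (y 0) \<le> e" "dist (ys h 1) (y 1) \<le> e" using h(2) by auto
        ultimately show ?thesis
          using dist_triangle[of "y 0" x0 "ys h 0"] dist_triangle[of "y 1" x1 "ys h 1"] h(3,4)
          by (simp add: dist_commute)
      qed
      then have "dist (y 0) x0 \<le> 0 + e \<and> dist (y 1) x1 \<le> 0 + e" if "0 < e" for e
        using that by (metis add_0 field_sum_of_halves half_gt_zero mult_2)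
      then have "dist (y 0) x0 \<le> 0" "dist (y 1) x1 \<le> 0" by (meson field_le_epsilon)+
      then show ?thesis by simp
    qed
    then have "Theta (\<lambda>_. 0) x0 x1 y = (\<integral>\<^sup>+t\<in>{0..1}. (ennreal (metric_derivative y t))\<^sup>2 \<partial>lborel)"
      using ac by (simp add: Theta_zero)
    also have "\<dots> \<le> ennreal (M 1 - M 0)" by (rule kinetic_energy_le[OF ac M(1)])
    also have "\<dots> \<le> c" unfolding cC(1) using M(2) by (rule ennreal_leI)
    finally show False using c by simp
  qed
qed

section \<open>Recovery sequences\<close>

context EVI_flow
begin

lemma regularised_curve_near:
  assumes near: "\<And>t r. t \<in> {0..1} \<Longrightarrow> 0 \<le> r \<Longrightarrow> r \<le> \<eta> \<Longrightarrow> dist (S (y t) r) (y t) \<le> e"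
    and \<epsilon>: "0 < \<epsilon>" "\<epsilon> \<le> \<eta>" "\<epsilon> \<le> 1" and \<gamma>: "\<And>t. t \<in> {0..1} \<Longrightarrow> dist (\<gamma> t) (y t) \<le> b"
        and t: "t \<in> {0..1}"
  shows "dist (regularised_curve S \<epsilon> \<gamma> t) (y t) \<le> exp \<bar>l\<bar> * b + e"
proof -
  let ?r = "2 * \<epsilon> * min t (1 - t)"
  have "2 * min t (1 - t) \<le> 1" by (cases "t \<le> 1 - t") auto
  then have "\<epsilon> * (2 * min t (1 - t)) \<le> \<epsilon> * 1" using \<epsilon>(1) by (intro mult_left_mono) auto
  then have r: "0 \<le> ?r" "?r \<le> \<epsilon>" using t \<epsilon>(1) by (simp_all add: mult_ac)
  have "exp (l * ?r) * dist (S (\<gamma> t) (0 + ?r)) (S (y t) (0 + ?r)) \<le> dist (S (\<gamma> t) 0) (S (y t) 0)"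
    using r by (intro integrated_EVI_contraction[OF flow flow]) auto
  then have "exp (- (l * ?r)) * (exp (l * ?r) * dist (S (\<gamma> t) ?r) (S (y t) ?r))
      \<le> exp (- (l * ?r)) * dist (\<gamma> t) (y t)"
    by (intro mult_left_mono) (auto simp: start)
  moreover have "exp (- (l * ?r)) * (exp (l * ?r) * dist (S (\<gamma> t) ?r) (S (y t) ?r))
      = dist (S (\<gamma> t) ?r) (S (y t) ?r)"
    by (simp add: exp_minus)
  moreover have "exp (- (l * ?r)) * dist (\<gamma> t) (y t) \<le> exp \<bar>l\<bar> * b"
  proof (rule mult_mono[OF _ \<gamma>[OF t]])
    have "?r \<le> 1" using r(2) \<epsilon>(3) by linarith
    then show "exp (- (l * ?r)) \<le> exp \<bar>l\<bar>"
      using exp_mult_le_exp_abs[OF r(1), of 1 "- l"] by simp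
  qed simp_all
  ultimately have "dist (S (\<gamma> t) ?r) (S (y t) ?r) \<le> exp \<bar>l\<bar> * b" by simp
  moreover have "?r \<le> \<eta>" using r(2) \<epsilon>(2) by linarith
  then have "dist (S (y t) ?r) (y t) \<le> e" by (rule near[OF t r(1)])
  ultimately show ?thesis
    using dist_triangle[of "S (\<gamma> t) ?r" "y t" "S (y t) ?r"] t by (simp add: regularised_curve_def)
qed

text \<open>
  With \<open>a h\<close> dominating the distances of the end points from their limits, the geodesic pieces cost at most
  \<open>d0 h + d1 h\<close>, and the time left for \<open>y\<close> tends to one. For the finitely many indices at which the
  construction is not available, the curve \<open>y\<close> itself is used.
\<close>

lemma Theta_recovery:
  fixes \<epsilon> :: "nat \<Rightarrow> real" and x0h x1h :: "nat \<Rightarrow> 'a"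
  assumes geo: "geodesic_space TYPE('a)"
    and eps: "\<And>h. 0 < \<epsilon> h" "\<epsilon> \<longlonglongrightarrow> 0"
    and x0: "x0h \<longlonglongrightarrow> x0" and x1: "x1h \<longlonglongrightarrow> x1"
    and b0: "eventually (\<lambda>h. f (x0h h) \<le> ereal b0) sequentially"
    and b1: "eventually (\<lambda>h. f (x1h h) \<le> ereal b1) sequentially"
    and y: "y \<in> mspace curve_space" and fin: "Theta (\<lambda>_. 0) x0 x1 y < \<infinity>"
  shows "\<exists>ys. range ys \<subseteq> mspace curve_space \<and> limitin (mtopology_of curve_space) ys y sequentially \<and>
     limsup (\<lambda>h. Theta (\<lambda>x. ereal (\<epsilon> h) * f x) (x0h h) (x1h h) (ys h)) \<le> Theta (\<lambda>_. 0) x0 x1 y"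
proof -
  note k = kinetic_energy_le_Theta[OF fin]
  define C where "C = enn2real (Theta (\<lambda>_. 0) x0 x1 y)"
  have C: "Theta (\<lambda>_. 0) x0 x1 y = ennreal C" "0 \<le> C" using fin by (auto simp: C_def)
  obtain M where M: "energy_bound 0 1 M y" "M 1 - M 0 \<le> C"
    using finite_energy_imp_energy_bound[OF k(1) _ C(2)] k(4) C(1) by metis
  define d0 d1 a where "d0 h = dist (x0h h) x0" and "d1 h = dist x1 (x1h h)"
    and "a h = d0 h + d1 h + 1 / real (Suc h)" for h
  have d0: "d0 \<longlonglongrightarrow> 0" and d1: "d1 \<longlonglongrightarrow> 0"
    using x0 x1 unfolding d0_def[abs_def] d1_def[abs_def]
        by (simp_all add: tendsto_dist_iff[symmetric] dist_commute[of x1])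
  have a: "a \<longlonglongrightarrow> 0"
    using tendsto_add[OF tendsto_add[OF d0 d1] LIMSEQ_Suc[OF lim_const_over_n[of 1]]]
    unfolding a_def[abs_def] by simp
  have d_nonneg: "0 \<le> d0 h" "0 \<le> d1 h" for h by (simp_all add: d0_def d1_def)
  have a_pos: "0 < a h" "d0 h \<le> a h" "d1 h \<le> a h" for h
    using d_nonneg[of h] by (auto simp: a_def intro: add_nonneg_pos)
  define good where "good h \<longleftrightarrow> a h < 1/2 \<and> \<epsilon> h \<le> 1 \<and> f (x0h h) \<le> ereal b0 \<and> f (x1h h) \<le> ereal b1"
      for h
  have good_ev: "eventually good sequentially"
    using order_tendstoD(2)[OF a half_gt_zero[OF zero_less_one]] order_tendstoD(2)[OF eps(2)
        zero_less_one] b0 b1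
    by (eventually_elim) (simp add: good_def)
  define b where "b h = d0 h + d1 h + sqrt (a h / (1 - 2 * a h) * C)" for h
  have b_lim: "b \<longlonglongrightarrow> 0"
  proof -
    have "b \<longlonglongrightarrow> 0 + 0 + sqrt (0 / (1 - 2 * 0) * C)"
      unfolding b_def[abs_def] by (intro tendsto_intros d0 d1 a) simp
    then show ?thesis by simp
  qed
  have "\<exists>\<gamma> R. energy_bound 0 1 R \<gamma> \<and> \<gamma> 0 = x0h h \<and> \<gamma> 1 = x1h h \<and>
      R 1 - R 0 \<le> d0 h + d1 h + C / (1 - 2 * a h) \<and> (\<forall>t\<in>{0..1}. dist (\<gamma> t) (y t) \<le> b h)"
          if h: "good h" for h
  proof -
    have ah: "a h < 1/2" using h by (simp add: good_def)
    obtain \<gamma> R where g: "energy_bound 0 1 R \<gamma>" "\<gamma> 0 = x0h h" "\<gamma> 1 = x1h h"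
      "R 1 - R 0 \<le> (dist (x0h h) (y 0))\<^sup>2 / a h + (dist (y 1) (x1h h))\<^sup>2 / a h + C / (1 - 2 * a h)"
      "\<And>t. t \<in> {0..1} \<Longrightarrow> dist (\<gamma> t) (y t) \<le> dist (x0h h) (y 0) + dist (y 1) (x1h h) + sqrt (a h / (1
          - 2 * a h) * C)"
      by (rule geodesic_extension[OF geo M a_pos(1) ah, of "x0h h" "x1h h"]) (rule that; assumption)
    have "(d0 h)\<^sup>2 / a h \<le> d0 h" "(d1 h)\<^sup>2 / a h \<le> d1 h"
      using a_pos[of h] d_nonneg[of h] by (simp_all add: power2_eq_square divide_le_eq
          mult_left_mono)
    then have "R 1 - R 0 \<le> d0 h + d1 h + C / (1 - 2 * a h)"
      using g(4) unfolding k(2,3) d0_def[symmetric] d1_def[symmetric] by linarith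
    moreover have "dist (\<gamma> t) (y t) \<le> b h" if "t \<in> {0..1}" for t
      using g(5)[OF that] unfolding k(2,3) b_def d0_def d1_def .
    ultimately show ?thesis using g(1-3) by blast
  qed
  then obtain \<gamma> R where g: "\<And>h. good h \<Longrightarrow> energy_bound 0 1 (R h) (\<gamma> h)" "\<And>h. good h \<Longrightarrow> \<gamma> h 0 = x0h h"
     "\<And>h. good h \<Longrightarrow> \<gamma> h 1 = x1h h" "\<And>h. good h \<Longrightarrow> R h 1 - R h 0 \<le> d0 h + d1 h + C / (1 - 2 * a h)"
     "\<And>h t. good h \<Longrightarrow> t \<in> {0..1} \<Longrightarrow> dist (\<gamma> h t) (y t) \<le> b h"
    by metis
  define u where "u h = regularised_curve S (\<epsilon> h) (\<gamma> h)" for h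
  define ys where "ys h = (if good h then u h else y)" for h
  have dom: "\<gamma> h 0 \<in> effective_domain f" "\<gamma> h 1 \<in> effective_domain f" if "good h" for h
    using that g(2,3)[OF that] by (auto simp: good_def effective_domain_def intro:
        order.strict_trans1)
  have um: "u h \<in> mspace curve_space" if "good h" for h
  proof -
    have "ac_curve_on 0 1 (u h)"
      unfolding u_def by (rule Theta_regularised_curve_le(2)[OF dom[OF that] eps(1) g(1)[OF that]])
    then have "continuous_on {0..1} (u h)" by (rule ac_curve_on_imp_continuous_on)
    then show ?thesis by (simp add: mspace_curve_space u_def regularised_curve_def)
  qed
  then have ysm: "range ys \<subseteq> mspace curve_space" using y by (auto simp: ys_def)
  have y_cont: "continuous_on {0..1} y" using y by (simp add: mspace_curve_space)
  have unif: "eventually (\<lambda>h. \<forall>t\<in>{0..1}. dist (ys h t) (y t) \<le> e) sequentially" if e: "0 < e" for e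
  proof -
    have "compact (y ` {0..1})" using y_cont by (intro compact_continuous_image) auto
    then obtain \<eta> where \<eta>: "0 < \<eta>" "\<And>x r. x \<in> y ` {0..1} \<Longrightarrow> 0 \<le> r \<Longrightarrow> r \<le> \<eta> \<Longrightarrow> dist (S x r) x \<le> e / 2"
      using flow_uniformly_near_start[of "y ` {0..1}" "e / 2"] e by (metis half_gt_zero)
    have "(\<lambda>h. exp \<bar>l\<bar> * b h) \<longlonglongrightarrow> exp \<bar>l\<bar> * 0" by (intro tendsto_mult tendsto_const b_lim)
    then have "eventually (\<lambda>h. exp \<bar>l\<bar> * b h < e / 2) sequentially"
      using e by (intro order_tendstoD(2)[of _ 0]) auto
    moreover have "eventually (\<lambda>h. \<epsilon> h < \<eta>) sequentially"
        by (rule order_tendstoD(2)[OF eps(2) \<eta>(1)])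
    ultimately show ?thesis using good_ev
    proof eventually_elim
      case (elim h)
      have "dist (u h t) (y t) \<le> exp \<bar>l\<bar> * b h + e / 2" if t: "t \<in> {0..1}" for t
        unfolding u_def
        by (rule regularised_curve_near[where \<eta>=\<eta>]) (use \<eta>(2) elim eps(1) g(5) t in \<open>auto simp:
            good_def\<close>)
      then show ?case using elim by (force simp: ys_def)
    qed
  qed
  have lim: "limitin (mtopology_of curve_space) ys y sequentially"
    using unif by (simp add: limitin_curve_space_iff[OF y ysm])
  have "f (y (1/2)) \<noteq> - \<infinity>" using fm by blast
  then obtain b2 where b2: "ereal b2 < f (y (1/2))"
    by (metis ereal_dense2 less_ereal.simps(6) ereal_infty_less(2))
  have "eventually (\<lambda>h. ereal b2 < f (ys h (1/2))) sequentially"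
  proof -
    have "(\<lambda>h. ys h (1/2)) \<longlonglongrightarrow> y (1/2)"
    proof (rule tendstoI)
      fix e :: real assume "0 < e"
      then have "eventually (\<lambda>h. \<forall>t\<in>{0..1}. dist (ys h t) (y t) \<le> e / 2) sequentially"
          by (intro unif) simp
      then show "eventually (\<lambda>h. dist (ys h (1/2)) (y (1/2)) < e) sequentially"
      proof eventually_elim
        case (elim h)
        then have "dist (ys h (1/2)) (y (1/2)) \<le> e / 2" by simp
        then show ?case using \<open>0 < e\<close> by simp
      qed
    qed
    moreover have "open (- {x. f x \<le> ereal b2})"
      using lower_semicontinuous_closed_sublevel[OF lsc] by (rule open_Compl)
    ultimately have "eventually (\<lambda>h. ys h (1/2) \<in> - {x. f x \<le> ereal b2}) sequentially"
      using b2 by (intro topological_tendstoD) (auto simp: not_le)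
    then show ?thesis by eventually_elim (simp add: not_le)
  qed
  define B where "B h = exp (3 * \<bar>l\<bar> * \<epsilon> h) * (d0 h + d1 h + C / (1 - 2 * a h)) + 4 * \<epsilon> h * (b0 + b1
      - 2 * b2)" for h
  have "eventually (\<lambda>h. Theta (\<lambda>x. ereal (\<epsilon> h) * f x) (x0h h) (x1h h) (ys h) \<le> ennreal (B h))
      sequentially"
    using good_ev \<open>eventually (\<lambda>h. ereal b2 < f (ys h (1/2))) sequentially\<close>
  proof eventually_elim
    case (elim h)
    have F: "F (\<gamma> h 0) \<le> b0" "F (\<gamma> h 1) \<le> b1"
      using elim(1) dom[OF elim(1)] effective_domain_real[OF _ fm] g(2,3)[OF elim(1)]
          unfolding good_def
      by (metis ereal_less_eq(3))+
    have "u h (1/2) \<in> effective_domain f"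
      unfolding u_def by (rule regularised_curve_dom[OF dom[OF elim(1)] eps(1)]) simp
    then have "ereal b2 < ereal (F (u h (1/2)))"
      using effective_domain_real[OF _ fm] elim by (auto simp: ys_def)
    then have F2: "b2 \<le> F (u h (1/2))" by simp
    have "Theta (\<lambda>x. ereal (\<epsilon> h) * f x) (\<gamma> h 0) (\<gamma> h 1) (u h)
      \<le> ennreal (exp (3 * \<bar>l\<bar> * \<epsilon> h) * (R h 1 - R h 0) + 4 * \<epsilon> h * (F (\<gamma> h 0) + F (\<gamma> h 1) - 2 * F (u
          h (1/2))))"
      unfolding u_def by (rule Theta_regularised_curve_le(1)[OF dom[OF elim(1)] eps(1) g(1)[OF
          elim(1)]])
    also have "\<dots> \<le> ennreal (B h)"
      unfolding B_def using F F2 g(4)[OF elim(1)] eps(1)[of h]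
      by (intro ennreal_leI add_mono mult_left_mono) auto
    finally show ?case using elim g(2,3)[OF elim(1)] by (simp add: ys_def)
  qed
  then have "limsup (\<lambda>h. Theta (\<lambda>x. ereal (\<epsilon> h) * f x) (x0h h) (x1h h) (ys h))
      \<le> limsup (\<lambda>h. ennreal (B h))"
    by (rule Limsup_mono)
  also have "\<dots> = ennreal C"
  proof (rule lim_imp_Limsup)
    have "B \<longlonglongrightarrow> exp (3 * \<bar>l\<bar> * 0) * (0 + 0 + C / (1 - 2 * 0)) + 4 * 0 * (b0 + b1 - 2 * b2)"
      unfolding B_def[abs_def] by (intro tendsto_intros d0 d1 a eps(2)) simp
    then show "(\<lambda>h. ennreal (B h)) \<longlonglongrightarrow> ennreal C" by (intro tendsto_ennrealI) simp
  qed simp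
  finally show ?thesis using ysm lim C(1) by auto
qed

end

section \<open>Gamma-convergence\<close>

lemma limsup_le_imp_eventually_le_real:
  fixes X :: "nat \<Rightarrow> ereal"
  assumes "limsup X \<le> c" "c < \<infinity>"
  obtains b where "eventually (\<lambda>h. X h \<le> ereal b) sequentially"
proof -
  obtain b where "c < ereal b" using assms(2) by (metis ereal_dense2)
  then have "limsup X < ereal b" using assms(1) by (rule order.strict_trans1[rotated])
  then have "eventually (\<lambda>h. X h < ereal b) sequentially" by (rule Limsup_lessD)
  then show ?thesis by (intro that[of b]) (auto elim: eventually_mono)
qed

theorem theorem18:
  fixes f :: "'a::metric_space \<Rightarrow> ereal"
    and l :: real
    and \<epsilon> :: "nat \<Rightarrow> real"
    and x0h x1h :: "nat \<Rightarrow> 'a"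
    and x0 x1 :: 'a
  assumes geodesic: "geodesic_space TYPE('a)"
    and f_not_minf: "\<forall>x. f x \<noteq> -\<infinity>"
    and f_lsc: "lower_semicontinuous f"
    and f_EVI: "\<forall>x. \<exists>\<xi>. EVI_trajectory l f x \<xi>"
    and eps_pos: "\<forall>h. \<epsilon> h > 0"
    and eps_lim: "\<epsilon> \<longlonglongrightarrow> 0"
    and x0_lim: "x0h \<longlonglongrightarrow> x0"
    and x1_lim: "x1h \<longlonglongrightarrow> x1"
    and x0_limsup: "limsup (\<lambda>h. f (x0h h)) \<le> f x0" "f x0 < \<infinity>"
    and x1_limsup: "limsup (\<lambda>h. f (x1h h)) \<le> f x1" "f x1 < \<infinity>"
  shows "gamma_converges curve_space
           (\<lambda>h. Theta (\<lambda>x. ereal (\<epsilon> h) * f x) (x0h h) (x1h h))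
           (Theta (\<lambda>x. 0) x0 x1)"
proof -
  obtain S where S: "\<And>x. EVI_trajectory l f x (S x)" using f_EVI by metis
  interpret EVI_flow l f S
  proof
    show "integrated_EVI l f (S x)" for x
      by (rule EVI_trajectory_imp_integrated_EVI[OF S f_not_minf f_lsc])
    show "S x 0 = x" for x using S[of x] by (simp add: EVI_trajectory_def)
  qed (fact f_not_minf f_lsc)+
  obtain b0 where b0: "eventually (\<lambda>h. f (x0h h) \<le> ereal b0) sequentially"
    using limsup_le_imp_eventually_le_real[OF x0_limsup] .
  obtain b1 where b1: "eventually (\<lambda>h. f (x1h h) \<le> ereal b1) sequentially"
    using limsup_le_imp_eventually_le_real[OF x1_limsup] .
  show ?thesis
    unfolding gamma_converges_def
  proof (intro ballI conjI allI impI)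
    fix y :: "real \<Rightarrow> 'a" and ys :: "nat \<Rightarrow> real \<Rightarrow> 'a"
    assume y: "y \<in> mspace curve_space"
      and ys: "range ys \<subseteq> mspace curve_space \<and> limitin (mtopology_of curve_space) ys y sequentially"
    then have "eventually (\<lambda>h. \<forall>t\<in>{0..1}. dist (ys h t) (y t) \<le> e) sequentially" if "0 < e" for e
      using limitin_curve_space_iff[OF y] that by blast
    then show "Theta (\<lambda>x. 0) x0 x1 y \<le> liminf (\<lambda>h. Theta (\<lambda>x. ereal (\<epsilon> h) * f x) (x0h h) (x1h h) (ys
        h))"
      by (rule Theta_liminf[OF x0_lim x1_lim])
  next
    fix y :: "real \<Rightarrow> 'a" assume y: "y \<in> mspace curve_space"
    show "\<exists>ys. range ys \<subseteq> mspace curve_space \<and> limitin (mtopology_of curve_space) ys y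
        sequentially \<and>
       limsup (\<lambda>h. Theta (\<lambda>x. ereal (\<epsilon> h) * f x) (x0h h) (x1h h) (ys h)) \<le> Theta (\<lambda>x. 0) x0 x1 y"
    proof (cases "Theta (\<lambda>x. 0) x0 x1 y < \<infinity>")
      case True
      then show ?thesis
        using Theta_recovery[OF geodesic _ eps_lim x0_lim x1_lim b0 b1 y] eps_pos by blast
    next
      case False
      then have "Theta (\<lambda>x. 0) x0 x1 y = \<infinity>" by (simp add: less_top[symmetric])
      then show ?thesis
        using y limitin_curve_space_iff[of y "\<lambda>_. y"] by (intro exI[of _ "\<lambda>_. y"]) auto
    qed
  qed
qed

end
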